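(* Let $\mathcal{D}$ be a taut bounded convex domain in a complex Banach space $X$. Then the holomorphic sectional curvature of the Kobayashi infinitesimal metric $k_{\mathcal{D}}$ satisfies $$\kappa_k(x,v)=-4\qquad\text{for all }x\in\mathcal{D},\ 0\ne v\in X.$$
   Context: $\mathbb{D}$ is the open unit disc in $\mathbb{C}$; $H(\mathcal{D}_1,\mathcal{D}_2)$ is the set of holomorphic maps from $\mathcal{D}_1$ to $\mathcal{D}_2$. The Kobayashi infinitesimal metric of a domain $\mathcal{D}\subset X$ is, for $p\in\mathcal{D}$, $v\in X$, $$k_{\mathcal{D}}(p,v)=\inf\{\eta>0:\exists f\in H(\mathbb{D},\mathcal{D}),\ f(0)=p,\ f'(0)\eta=v\}.$$ For a bounded domain $\mathcal{D}$, the holomorphic sectional curvature of $k_{\mathcal{D}}$ at $x\in\mathcal{D}$ in the nonzero direction $v\in X$ is $$\kappa_k(x,v)=\sup\left\{\frac{\triangle\log k_{\mathcal{D}}^2(f(z),f'(z))\big|_{z=0}}{-2k_{\mathcal{D}}^2(f(0),f'(0))}: f\in H(r\mathbb{D},\mathcal{D}),\ r>0,\ f(0)=x,\ f'(0)=v\right\}.$$ Here $\triangle$ is the generalised Laplacian, defined for upper semicontinuous functions $u$ with values in $[-\infty,\infty)$ (not identically $-\infty$) at points $z$ with $u(z)\neq-\infty$ by $$\triangle u(z)=4\liminf_{r\to0^+}\frac1{r^2}\left\{\frac1{2\pi}\int_0^{2\pi}u(z+re^{i\theta})\,d\theta-u(z)\right\}.$$ A domain $\mathcal{D}$ in a Banach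 space $X$ is taut if there exists a Hausdorff locally convex topology $\tau$ on $X$ such that every net $(f_\alpha)_\alpha$ in $H(\mathbb{D},\mathcal{D})$ contains either a compactly divergent subnet or a subnet which converges with respect to $\tau$, uniformly on compact subsets of $\mathbb{D}$, to some $f\in H(\mathbb{D},\mathcal{D})$. A net $(f_\alpha)_{\alpha\in\Gamma}$ is compactly divergent if, given $K$ compact in $\mathbb{D}$ and $L$ a norm-compact subset of $\mathcal{D}$, there exists $\alpha_0\in\Gamma$ such that $f_\alpha(K)\cap L=\emptyset$ for all $\alpha\ge\alpha_0$. *)

theory Defs
  imports "HOL-Analysis.Analysis"
begin

section \<open>Complex Banach spaces\<close>

class complex_normed_vector = real_normed_vector +
  fixes scaleC :: "complex \<Rightarrow> 'a \<Rightarrow> 'a" (infixr "*\<^sub>C" 75)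
  assumes scaleC_add_right: "a *\<^sub>C (x + y) = a *\<^sub>C x + a *\<^sub>C y"
    and scaleC_add_left: "(a + b) *\<^sub>C x = a *\<^sub>C x + b *\<^sub>C x"
    and scaleC_scaleC: "a *\<^sub>C b *\<^sub>C x = (a * b) *\<^sub>C x"
    and scaleR_scaleC: "r *\<^sub>R x = complex_of_real r *\<^sub>C x"
    and norm_scaleC: "norm (a *\<^sub>C x) = cmod a * norm x"

class cbanach = complex_normed_vector + banach

instantiation complex :: cbanach
begin

definition scaleC_complex_def: "a *\<^sub>C (x :: complex) = a * x"

instance
  by standard (simp_all add: scaleC_complex_def algebra_simps norm_mult scaleR_conv_of_real)

end

section \<open>Holomorphic maps from plane domains\<close>

definition has_cderiv :: "(complex \<Rightarrow> 'a::complex_normed_vector) \<Rightarrow> 'a \<Rightarrow> complex \<Rightarrow> bool" where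
  "has_cderiv f f' z \<longleftrightarrow> (f has_derivative (\<lambda>h. h *\<^sub>C f')) (at z)"

definition cderiv :: "(complex \<Rightarrow> 'a::complex_normed_vector) \<Rightarrow> complex \<Rightarrow> 'a" where
  "cderiv f z = (THE f'. has_cderiv f f' z)"

lemma cderivI:
  assumes "has_cderiv f f' z"
  shows "cderiv f z = f'"
  unfolding cderiv_def
proof (rule the_equality)
  fix g' assume "has_cderiv f g' z"
  with assms have "(\<lambda>h. h *\<^sub>C f') = (\<lambda>h. h *\<^sub>C g')"
    unfolding has_cderiv_def by (rule has_derivative_unique)
  then have "1 *\<^sub>C f' = 1 *\<^sub>C g'" by metis
  then show "g' = f'" using scaleR_scaleC[of 1 f'] scaleR_scaleC[of 1 g'] by simp
qed (fact assms)

text \<open>Used for open \<open>S\<close> only.  The members are total functions, whose values outside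
  \<open>S\<close> are arbitrary.\<close>

definition hol_maps :: "complex set \<Rightarrow> 'a::complex_normed_vector set \<Rightarrow> (complex \<Rightarrow> 'a) set" where
  "hol_maps S D = {f. (\<forall>z\<in>S. \<exists>f'. has_cderiv f f' z) \<and> f ` S \<subseteq> D}"

section \<open>The Kobayashi infinitesimal metric and its curvature\<close>

text \<open>For open \<open>D\<close> and \<open>p \<in> D\<close> the infimum is over a nonempty set that is bounded below by 0.\<close>

definition kobayashi :: "'a::complex_normed_vector set \<Rightarrow> 'a \<Rightarrow> 'a \<Rightarrow> real" where
  "kobayashi D p v =
     Inf {\<eta>. \<eta> > 0 \<and> (\<exists>f\<in>hol_maps (ball 0 1) D. f 0 = p \<and> \<eta> *\<^sub>R cderiv f 0 = v)}"

lemma kobayashi_set_nonempty: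
  assumes "open D" "p \<in> D"
  shows "{\<eta>. \<eta> > 0 \<and> (\<exists>f\<in>hol_maps (ball 0 1) D. f 0 = p \<and> \<eta> *\<^sub>R cderiv f 0 = v)} \<noteq> {}"
proof -
  obtain e where e: "e > 0" "ball p e \<subseteq> D"
    using assms open_contains_ball by blast
  define t where "t = e / (1 + norm v)"
  have t: "t > 0" using e by (simp add: t_def add_pos_nonneg)
  define w where "w = t *\<^sub>R v"
  have nw: "norm w < e"
  proof -
    have "norm w = e * (norm v / (1 + norm v))" using e(1) by (simp add: w_def t_def add_pos_nonneg)
    also have "\<dots> < e * 1"
      using e(1) by (intro mult_strict_left_mono) (simp_all add: divide_less_eq add_pos_nonneg)
    finally show ?thesis by simp
  qed
  define f where "f = (\<lambda>z::complex. p + z *\<^sub>C w)"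
  have bl: "bounded_linear (\<lambda>z::complex. z *\<^sub>C w)"
  proof (rule bounded_linear_intro[where K = "norm w"])
    fix r :: real and x :: complex
    show "(r *\<^sub>R x) *\<^sub>C w = r *\<^sub>R (x *\<^sub>C w)"
      by (subst scaleR_conv_of_real) (simp add: scaleR_scaleC scaleC_scaleC)
  qed (simp_all add: scaleC_add_left norm_scaleC)
  have der: "has_cderiv f w z" for z
    unfolding has_cderiv_def f_def
    using has_derivative_add[OF has_derivative_const bounded_linear_imp_has_derivative[OF bl]]
    by simp
  have "f ` ball 0 1 \<subseteq> D"
  proof (intro subset_trans[OF _ e(2)] image_subsetI)
    fix z :: complex assume "z \<in> ball 0 1"
    then have "cmod z * norm w \<le> 1 * norm w"
      by (intro mult_right_mono) (simp_all add: dist_norm)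
    then show "f z \<in> ball p e"
      using nw by (simp add: f_def dist_norm norm_scaleC)
  qed
  with der have "f \<in> hol_maps (ball 0 1) D" by (auto simp: hol_maps_def)
  moreover have "f 0 = p" using linear_0[OF bounded_linear.linear[OF bl]] by (simp add: f_def)
  moreover have "(1 / t) *\<^sub>R cderiv f 0 = v"
    using t by (simp add: cderivI[OF der] w_def)
  moreover have "1 / t > 0" using t by simp
  ultimately show ?thesis by blast
qed

definition elog :: "real \<Rightarrow> ereal" where
  "elog t = (if t > 0 then ereal (ln t) else -\<infinity>)"

text \<open>The integral of an extended real function is the difference of the integrals of its
  positive and negative parts; \<open>e2ennreal\<close> sends negative arguments to 0.  For \<open>u\<close> upper
  semicontinuous and \<open>< \<infinity>\<close> near the circle the first of these is finite, so that the
  difference is a genuine one.\<close>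

definition circle_mean :: "(complex \<Rightarrow> ereal) \<Rightarrow> complex \<Rightarrow> real \<Rightarrow> ereal" where
  "circle_mean u z r = ereal (1 / (2 * pi)) *
     (enn2ereal (\<integral>\<^sup>+\<theta>\<in>{0..2*pi}. e2ennreal (u (z + of_real r * exp (\<i> * of_real \<theta>))) \<partial>lborel)
      - enn2ereal (\<integral>\<^sup>+\<theta>\<in>{0..2*pi}. e2ennreal (- u (z + of_real r * exp (\<i> * of_real \<theta>))) \<partial>lborel))"

definition gen_laplacian :: "(complex \<Rightarrow> ereal) \<Rightarrow> complex \<Rightarrow> ereal" where
  "gen_laplacian u z =
     4 * Liminf (at_right 0) (\<lambda>r. ereal (1 / r\<^sup>2) * (circle_mean u z r - u z))"

definition kobayashi_curvature :: "'a::complex_normed_vector set \<Rightarrow> 'a \<Rightarrow> 'a \<Rightarrow> ereal" where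
  "kobayashi_curvature D x v =
     Sup {gen_laplacian (\<lambda>z. elog ((kobayashi D (f z) (cderiv f z))\<^sup>2)) 0
            / ereal (- 2 * (kobayashi D (f 0) (cderiv f 0))\<^sup>2) | f r.
          r > 0 \<and> f \<in> hol_maps (ball 0 r) D \<and> f 0 = x \<and> cderiv f 0 = v}"

section \<open>Nets of holomorphic maps and tautness\<close>

definition directed_on :: "'i set \<Rightarrow> ('i \<Rightarrow> 'i \<Rightarrow> bool) \<Rightarrow> bool" where
  "directed_on I le \<longleftrightarrow> I \<noteq> {} \<and> (\<forall>a\<in>I. le a a)
     \<and> (\<forall>a\<in>I. \<forall>b\<in>I. \<forall>c\<in>I. le a b \<and> le b c \<longrightarrow> le a c)
     \<and> (\<forall>a\<in>I. \<forall>b\<in>I. \<exists>c\<in>I. le a c \<and> le b c)"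

text \<open>\<open>h\<close> turns a net \<open>f\<close> on \<open>I\<close> into the subnet \<open>f \<circ> h\<close> on \<open>J\<close>.\<close>

definition subnet_map ::
    "'i set \<Rightarrow> ('i \<Rightarrow> 'i \<Rightarrow> bool) \<Rightarrow> 'j set \<Rightarrow> ('j \<Rightarrow> 'j \<Rightarrow> bool) \<Rightarrow> ('j \<Rightarrow> 'i) \<Rightarrow> bool" where
  "subnet_map I leI J leJ h \<longleftrightarrow> directed_on J leJ \<and> h ` J \<subseteq> I
     \<and> (\<forall>a\<in>I. \<exists>j0\<in>J. \<forall>j\<in>J. leJ j0 j \<longrightarrow> leI a (h j))"

definition compactly_divergent ::
    "'a::complex_normed_vector set \<Rightarrow> 'i set \<Rightarrow> ('i \<Rightarrow> 'i \<Rightarrow> bool) \<Rightarrow> ('i \<Rightarrow> complex \<Rightarrow> 'a) \<Rightarrow> bool" where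
  "compactly_divergent D I le f \<longleftrightarrow>
     (\<forall>K L. compact K \<and> K \<subseteq> ball 0 1 \<and> compact L \<and> L \<subseteq> D \<longrightarrow>
        (\<exists>a0\<in>I. \<forall>a\<in>I. le a0 a \<longrightarrow> f a ` K \<inter> L = {}))"

definition converges_on_compacta ::
    "'a::complex_normed_vector topology \<Rightarrow> 'i set \<Rightarrow> ('i \<Rightarrow> 'i \<Rightarrow> bool)
      \<Rightarrow> ('i \<Rightarrow> complex \<Rightarrow> 'a) \<Rightarrow> (complex \<Rightarrow> 'a) \<Rightarrow> bool" where
  "converges_on_compacta \<tau> I le f g \<longleftrightarrow>
     (\<forall>K U. compact K \<and> K \<subseteq> ball 0 1 \<and> openin \<tau> U \<and> 0 \<in> U \<longrightarrow>
        (\<exists>a0\<in>I. \<forall>a\<in>I. le a0 a \<longrightarrow> (\<forall>z\<in>K. f a z - g z \<in> U)))"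

definition locally_convex_topology :: "'a::complex_normed_vector topology \<Rightarrow> bool" where
  "locally_convex_topology \<tau> \<longleftrightarrow> topspace \<tau> = UNIV
     \<and> continuous_map (prod_topology \<tau> \<tau>) \<tau> (\<lambda>(x, y). x + y)
     \<and> continuous_map (prod_topology euclidean \<tau>) \<tau> (\<lambda>(c, x). c *\<^sub>C x)
     \<and> (\<forall>U. openin \<tau> U \<and> 0 \<in> U \<longrightarrow> (\<exists>V. openin \<tau> V \<and> 0 \<in> V \<and> convex V \<and> V \<subseteq> U))"

definition has_taut_subnet ::
    "'a::complex_normed_vector topology \<Rightarrow> 'a set
      \<Rightarrow> 'i set \<Rightarrow> ('i \<Rightarrow> 'i \<Rightarrow> bool) \<Rightarrow> ('i \<Rightarrow> complex \<Rightarrow> 'a) \<Rightarrow> bool" where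
  "has_taut_subnet \<tau> D I le f \<longleftrightarrow>
     (\<exists>(J :: ('i \<times> (complex \<Rightarrow> 'a) set) set) leJ h. subnet_map I le J leJ h \<and>
        (compactly_divergent D J leJ (f \<circ> h)
         \<or> (\<exists>g\<in>hol_maps (ball 0 1) D. converges_on_compacta \<tau> J leJ (f \<circ> h) g)))"

text \<open>HOL cannot quantify over index types inside a formula, so the definition fixes, for nets
  and for subnets, index types that are large enough.  That this loses nothing is proved below:
  \<open>every_net_has_taut_subnet\<close> extends the property to nets over arbitrary index types, and
  \<open>has_taut_subnetI\<close> shows that a suitable subnet over an arbitrary index type yields one
  over the index type fixed in \<open>has_taut_subnet\<close>.\<close>

definition taut :: "'a::complex_normed_vector set \<Rightarrow> bool" where
  "taut D \<longleftrightarrow> (\<exists>\<tau>. locally_convex_topology \<tau> \<and> Hausdorff_space \<tau> \<and>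
     (\<forall>(I :: ((complex \<Rightarrow> 'a) set \<times> (complex \<Rightarrow> 'a)) set) le f.
        directed_on I le \<and> (\<forall>a\<in>I. f a \<in> hol_maps (ball 0 1) D) \<longrightarrow> has_taut_subnet \<tau> D I le f))"

lemma refining_net_imp_has_taut_subnet:
  fixes f :: "'i \<Rightarrow> complex \<Rightarrow> 'a::complex_normed_vector" and g :: "'j \<Rightarrow> complex \<Rightarrow> 'a"
  assumes I: "directed_on I le" and J: "directed_on J leJ"
    and refines: "\<And>a. a \<in> I \<Longrightarrow> \<exists>j0\<in>J. \<forall>j\<in>J. leJ j0 j \<longrightarrow> (\<exists>b\<in>I. le a b \<and> g j = f b)"
    and lim: "compactly_divergent D J leJ g
       \<or> (\<exists>g0\<in>hol_maps (ball 0 1) D. converges_on_compacta \<tau> J leJ g g0)"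
  shows "has_taut_subnet \<tau> D I le f"
proof -
  define ev where "ev = (\<lambda>U. \<exists>j0\<in>J. \<forall>j\<in>J. leJ j0 j \<longrightarrow> g j \<in> U)"
  have J_ne: "J \<noteq> {}" and J_refl: "\<And>j. j \<in> J \<Longrightarrow> leJ j j"
    and J_trans: "\<And>a b c. \<lbrakk>a \<in> J; b \<in> J; c \<in> J; leJ a b; leJ b c\<rbrakk> \<Longrightarrow> leJ a c"
    and J_dir: "\<And>a b. \<lbrakk>a \<in> J; b \<in> J\<rbrakk> \<Longrightarrow> \<exists>c\<in>J. leJ a c \<and> leJ b c"
    using J unfolding directed_on_def by blast+
  have I_ne: "I \<noteq> {}" and I_refl: "\<And>j. j \<in> I \<Longrightarrow> le j j"
    and I_trans: "\<And>a b c. \<lbrakk>a \<in> I; b \<in> I; c \<in> I; le a b; le b c\<rbrakk> \<Longrightarrow> le a c"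
    and I_dir: "\<And>a b. \<lbrakk>a \<in> I; b \<in> I\<rbrakk> \<Longrightarrow> \<exists>c\<in>I. le a c \<and> le b c"
    using I unfolding directed_on_def by blast+
  have ev_UNIV: "ev UNIV" using J_ne by (auto simp: ev_def)
  have ev_Int: "ev (U \<inter> V)" if U: "ev U" and V: "ev V" for U V
  proof -
    obtain a where a: "a \<in> J" "\<forall>j\<in>J. leJ a j \<longrightarrow> g j \<in> U" using U by (auto simp: ev_def)
    obtain b where b: "b \<in> J" "\<forall>j\<in>J. leJ b j \<longrightarrow> g j \<in> V" using V by (auto simp: ev_def)
    obtain c where "c \<in> J" "leJ a c" "leJ b c" using J_dir[OF a(1) b(1)] by blast
    then show ?thesis using a b J_trans unfolding ev_def by (intro bexI[of _ c]) blast+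
  qed
  have freq: "\<exists>b\<in>I. le a b \<and> f b \<in> U" if U: "ev U" and a: "a \<in> I" for U a
  proof -
    obtain j where j: "j \<in> J" "\<forall>k\<in>J. leJ j k \<longrightarrow> g k \<in> U" using U by (auto simp: ev_def)
    obtain k where k: "k \<in> J" "\<forall>l\<in>J. leJ k l \<longrightarrow> (\<exists>b\<in>I. le a b \<and> g l = f b)"
      using refines[OF a] by blast
    obtain l where "l \<in> J" "leJ j l" "leJ k l" using J_dir[OF j(1) k(1)] by blast
    then show ?thesis using j k by metis
  qed
  define M where "M = {(b, U). b \<in> I \<and> ev U \<and> f b \<in> U}"
  define leM where
    "leM = (\<lambda>p q :: 'i \<times> (complex \<Rightarrow> 'a) set. le (fst p) (fst q) \<and> snd q \<subseteq> snd p)"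
  have M_dir: "directed_on M leM"
    unfolding directed_on_def
  proof (intro conjI ballI impI)
    show "M \<noteq> {}" using I_ne ev_UNIV by (auto simp: M_def)
    show "leM p p" if "p \<in> M" for p using that I_refl by (auto simp: M_def leM_def)
    show "leM p r" if "p \<in> M" "q \<in> M" "r \<in> M" "leM p q \<and> leM q r" for p q r
    proof -
      have "fst p \<in> I" "fst q \<in> I" "fst r \<in> I" using that(1-3) by (auto simp: M_def)
      then show ?thesis using that(4) I_trans[of "fst p" "fst q" "fst r"] by (auto simp: leM_def)
    qed
    show "\<exists>r\<in>M. leM p r \<and> leM q r" if pq: "p \<in> M" "q \<in> M" for p q
    proof -
      have p: "fst p \<in> I" "ev (snd p)" and q: "fst q \<in> I" "ev (snd q)"
        using pq by (auto simp: M_def)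
      obtain c where c: "c \<in> I" "le (fst p) c" "le (fst q) c" using I_dir[OF p(1) q(1)] by blast
      obtain b where b: "b \<in> I" "le c b" "f b \<in> snd p \<inter> snd q"
        using freq[OF ev_Int[OF p(2) q(2)] c(1)] by blast
      have "(b, snd p \<inter> snd q) \<in> M" using b ev_Int[OF p(2) q(2)] by (simp add: M_def)
      moreover have "le (fst p) b" "le (fst q) b"
        using I_trans p(1) q(1) b c by blast+
      ultimately show ?thesis
        by (intro bexI[of _ "(b, snd p \<inter> snd q)"]) (auto simp: leM_def)
    qed
  qed
  have sub: "subnet_map I le M leM fst"
    unfolding subnet_map_def
  proof (intro conjI ballI M_dir)
    show "fst ` M \<subseteq> I" by (auto simp: M_def)
    show "\<exists>p\<in>M. \<forall>q\<in>M. leM p q \<longrightarrow> le a (fst q)" if "a \<in> I" for a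
      using that ev_UNIV by (intro bexI[of _ "(a, UNIV)"]) (auto simp: M_def leM_def)
  qed
  have trans: "\<exists>p\<in>M. \<forall>q\<in>M. leM p q \<longrightarrow> (f \<circ> fst) q \<in> U" if U: "ev U" for U
  proof -
    obtain b where "b \<in> I" "f b \<in> U" using freq[OF U] I_ne by blast
    then show ?thesis using U by (intro bexI[of _ "(b, U)"]) (auto simp: M_def leM_def)
  qed
  have "compactly_divergent D M leM (f \<circ> fst)
      \<or> (\<exists>g0\<in>hol_maps (ball 0 1) D. converges_on_compacta \<tau> M leM (f \<circ> fst) g0)"
    using lim
  proof (elim disjE bexE)
    assume div: "compactly_divergent D J leJ g"
    have "compactly_divergent D M leM (f \<circ> fst)"
      unfolding compactly_divergent_def
    proof (intro allI impI)
      fix K :: "complex set" and L :: "'a set"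
      assume "compact K \<and> K \<subseteq> ball 0 1 \<and> compact L \<and> L \<subseteq> D"
      with div have "ev {u. u ` K \<inter> L = {}}"
        unfolding compactly_divergent_def ev_def by simp
      from trans[OF this] show "\<exists>p\<in>M. \<forall>q\<in>M. leM p q \<longrightarrow> (f \<circ> fst) q ` K \<inter> L = {}" by simp
    qed
    then show ?thesis ..
  next
    fix g0 assume g0: "g0 \<in> hol_maps (ball 0 1) D" "converges_on_compacta \<tau> J leJ g g0"
    have "converges_on_compacta \<tau> M leM (f \<circ> fst) g0"
      unfolding converges_on_compacta_def
    proof (intro allI impI)
      fix K :: "complex set" and U :: "'a set"
      assume "compact K \<and> K \<subseteq> ball 0 1 \<and> openin \<tau> U \<and> 0 \<in> U"
      with g0(2) have "ev {u. \<forall>z\<in>K. u z - g0 z \<in> U}"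
        unfolding converges_on_compacta_def ev_def by simp
      from trans[OF this]
      show "\<exists>p\<in>M. \<forall>q\<in>M. leM p q \<longrightarrow> (\<forall>z\<in>K. (f \<circ> fst) q z - g0 z \<in> U)" by simp
    qed
    with g0(1) show ?thesis by blast
  qed
  with sub show ?thesis unfolding has_taut_subnet_def by blast
qed

lemma has_taut_subnetI:
  fixes f :: "'i \<Rightarrow> complex \<Rightarrow> 'a::complex_normed_vector" and J :: "'j set"
  assumes I: "directed_on I le" and J: "subnet_map I le J leJ h"
    and lim: "compactly_divergent D J leJ (f \<circ> h)
       \<or> (\<exists>g\<in>hol_maps (ball 0 1) D. converges_on_compacta \<tau> J leJ (f \<circ> h) g)"
  shows "has_taut_subnet \<tau> D I le f"
proof (rule refining_net_imp_has_taut_subnet[OF I _ _ lim])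
  show "directed_on J leJ" using J by (simp add: subnet_map_def)
  show "\<exists>j0\<in>J. \<forall>j\<in>J. leJ j0 j \<longrightarrow> (\<exists>b\<in>I. le a b \<and> (f \<circ> h) j = f b)" if a: "a \<in> I" for a
  proof -
    obtain j0 where "j0 \<in> J" "\<forall>j\<in>J. leJ j0 j \<longrightarrow> le a (h j)"
      using J a unfolding subnet_map_def by blast
    moreover have "h j \<in> I" if "j \<in> J" for j
      using J that unfolding subnet_map_def by blast
    ultimately show ?thesis by (intro bexI[of _ j0]) auto
  qed
qed

lemma every_net_has_taut_subnet:
  fixes D :: "'a::complex_normed_vector set"
    and I :: "'i set" and f :: "'i \<Rightarrow> complex \<Rightarrow> 'a"
  assumes fixed: "\<And>(I' :: ((complex \<Rightarrow> 'a) set \<times> (complex \<Rightarrow> 'a)) set) le' f'.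
      \<lbrakk>directed_on I' le'; \<forall>a\<in>I'. f' a \<in> hol_maps (ball 0 1) D\<rbrakk> \<Longrightarrow> has_taut_subnet \<tau> D I' le' f'"
    and I: "directed_on I le" and f: "\<And>a. a \<in> I \<Longrightarrow> f a \<in> hol_maps (ball 0 1) D"
  shows "has_taut_subnet \<tau> D I le f"
proof -
  have I_ne: "I \<noteq> {}" and I_refl: "\<And>j. j \<in> I \<Longrightarrow> le j j"
    and I_trans: "\<And>a b c. \<lbrakk>a \<in> I; b \<in> I; c \<in> I; le a b; le b c\<rbrakk> \<Longrightarrow> le a c"
    and I_dir: "\<And>a b. \<lbrakk>a \<in> I; b \<in> I\<rbrakk> \<Longrightarrow> \<exists>c\<in>I. le a c \<and> le b c"
    using I unfolding directed_on_def by blast+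
  define T where "T = (\<lambda>a. f ` {b\<in>I. le a b})"
  define I' where "I' = {(F, u). \<exists>a\<in>I. F = T a \<and> u \<in> F}"
  define le' where "le' = (\<lambda>(p :: (complex \<Rightarrow> 'a) set \<times> (complex \<Rightarrow> 'a))
      (q :: (complex \<Rightarrow> 'a) set \<times> (complex \<Rightarrow> 'a)). fst q \<subseteq> fst p)"
  have mem: "(T a, f a) \<in> I'" if "a \<in> I" for a
    using that I_refl by (auto simp: I'_def T_def)
  have mono: "T b \<subseteq> T a" if "a \<in> I" "b \<in> I" "le a b" for a b
    using that unfolding T_def by (blast intro: I_trans)
  have dir: "directed_on I' le'"
    unfolding directed_on_def
  proof (intro conjI ballI impI)
    show "I' \<noteq> {}" using I_ne mem by blast
    show "\<exists>r\<in>I'. le' p r \<and> le' q r" if pq: "p \<in> I'" "q \<in> I'" for p q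
    proof -
      obtain a b where ab: "a \<in> I" "fst p = T a" "b \<in> I" "fst q = T b"
        using pq by (auto simp: I'_def)
      obtain c where "c \<in> I" "le a c" "le b c" using I_dir[OF ab(1,3)] by blast
      then show ?thesis
        using mem mono ab by (intro bexI[of _ "(T c, f c)"]) (auto simp: le'_def)
    qed
  qed (auto simp: le'_def)
  have "\<forall>p\<in>I'. snd p \<in> hol_maps (ball 0 1) D"
    using f by (auto simp: I'_def T_def)
  from fixed[OF dir this] obtain J :: "(((complex \<Rightarrow> 'a) set \<times> (complex \<Rightarrow> 'a)) \<times> (complex \<Rightarrow> 'a) set) set"
      and leJ h where J: "subnet_map I' le' J leJ h" and
      lim: "compactly_divergent D J leJ (snd \<circ> h)
         \<or> (\<exists>g\<in>hol_maps (ball 0 1) D. converges_on_compacta \<tau> J leJ (snd \<circ> h) g)"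
    unfolding has_taut_subnet_def by blast
  show ?thesis
  proof (rule refining_net_imp_has_taut_subnet[OF I _ _ lim])
    show "directed_on J leJ" using J by (simp add: subnet_map_def)
    show "\<exists>j0\<in>J. \<forall>j\<in>J. leJ j0 j \<longrightarrow> (\<exists>b\<in>I. le a b \<and> (snd \<circ> h) j = f b)" if a: "a \<in> I" for a
    proof -
      obtain j0 where j0: "j0 \<in> J" "\<forall>j\<in>J. leJ j0 j \<longrightarrow> le' (T a, f a) (h j)"
        using J mem[OF a] unfolding subnet_map_def by blast
      have "\<exists>b\<in>I. le a b \<and> (snd \<circ> h) j = f b" if j: "j \<in> J" "leJ j0 j" for j
      proof -
        have "h j \<in> I'" using J j(1) unfolding subnet_map_def by blast
        then have "snd (h j) \<in> fst (h j)" by (auto simp: I'_def)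
        moreover have "fst (h j) \<subseteq> T a" using j0(2) j by (simp add: le'_def)
        ultimately show ?thesis by (auto simp: T_def)
      qed
      with j0(1) show ?thesis by blast
    qed
  qed
qed

end

theory Submission
  imports Defs "HOL-Complex_Analysis.Complex_Analysis"
begin

text \<open>
  Write \<open>k\<close> for the Kobayashi length of \<open>v\<close> at \<open>x\<close>.  Tautness forces \<open>\<tau>\<close> to be coarser than the norm
  topology and so provides an extremal disc \<open>f\<close> with \<open>f 0 = x\<close>, \<open>k f'(0) = v\<close>.  Moebius maps of the
  disc bound the metric along \<open>z \<mapsto> f (k z)\<close> by \<open>k / (1 - k\<^sup>2 \<bar>z\<bar>\<^sup>2)\<close> with equality at \<open>0\<close>, and the Laplacian
  of the logarithm of the square of this bound is \<open>8 k\<^sup>2\<close> at \<open>0\<close>.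

  That no disc has a smaller Laplacian is due to convexity.  If \<open>\<eta>1 < k\<close>, the Hahn-Banach theorem yields
  a functional \<open>L\<close> on continuous maps from the circle into \<open>X\<close> that annihilates \<open>\<zeta>\<^sup>2 b(\<zeta>)\<close> for holomorphic \<open>b\<close>
  and is bounded above on maps into \<open>D\<close> by its value at \<open>x + \<zeta> v / \<eta>1\<close>.  A disc \<open>\<phi>\<close> through \<open>x\<close> with
  \<open>\<phi>'(0) = v / \<eta>2\<close>, where \<open>\<eta>2\<close> is slightly larger than \<open>k\<close>, nearly attains the bound.  The maps
  \<open>\<phi> + W (\<psi> - \<phi>)\<close> with \<open>0 \<le> W \<le> 1\<close> do not exceed it, whence \<open>Re L (W (\<psi> - \<phi>))\<close> is at most
  \<open>\<delta> = 1 / \<eta>1 - 1 / \<eta>2\<close>.  For \<open>W\<close> the square of a Poisson kernel at \<open>a\<close> and \<open>\<psi>\<close> a disc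
  centred at \<open>f z\<close> and reparametrised to be centred at \<open>a\<close>, this is, up to \<open>O(\<bar>z\<bar>\<^sup>3 + \<delta>)\<close>, a lower bound
  \<open>\<bar>N z\<bar> / ((1 - \<bar>a\<bar>\<^sup>2) \<bar>H z\<bar>)\<close> for the metric, with \<open>N\<close> and \<open>H\<close> holomorphic, \<open>a = \<eta>2 z\<close> and
  \<open>N 0 = \<eta>2 H 0\<close>.  As \<open>ln \<bar>N / H\<bar>\<close> is harmonic, the mean of the logarithm of the square over the circle of radius \<open>r\<close>
  is at least \<open>2 ln k + 2 k\<^sup>2 r\<^sup>2 - O(r\<^sup>3)\<close>.
\<close>

section \<open>Separation of convex sets\<close>

text \<open>A lower bound for the metric along \<open>f\<close> needs one test object that serves
  all discs centred near \<open>x\<close>. A separating functional is such an object because it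
  accepts every continuous map of the circle: convexity then permits mixing two discs with a
  nonholomorphic weight. The obstacle is the order of the errors. The Laplacian is read off at order
  r^2, so an uncontrolled error of that order in the mean would ruin the constant. A weight with a
  double pole at a lets the functional see values and first derivatives at a only. With a
  proportional to z, the nearly extremal disc at a misses f(z) by O(|z|^2). This difference enters
  twice: inside H, where it is holomorphic in z and hence invisible to the mean of a logarithm, and
  multiplied by the conjugate of a, where it is O(|z|^3). The curvature then stems from the factor 1
  - |a|^2 alone, which is the reciprocal of the derivative at a of the disc automorphism used for
  recentring. The infimum in the metric need not be attained, hence the bracket \<eta>1 < k <
  \<eta>2 and the defect \<delta>. All radii and constants are uniform in the bracket, so that
  \<delta> tends to 0 at fixed r, before r does.\<close>

definition sublinear :: "('v::real_vector \<Rightarrow> real) \<Rightarrow> bool" where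
  "sublinear p \<longleftrightarrow> (\<forall>x y. p (x + y) \<le> p x + p y) \<and> (\<forall>t\<ge>0. \<forall>x. p (t *\<^sub>R x) = t * p x)"

lemma sublinear_add: "sublinear p \<Longrightarrow> p (x + y) \<le> p x + p y"
  and sublinear_scale: "sublinear p \<Longrightarrow> t \<ge> 0 \<Longrightarrow> p (t *\<^sub>R x) = t * p x"
  by (auto simp: sublinear_def)

lemma sublinear_0: "sublinear p \<Longrightarrow> p 0 = 0"
  using sublinear_scale[of p 0 0] by simp

lemma sublinear_ge_uminus: "sublinear p \<Longrightarrow> - p (- x) \<le> p x"
  using sublinear_add[of p x "- x"] sublinear_0[of p] by simp

text \<open>For sublinear \<open>p\<close> this is the largest sublinear minorant of
  \<open>p\<close> whose value at \<open>- y\<close> is \<open>- p y\<close>. A linear functional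
  below it therefore equals \<open>p y\<close> at \<open>y\<close>.\<close>

definition tilt :: "('v::real_vector \<Rightarrow> real) \<Rightarrow> 'v \<Rightarrow> 'v \<Rightarrow> real" where
  "tilt p y x = (INF t\<in>{0..}. p (x + t *\<^sub>R y) - t * p y)"

text \<open>The infimum in \<open>tilt\<close> runs over an unbounded range; a bound independent of
  \<open>t\<close> keeps it finite.\<close>

lemma tilt_lower:
  assumes p: "sublinear p" and t: "t \<ge> 0"
  shows "- p (- x) \<le> p (x + t *\<^sub>R y) - t * p y"
proof -
  have "p (t *\<^sub>R y) \<le> p (x + t *\<^sub>R y) + p (- x)"
    using sublinear_add[OF p, of "x + t *\<^sub>R y" "- x"] by simp
  then show ?thesis using sublinear_scale[OF p t] by simp
qed

lemma tilt_le:
  assumes p: "sublinear p" and t: "t \<ge> 0"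
  shows "tilt p y x \<le> p (x + t *\<^sub>R y) - t * p y"
  unfolding tilt_def
  using t tilt_lower[OF p] by (intro cINF_lower bdd_belowI2[where m = "- p (- x)"]) auto

lemma tilt_greatest:
  assumes "\<And>t. t \<ge> 0 \<Longrightarrow> m \<le> p (x + t *\<^sub>R y) - t * p y"
  shows "m \<le> tilt p y x"
  unfolding tilt_def using assms by (intro cINF_greatest) auto

lemma tilt_le_self: "sublinear p \<Longrightarrow> tilt p y x \<le> p x"
  using tilt_le[of p 0 y x] by simp

lemma sublinear_tilt:
  assumes p: "sublinear p"
  shows "sublinear (tilt p y)"
  unfolding sublinear_def
proof (intro conjI allI impI)
  fix u w
  \<comment> \<open>Parameters \<open>s\<close> and \<open>t\<close> for the two summands give the
    competitor \<open>s + t\<close> for the sum; the two infima are then taken one after the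
    other.\<close>
  have 1: "tilt p y (u + w) - (p (w + s *\<^sub>R y) - s * p y) \<le> p (u + t *\<^sub>R y) - t * p y"
    if "s \<ge> 0" "t \<ge> 0" for s t
  proof -
    have "tilt p y (u + w) \<le> p ((u + w) + (s + t) *\<^sub>R y) - (s + t) * p y"
      using tilt_le[OF p, of "s + t"] that by simp
    also have "(u + w) + (s + t) *\<^sub>R y = (u + t *\<^sub>R y) + (w + s *\<^sub>R y)"
      by (simp add: algebra_simps)
    finally show ?thesis
      using sublinear_add[OF p, of "u + t *\<^sub>R y" "w + s *\<^sub>R y"] by (simp add: algebra_simps)
  qed
  have "tilt p y (u + w) - tilt p y u \<le> p (w + s *\<^sub>R y) - s * p y" if "s \<ge> 0" for s
    using tilt_greatest[of "tilt p y (u + w) - (p (w + s *\<^sub>R y) - s * p y)" p u y] 1[OF that] by simp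
  from tilt_greatest[of "tilt p y (u + w) - tilt p y u" p w y, OF this]
  show "tilt p y (u + w) \<le> tilt p y u + tilt p y w" by simp
next
  \<comment> \<open>Only this inequality is proved directly; the opposite one is the same statement
    for \<open>1 / t\<close>.\<close>
  have le: "t * tilt p y w \<le> tilt p y (t *\<^sub>R w)" if t: "t > 0" for t w
  proof (rule tilt_greatest)
    fix s :: real assume s: "s \<ge> 0"
    have "t * tilt p y w \<le> t * (p (w + (s / t) *\<^sub>R y) - (s / t) * p y)"
      using tilt_le[OF p, of "s / t" y w] s t by (intro mult_left_mono) auto
    also have "\<dots> = p (t *\<^sub>R (w + (s / t) *\<^sub>R y)) - s * p y"
      using t sublinear_scale[OF p, of t] by (simp add: right_diff_distrib)
    also have "t *\<^sub>R (w + (s / t) *\<^sub>R y) = t *\<^sub>R w + s *\<^sub>R y"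
      using t by (simp add: scaleR_add_right)
    finally show "t * tilt p y w \<le> p (t *\<^sub>R w + s *\<^sub>R y) - s * p y" .
  qed
  fix t :: real and w assume t: "0 \<le> t"
  show "tilt p y (t *\<^sub>R w) = t * tilt p y w"
  proof (cases "t = 0")
    case True
    have "tilt p y 0 \<le> 0" using tilt_le_self[OF p, of y 0] sublinear_0[OF p] by simp
    moreover have "0 \<le> tilt p y 0"
      using sublinear_scale[OF p] by (intro tilt_greatest) simp
    ultimately show ?thesis using True by simp
  next
    case False
    with t have t: "t > 0" by simp
    have "(1 / t) * tilt p y (t *\<^sub>R w) \<le> tilt p y ((1 / t) *\<^sub>R (t *\<^sub>R w))"
      using t by (intro le) simp
    then have "tilt p y (t *\<^sub>R w) \<le> t * tilt p y w"
      using t by (simp add: field_simps)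
    with le[OF t, of w] show ?thesis by simp
  qed
qed

text \<open>A minimal sublinear functional agrees with all its tilts and is therefore additive.\<close>

lemma minimal_sublinear_linear:
  assumes q: "sublinear q" and min: "\<And>r. sublinear r \<Longrightarrow> (\<And>x. r x \<le> q x) \<Longrightarrow> r = q"
  shows "linear q"
proof -
  have "q x + q y \<le> q (x + y)" for x y
  proof -
    have "tilt q y = q" by (intro min sublinear_tilt tilt_le_self q)
    then show ?thesis using tilt_le[OF q, of 1 y x] by simp
  qed
  then have add: "q (x + y) = q x + q y" for x y
    using sublinear_add[OF q, of x y] by (simp add: order_antisym)
  have neg: "q (- x) = - q x" for x using add[of x "- x"] sublinear_0[OF q] by simp
  have "q (t *\<^sub>R x) = t * q x" for t x
  proof (cases "t \<ge> 0")
    case False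
    then have "q ((- t) *\<^sub>R x) = (- t) * q x" by (intro sublinear_scale[OF q]) simp
    then show ?thesis using neg[of "t *\<^sub>R x"] by simp
  qed (rule sublinear_scale[OF q])
  with add show ?thesis by (intro linearI) auto
qed

text \<open>Hahn-Banach without extending from subspaces: Zorn's lemma gives a minimal sublinear
  functional below \<open>p\<close>, and minimality forces linearity. The order \<open>ge\<close> is
  reversed so that a maximal element is a minimal functional.\<close>

lemma linear_below_sublinear:
  assumes p: "sublinear p"
  obtains l where "linear l" "\<And>x. l x \<le> p x"
proof -
  define A where "A = {q. sublinear q \<and> (\<forall>x. q x \<le> p x)}"
  define ge where "ge = (\<lambda>q r :: 'a \<Rightarrow> real. \<forall>x. r x \<le> q x)"
  have "\<exists>m\<in>A. \<forall>a\<in>A. ge m a \<longrightarrow> a = m"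
  proof (rule predicate_Zorn)
    show "partial_order_on A (relation_of ge A)"
      by (rule partial_order_on_relation_ofI)
         (auto simp: ge_def fun_eq_iff intro: order_trans order_antisym)
    fix C assume C: "C \<in> Chains (relation_of ge A)"
    have CA: "C \<subseteq> A" using C by (auto simp: Chains_def relation_of_def)
    have tot: "ge q r \<or> ge r q" if "q \<in> C" "r \<in> C" for q r
      using C that by (auto simp: Chains_def relation_of_def)
    show "\<exists>u\<in>A. \<forall>a\<in>C. ge a u"
    proof (cases "C = {}")
      case True then show ?thesis using p by (intro bexI[of _ p]) (auto simp: A_def)
    next
      case False
      have sub: "sublinear q" "q x \<le> p x" if "q \<in> C" for q x using that CA by (auto simp: A_def)
      define u where "u = (\<lambda>x. INF q\<in>C. q x)"
      have bdd: "bdd_below ((\<lambda>q. q x) ` C)" for x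
      proof (rule bdd_belowI2)
        fix q assume "q \<in> C"
        then show "- p (- x) \<le> q x"
          using sublinear_ge_uminus[OF sub(1), of q x] sub(2)[of q "- x"] by simp
      qed
      have ule: "u x \<le> q x" if "q \<in> C" for q x
        unfolding u_def using that bdd by (intro cINF_lower)
      have ugr: "m \<le> u x" if "\<And>q. q \<in> C \<Longrightarrow> m \<le> q x" for m x
        unfolding u_def using that False by (intro cINF_greatest)
      have "sublinear u"
        unfolding sublinear_def
      proof (intro conjI allI impI)
        fix x y
        \<comment> \<open>Of two members of a chain the smaller one can serve both summands, so
          subadditivity survives the infimum.\<close>
        have *: "u (x + y) \<le> q x + r y" if qr: "q \<in> C" "r \<in> C" for q r
        proof -
          consider "ge q r" | "ge r q" using tot qr by blast
          then show ?thesis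
          proof cases
            case 1
            have "u (x + y) \<le> r x + r y" using ule[OF qr(2)] sublinear_add[OF sub(1)[OF qr(2)]] order_trans by blast
            with 1 show ?thesis by (auto simp: ge_def intro: order_trans)
          next
            case 2
            have "u (x + y) \<le> q x + q y" using ule[OF qr(1)] sublinear_add[OF sub(1)[OF qr(1)]] order_trans by blast
            with 2 show ?thesis by (auto simp: ge_def intro: order_trans)
          qed
        qed
        have "u (x + y) - r y \<le> u x" if "r \<in> C" for r
          using *[OF _ that] by (intro ugr) (simp add: algebra_simps)
        then have "u (x + y) - u x \<le> u y"
          by (intro ugr) (simp add: algebra_simps)
        then show "u (x + y) \<le> u x + u y" by simp
      next
        have le: "t * u x \<le> u (t *\<^sub>R x)" if "t \<ge> 0" for t x
        proof (rule ugr)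
          fix q assume q: "q \<in> C"
          show "t * u x \<le> q (t *\<^sub>R x)"
            using sublinear_scale[OF sub(1)[OF q] that] ule[OF q] that by (simp add: mult_left_mono)
        qed
        fix t :: real and x assume t: "t \<ge> 0"
        show "u (t *\<^sub>R x) = t * u x"
        proof (cases "t = 0")
          case True
          obtain q where q: "q \<in> C" using False by blast
          have "u 0 \<le> 0" using ule[OF q, of 0] sublinear_0[OF sub(1)[OF q]] by simp
          moreover have "0 \<le> u 0" by (intro ugr) (simp add: sublinear_0[OF sub(1)])
          ultimately show ?thesis using True by simp
        next
          case False
          with t have "t > 0" by simp
          have "(1 / t) * u (t *\<^sub>R x) \<le> u ((1 / t) *\<^sub>R (t *\<^sub>R x))" using t by (intro le) simp
          then have "u (t *\<^sub>R x) \<le> t * u x" using \<open>t > 0\<close> by (simp add: field_simps)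
          with le[OF t, of x] show ?thesis by simp
        qed
      qed
      moreover have "u x \<le> p x" for x using False ule sub(2) order_trans by blast
      ultimately show ?thesis using ule by (intro bexI[of _ u]) (auto simp: A_def ge_def)
    qed
  qed
  then obtain m where m: "m \<in> A" "\<And>a. a \<in> A \<Longrightarrow> ge m a \<Longrightarrow> a = m" by blast
  have "linear m"
  proof (rule minimal_sublinear_linear)
    show "sublinear m" using m(1) by (simp add: A_def)
    fix r assume r: "sublinear r" "\<And>x. r x \<le> m x"
    then have "r \<in> A" using m(1) by (auto simp: A_def intro: order_trans)
    then show "r = m" using m(2) r(2) by (auto simp: ge_def)
  qed
  then show ?thesis using that m(1) by (auto simp: A_def)
qed

section \<open>Minkowski gauges and the separation theorem\<close>

definition gauge_of :: "'v::real_vector set \<Rightarrow> 'v \<Rightarrow> real" where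
  "gauge_of A x = Inf {t. t > 0 \<and> (1 / t) *\<^sub>R x \<in> A}"

locale open_convex_nhd_zero =
  fixes A :: "'v::real_normed_vector set"
  assumes open_A: "open A" and convex_A: "convex A" and zero_A: "0 \<in> A"
begin

lemma gauge_set_nonempty: "\<exists>t. t > 0 \<and> (1 / t) *\<^sub>R x \<in> A"
proof -
  obtain e where e: "e > 0" "ball 0 e \<subseteq> A" using open_A zero_A open_contains_ball by blast
  define t where "t = (1 + norm x) / e"
  have "t > 0" using e by (simp add: t_def add_pos_nonneg)
  moreover have "norm ((1 / t) *\<^sub>R x) < e"
    using e(1) by (simp add: t_def divide_less_eq add_pos_nonneg)
  ultimately show ?thesis using e(2) by (intro exI[of _ t]) (auto simp: dist_norm)
qed

lemma gauge_bdd: "bdd_below {t. t > 0 \<and> (1 / t) *\<^sub>R x \<in> A}"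
  by (rule bdd_belowI[of _ 0]) auto

lemma gauge_le: "t > 0 \<Longrightarrow> (1 / t) *\<^sub>R x \<in> A \<Longrightarrow> gauge_of A x \<le> t"
  unfolding gauge_of_def using gauge_bdd by (intro cInf_lower) auto

lemma gauge_ge: "(\<And>t. t > 0 \<Longrightarrow> (1 / t) *\<^sub>R x \<in> A \<Longrightarrow> m \<le> t) \<Longrightarrow> m \<le> gauge_of A x"
  unfolding gauge_of_def using gauge_set_nonempty[of x] by (intro cInf_greatest) auto

lemma gauge_nonneg: "gauge_of A x \<ge> 0"
  by (rule gauge_ge) simp

lemma gauge_lt_imp_mem:
  assumes "gauge_of A x < s"
  shows "(1 / s) *\<^sub>R x \<in> A"
proof -
  obtain t where t: "t > 0" "(1 / t) *\<^sub>R x \<in> A" "t < s"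
    using assms gauge_set_nonempty[of x] gauge_bdd[of x] unfolding gauge_of_def
    by (subst (asm) cInf_less_iff) auto
  have "(t / s) *\<^sub>R ((1 / t) *\<^sub>R x) + (1 - t / s) *\<^sub>R 0 \<in> A"
    using t zero_A by (intro convexD[OF convex_A]) auto
  then show ?thesis using t by simp
qed

lemma sublinear_gauge: "sublinear (gauge_of A)"
  unfolding sublinear_def
proof (intro conjI allI impI)
  fix x y
  show "gauge_of A (x + y) \<le> gauge_of A x + gauge_of A y"
  proof (rule field_le_epsilon)
    fix e :: real assume e: "e > 0"
    define s where "s = gauge_of A x + e / 2"
    define t where "t = gauge_of A y + e / 2"
    have pos: "s > 0" "t > 0" using gauge_nonneg[of x] gauge_nonneg[of y] e by (auto simp: s_def t_def)
    have "(1 / s) *\<^sub>R x \<in> A" "(1 / t) *\<^sub>R y \<in> A"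
      using e by (auto intro!: gauge_lt_imp_mem simp: s_def t_def)
    then have "(s / (s + t)) *\<^sub>R ((1 / s) *\<^sub>R x) + (t / (s + t)) *\<^sub>R ((1 / t) *\<^sub>R y) \<in> A"
      using pos by (intro convexD[OF convex_A]) (auto simp: add_divide_distrib[symmetric])
    then have "(1 / (s + t)) *\<^sub>R (x + y) \<in> A" using pos by (simp add: scaleR_add_right)
    then have "gauge_of A (x + y) \<le> s + t" using pos by (intro gauge_le) auto
    then show "gauge_of A (x + y) \<le> gauge_of A x + gauge_of A y + e" by (simp add: s_def t_def)
  qed
next
  have le: "gauge_of A (t *\<^sub>R x) \<le> t * gauge_of A x" if t: "t > 0" for t x
  proof -
    have "gauge_of A (t *\<^sub>R x) / t \<le> gauge_of A x"
    proof (rule gauge_ge)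
      fix s assume "s > 0" "(1 / s) *\<^sub>R x \<in> A"
      then have "gauge_of A (t *\<^sub>R x) \<le> s * t" using t by (intro gauge_le) (auto simp: field_simps)
      then show "gauge_of A (t *\<^sub>R x) / t \<le> s" using t by (simp add: field_simps)
    qed
    then show ?thesis using t by (simp add: field_simps)
  qed
  fix t :: real and x assume t: "t \<ge> 0"
  show "gauge_of A (t *\<^sub>R x) = t * gauge_of A x"
  proof (cases "t = 0")
    case True
    have "gauge_of A 0 \<le> 0"
      by (rule field_le_epsilon) (use zero_A in \<open>auto intro: gauge_le\<close>)
    then show ?thesis using True gauge_nonneg[of 0] by simp
  next
    case False
    with t have t: "t > 0" by simp
    have "gauge_of A ((1 / t) *\<^sub>R (t *\<^sub>R x)) \<le> (1 / t) * gauge_of A (t *\<^sub>R x)" using t by (intro le) simp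
    then have "t * gauge_of A x \<le> gauge_of A (t *\<^sub>R x)" using t by (simp add: field_simps)
    with le[OF t, of x] show ?thesis by simp
  qed
qed

text \<open>Openness leaves room to stretch \<open>x\<close> by some \<open>t > 1\<close> inside
  \<open>A\<close>, which makes the inequality strict.\<close>

lemma gauge_lt_1: "x \<in> A \<Longrightarrow> gauge_of A x < 1"
proof -
  assume x: "x \<in> A"
  have "((\<lambda>t::real. t *\<^sub>R x) \<longlongrightarrow> 1 *\<^sub>R x) (at_right 1)" by (intro tendsto_intros)
  then have "\<forall>\<^sub>F t in at_right (1::real). t *\<^sub>R x \<in> A"
    using open_A x by (auto dest: topological_tendstoD)
  moreover have "\<forall>\<^sub>F t in at_right (1::real). t > 1" by (simp add: eventually_at_right_less)
  ultimately have "\<forall>\<^sub>F t in at_right (1::real). t *\<^sub>R x \<in> A \<and> t > 1" by (rule eventually_conj)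
  then obtain t :: real where t: "t *\<^sub>R x \<in> A" "t > 1"
    using eventually_happens trivial_limit_at_right_real by blast
  then have "gauge_of A x \<le> 1 / t" by (intro gauge_le) auto
  also have "1 / t < 1" using t by simp
  finally show ?thesis .
qed

lemma gauge_ge_1: "x \<notin> A \<Longrightarrow> gauge_of A x \<ge> 1"
  using gauge_lt_imp_mem[of x 1] by fastforce

end

text \<open>The set \<open>A\<close> of all \<open>c0 - c\<close> is a convex neighbourhood of 0
  that misses \<open>c0\<close>, so its gauge is at least 1 at \<open>c0\<close>. A functional below
  the gauge tilted at \<open>c0\<close> keeps this value, while it is below 1 on
  \<open>A\<close>.\<close>

theorem separate_open_convex_zero:
  fixes C :: "'v::real_normed_vector set"
  assumes C: "open C" "convex C" "0 \<notin> C"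
  obtains l where "bounded_linear l" "\<And>c. c \<in> C \<Longrightarrow> (0::real) < l c"
proof (cases "C = {}")
  case True
  then show ?thesis using that[of "\<lambda>_. 0"] by simp
next
  case False
  then obtain c0 where c0: "c0 \<in> C" by blast
  define A where "A = (\<lambda>c. c0 - c) ` C"
  have A_alt: "A = (+) c0 ` uminus ` C" by (auto simp: A_def image_image)
  interpret A: open_convex_nhd_zero A
  proof
    show "open A" unfolding A_alt by (intro open_translation open_negations C)
    show "convex A" unfolding A_alt by (intro convex_translation convex_negations C)
    show "0 \<in> A" using c0 by (force simp: A_def)
  qed
  let ?p = "gauge_of A"
  obtain l where l: "linear l" "\<And>x. l x \<le> tilt ?p c0 x"
    using linear_below_sublinear[OF sublinear_tilt[OF A.sublinear_gauge, of c0]] by blast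
  have lp: "l x \<le> ?p x" for x using l(2)[of x] tilt_le_self[OF A.sublinear_gauge, of c0 x] by simp
  have "c0 \<notin> A" using C(3) by (auto simp: A_def)
  then have "1 \<le> ?p c0" by (rule A.gauge_ge_1)
  also have "?p c0 \<le> l c0"
  proof -
    have "- l c0 = l (- c0)" using linear_neg[OF l(1)] by simp
    also have "\<dots> \<le> tilt ?p c0 (- c0)" by (rule l)
    also have "\<dots> \<le> ?p (- c0 + 1 *\<^sub>R c0) - 1 * ?p c0" by (rule tilt_le[OF A.sublinear_gauge]) simp
    also have "\<dots> = - ?p c0" using sublinear_0[OF A.sublinear_gauge] by simp
    finally show ?thesis by simp
  qed
  finally have l_c0: "1 \<le> l c0" .
  have pos: "0 < l c" if "c \<in> C" for c
  proof -
    have "l (c0 - c) \<le> ?p (c0 - c)" by (rule lp)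
    also have "\<dots> < 1" using that by (intro A.gauge_lt_1) (auto simp: A_def)
    finally show ?thesis using l_c0 linear_diff[OF l(1)] by simp
  qed
  obtain e where e: "e > 0" "ball 0 e \<subseteq> A" using A.open_A A.zero_A open_contains_ball by blast
  have le: "l x \<le> (2 / e) * norm x" for x
  proof (cases "x = 0")
    case True then show ?thesis using linear_0[OF l(1)] by simp
  next
    case False
    \<comment> \<open>Rescaled to norm \<open>e / 2\<close>, the vector lies in \<open>A\<close>,
      where \<open>l\<close> is less than 1; this yields continuity of \<open>l\<close>.\<close>
    define y where "y = (e / (2 * norm x)) *\<^sub>R x"
    have "y \<in> A" using e False by (intro subsetD[OF e(2)]) (simp add: y_def)
    then have "l y < 1" using lp[of y] A.gauge_lt_1[of y] by simp
    moreover have "l y = (e / (2 * norm x)) * l x" using linear_scale[OF l(1)] by (simp add: y_def)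
    ultimately show ?thesis using False e(1) by (simp add: field_simps)
  qed
  have "bounded_linear l"
  proof (rule bounded_linear_intro[where K = "2 / e"])
    show "norm (l x) \<le> norm x * (2 / e)" for x
      using le[of x] le[of "- x"] linear_neg[OF l(1), of x] by (simp add: abs_le_iff mult.commute)
  qed (use linear_add[OF l(1)] linear_scale[OF l(1)] in auto)
  then show ?thesis using pos that by blast
qed

lemma separate_point_open_convex:
  fixes D :: "'v::real_normed_vector set"
  assumes D: "open D" "convex D" "p \<notin> D"
  obtains l where "bounded_linear l" "\<And>d. d \<in> D \<Longrightarrow> l d < (l p :: real)"
proof -
  have eq: "(\<lambda>d. p - d) ` D = (+) p ` uminus ` D" by (auto simp: image_image)
  obtain l where l: "bounded_linear l" "\<And>c. c \<in> (\<lambda>d. p - d) ` D \<Longrightarrow> (0::real) < l c"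
  proof (rule separate_open_convex_zero)
    show "open ((\<lambda>d. p - d) ` D)" unfolding eq by (intro open_translation open_negations D)
    show "convex ((\<lambda>d. p - d) ` D)" unfolding eq by (intro convex_translation convex_negations D)
    show "0 \<notin> (\<lambda>d. p - d) ` D" using D(3) by auto
  qed blast
  show ?thesis
    using l(2) linear_diff[OF bounded_linear.linear[OF l(1)]] by (intro that[OF l(1)]) force
qed

section \<open>Complex functionals and vector-valued holomorphic maps\<close>

lemma bounded_bilinear_scaleC: "bounded_bilinear ((*\<^sub>C) :: complex \<Rightarrow> 'a \<Rightarrow> 'a::complex_normed_vector)"
proof (rule bounded_bilinear.intro)
  show "(r *\<^sub>R c) *\<^sub>C x = r *\<^sub>R (c *\<^sub>C x)" for r c and x :: 'a
    by (subst scaleR_conv_of_real) (simp add: scaleR_scaleC scaleC_scaleC)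
  show "c *\<^sub>C (r *\<^sub>R x) = r *\<^sub>R (c *\<^sub>C x)" for r c and x :: 'a
    by (simp add: scaleR_scaleC scaleC_scaleC mult.commute)
  show "\<exists>K. \<forall>c (x :: 'a). norm (c *\<^sub>C x) \<le> norm c * norm x * K"
    by (intro exI[of _ 1]) (simp add: norm_scaleC)
qed (rule scaleC_add_left scaleC_add_right)+

interpretation scaleC: bounded_bilinear "(*\<^sub>C) :: complex \<Rightarrow> 'a \<Rightarrow> 'a::complex_normed_vector"
  by (rule bounded_bilinear_scaleC)

lemmas scaleC_continuous_on [continuous_intros] = scaleC.continuous_on

declare scaleC.zero_left [simp] scaleC.zero_right [simp]

lemma scaleC_one [simp]: "1 *\<^sub>C x = (x :: 'a::complex_normed_vector)"
  using scaleR_scaleC[of 1 x] by simp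

lemma scaleC_of_real: "of_real r *\<^sub>C x = r *\<^sub>R (x :: 'a::complex_normed_vector)"
  by (simp add: scaleR_scaleC)

lemma scaleC_left_commute: "a *\<^sub>C b *\<^sub>C x = b *\<^sub>C a *\<^sub>C (x :: 'a::complex_normed_vector)"
  by (simp add: scaleC_scaleC mult.commute)

definition clinear_functional :: "('a::complex_normed_vector \<Rightarrow> complex) \<Rightarrow> bool" where
  "clinear_functional \<Lambda> \<longleftrightarrow> bounded_linear \<Lambda> \<and> (\<forall>c x. \<Lambda> (c *\<^sub>C x) = c * \<Lambda> x)"

lemma clinear_functional_bounded_linear: "clinear_functional \<Lambda> \<Longrightarrow> bounded_linear \<Lambda>"
  and clinear_functional_scale: "clinear_functional \<Lambda> \<Longrightarrow> \<Lambda> (c *\<^sub>C x) = c * \<Lambda> x"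
  by (auto simp: clinear_functional_def)

lemma complexify_functional:
  fixes l :: "'a::complex_normed_vector \<Rightarrow> real"
  assumes l: "bounded_linear l"
  shows "clinear_functional (\<lambda>x. Complex (l x) (- l (\<i> *\<^sub>C x)))"
  unfolding clinear_functional_def
proof (intro conjI allI)
  interpret l: bounded_linear l by fact
  have "bounded_linear (\<lambda>x. of_real (l x) - \<i> * of_real (l (\<i> *\<^sub>C x)))"
    by (intro bounded_linear_intros bounded_linear_sub bounded_linear_compose[OF bounded_linear_of_real]
        bounded_linear_const_mult l bounded_linear_compose[OF l scaleC.bounded_linear_right])
  then show "bounded_linear (\<lambda>x. Complex (l x) (- l (\<i> *\<^sub>C x)))"
    by (simp add: complex_eq_iff Complex_eq)
  fix c x
  have 1: "l (c *\<^sub>C x) = Re c * l x + Im c * l (\<i> *\<^sub>C x)" for c x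
  proof -
    have "c *\<^sub>C x = Re c *\<^sub>R x + Im c *\<^sub>R (\<i> *\<^sub>C x)"
      by (simp add: scaleR_scaleC scaleC_scaleC scaleC_add_left[symmetric] complex_eq[of c, symmetric] mult.commute)
    then show ?thesis by (simp add: l.add l.scaleR)
  qed
  show "Complex (l (c *\<^sub>C x)) (- l (\<i> *\<^sub>C c *\<^sub>C x)) = c * Complex (l x) (- l (\<i> *\<^sub>C x))"
    using 1[of c x] 1[of "\<i> * c" x] by (simp add: complex_eq_iff scaleC_scaleC algebra_simps)
qed

text \<open>The ball around \<open>x - y\<close> that has 0 on its boundary is open, convex and
  misses 0. This reduces identities between vectors to scalar ones.\<close>

lemma clinear_functionals_separate:
  fixes x y :: "'a::complex_normed_vector"
  assumes "\<And>\<Lambda>. clinear_functional \<Lambda> \<Longrightarrow> \<Lambda> x = \<Lambda> y"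
  shows "x = y"
proof (rule ccontr)
  assume "x \<noteq> y"
  define C where "C = ball (x - y) (norm (x - y))"
  obtain l where l: "bounded_linear l" "\<And>c. c \<in> C \<Longrightarrow> (0::real) < l c"
    by (rule separate_open_convex_zero[of C]) (auto simp: C_def dist_norm)
  have "0 < l (x - y)" using \<open>x \<noteq> y\<close> by (intro l(2)) (simp add: C_def)
  moreover have "l x = l y"
    using assms[OF complexify_functional[OF l(1)]] by simp
  ultimately show False using linear_diff[OF bounded_linear.linear[OF l(1)]] by simp
qed

section \<open>Calculus of vector-valued holomorphic maps\<close>

lemma has_cderiv_const: "has_cderiv (\<lambda>z. c) 0 z"
  by (simp add: has_cderiv_def scaleC.zero_right)

lemma has_cderiv_add:
  "has_cderiv f f' z \<Longrightarrow> has_cderiv g g' z \<Longrightarrow> has_cderiv (\<lambda>z. f z + g z) (f' + g') z"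
  unfolding has_cderiv_def by (simp add: scaleC.add_right has_derivative_add)

lemma has_cderiv_diff:
  "has_cderiv f f' z \<Longrightarrow> has_cderiv g g' z \<Longrightarrow> has_cderiv (\<lambda>z. f z - g z) (f' - g') z"
  unfolding has_cderiv_def by (simp add: scaleC.diff_right has_derivative_diff)

lemma has_cderiv_scaleC:
  assumes "(s has_field_derivative s') (at z)" "has_cderiv b b' z"
  shows "has_cderiv (\<lambda>z. s z *\<^sub>C b z) (s' *\<^sub>C b z + s z *\<^sub>C b') z"
proof -
  have "((\<lambda>z. s z *\<^sub>C b z) has_derivative (\<lambda>h. s z *\<^sub>C (h *\<^sub>C b') + (s' * h) *\<^sub>C b z)) (at z)"
    using assms unfolding has_cderiv_def has_field_derivative_def by (rule scaleC.FDERIV)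
  moreover have "s z *\<^sub>C (h *\<^sub>C b') + (s' * h) *\<^sub>C b z = h *\<^sub>C (s' *\<^sub>C b z + s z *\<^sub>C b')" for h
    by (simp add: scaleC.add_right scaleC_scaleC mult.commute)
  ultimately show ?thesis by (simp add: has_cderiv_def)
qed

lemma has_cderiv_scaleC_const:
  assumes "(s has_field_derivative s') (at z)"
  shows "has_cderiv (\<lambda>z. s z *\<^sub>C b) (s' *\<^sub>C b) z"
  using has_cderiv_scaleC[OF assms has_cderiv_const, of b] by (simp add: scaleC.zero_right)

lemma has_cderiv_sum:
  assumes "\<And>i. i \<in> I \<Longrightarrow> has_cderiv (f i) (f' i) z"
  shows "has_cderiv (\<lambda>z. \<Sum>i\<in>I. f i z) (\<Sum>i\<in>I. f' i) z"
  using assms unfolding has_cderiv_def by (simp add: scaleC.sum_right has_derivative_sum)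

lemma has_cderiv_compose:
  assumes "(s has_field_derivative s') (at z)" "has_cderiv f f' (s z)"
  shows "has_cderiv (\<lambda>z. f (s z)) (s' *\<^sub>C f') z"
proof -
  have "((\<lambda>z. f (s z)) has_derivative (\<lambda>h. (s' * h) *\<^sub>C f')) (at z)"
    using assms unfolding has_cderiv_def has_field_derivative_def
    by (rule has_derivative_compose)
  then show ?thesis by (simp add: has_cderiv_def scaleC_scaleC mult.commute)
qed

lemma has_cderiv_functional:
  assumes "clinear_functional \<Lambda>" "has_cderiv f f' z"
  shows "((\<lambda>z. \<Lambda> (f z)) has_field_derivative \<Lambda> f') (at z)"
proof -
  have "((\<lambda>z. \<Lambda> (f z)) has_derivative (\<lambda>h. \<Lambda> (h *\<^sub>C f'))) (at z)"
    using assms bounded_linear.has_derivative unfolding has_cderiv_def clinear_functional_def by blast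
  then show ?thesis
    using assms(1) by (simp add: has_field_derivative_def clinear_functional_def mult.commute[of _ "\<Lambda> f'"])
qed

lemma has_cderiv_imp_isCont: "has_cderiv f f' z \<Longrightarrow> isCont f z"
  unfolding has_cderiv_def by (rule has_derivative_continuous)

lemma continuous_on_has_cderiv:
  "(\<And>z. z \<in> S \<Longrightarrow> has_cderiv f (f' z) z) \<Longrightarrow> continuous_on S f"
  using has_cderiv_imp_isCont continuous_at_imp_continuous_on by blast

lemma holomorphic_functional:
  assumes "clinear_functional \<Lambda>" "\<And>z. z \<in> S \<Longrightarrow> has_cderiv f (f' z) z"
  shows "(\<lambda>z. \<Lambda> (f z)) holomorphic_on S"
  unfolding holomorphic_on_def field_differentiable_def
  using has_cderiv_functional[OF assms] has_field_derivative_at_within by blast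

text \<open>A value outside \<open>D\<close> is separated from \<open>D\<close> by the real part of
  a complex functional. Composed with \<open>b\<close> this is harmonic and attains its maximum on
  the circle, where \<open>b\<close> lies in \<open>D\<close>.\<close>

lemma convex_maximum_principle:
  fixes b :: "complex \<Rightarrow> 'a::complex_normed_vector"
  assumes D: "open D" "convex D"
    and b: "\<And>z. z \<in> cball 0 1 \<Longrightarrow> has_cderiv b (b' z) z"
    and bd: "\<And>z. z \<in> sphere 0 1 \<Longrightarrow> b z \<in> D"
    and z: "z \<in> cball 0 1"
  shows "b z \<in> D"
proof (rule ccontr)
  assume "b z \<notin> D"
  then obtain l where l: "bounded_linear l" "\<And>d. d \<in> D \<Longrightarrow> l d < (l (b z) :: real)"
    using separate_point_open_convex[OF D] by blast
  define \<Lambda> where "\<Lambda> = (\<lambda>x. Complex (l x) (- l (\<i> *\<^sub>C x)))"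
  have \<Lambda>: "clinear_functional \<Lambda>" unfolding \<Lambda>_def by (rule complexify_functional[OF l(1)])
  have hol: "(\<lambda>z. \<Lambda> (b z)) holomorphic_on cball 0 1"
    using b by (rule holomorphic_functional[OF \<Lambda>])
  have cont: "continuous_on (cball 0 1) (\<lambda>z. \<Lambda> (b z))" by (rule holomorphic_on_imp_continuous_on[OF hol])
  have "\<exists>w\<in>sphere (0::complex) 1. \<forall>y\<in>sphere 0 1. Re (\<Lambda> (b y)) \<le> Re (\<Lambda> (b w))"
    using continuous_on_subset[OF cont] by (intro continuous_attains_sup continuous_intros) auto
  then obtain w where w: "w \<in> sphere (0::complex) 1" "\<And>y. y \<in> sphere 0 1 \<Longrightarrow> Re (\<Lambda> (b y)) \<le> Re (\<Lambda> (b w))"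
    by blast
  have "Re (\<Lambda> (b z)) \<le> Re (\<Lambda> (b w))"
  proof (rule maximum_real_frontier[where S = "cball 0 1" and f = "\<lambda>z. \<Lambda> (b z)"])
    show "(\<lambda>z. \<Lambda> (b z)) holomorphic_on interior (cball 0 1)"
      by (rule holomorphic_on_subset[OF hol interior_subset])
    show "Re (\<Lambda> (b y)) \<le> Re (\<Lambda> (b w))" if "y \<in> frontier (cball 0 1)" for y
      using that by (intro w(2)) (simp add: frontier_cball)
  qed (use cont z in simp_all)
  moreover have "l (b w) < l (b z)" using l(2) bd[OF w(1)] by blast
  ultimately show False by (simp add: \<Lambda>_def)
qed

text \<open>The coefficients exist as integrals because the space is complete. Functionals turn them
  into ordinary Taylor coefficients, and since functionals separate points, the scalar expansions of
  \<open>f\<close> and of its derivative give the vector ones.\<close>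

lemma vector_taylor:
  fixes f :: "complex \<Rightarrow> 'a::cbanach"
  assumes f: "\<And>z. z \<in> ball 0 R \<Longrightarrow> has_cderiv f (f' z) z"
    and \<rho>: "0 < \<rho>" "\<rho> < R" and M: "\<And>z. z \<in> ball 0 R \<Longrightarrow> norm (f z) \<le> M"
  obtains c where "\<And>n. norm (c n) \<le> M / \<rho> ^ n"
    "\<And>z. z \<in> ball 0 \<rho> \<Longrightarrow> (\<lambda>n. z ^ n *\<^sub>C c n) sums f z"
    "\<And>z. z \<in> ball 0 \<rho> \<Longrightarrow> (\<lambda>n. (of_nat (Suc n) * z ^ n) *\<^sub>C c (Suc n)) sums f' z"
proof -
  have contf: "continuous_on (ball 0 R) f" using f by (rule continuous_on_has_cderiv)
  have in_ball: "of_real \<rho> * cis t \<in> ball 0 R" for t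
    using \<rho> by (simp add: norm_mult)
  \<comment> \<open>Cauchy's coefficient formula in the angle: the n-th coefficient is the mean of
    \<open>f\<close> times the (-n)-th power of the variable.\<close>
  define h where "h = (\<lambda>n t. (inverse (of_real \<rho> * cis t) ^ n / of_real (2 * pi)) *\<^sub>C f (of_real \<rho> * cis t))"
  have conth: "continuous_on {0..2*pi} (h n)" for n
    unfolding h_def using \<rho> in_ball
    by (intro continuous_intros continuous_on_compose2[OF contf]) auto
  define c where "c = (\<lambda>n. integral {0..2*pi} (h n))"
  have inth: "(h n has_integral c n) {0..2*pi}" for n
    unfolding c_def by (intro integrable_integral integrable_continuous_interval conth)
  have M0: "M \<ge> 0" using M[of 0] \<rho> norm_ge_zero[of "f 0"] by (simp del: norm_ge_zero)
  have normc: "norm (c n) \<le> M / \<rho> ^ n" for n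
  proof -
    have "norm (h n t) \<le> M / \<rho> ^ n / (2 * pi)" for t
    proof -
      have "norm (h n t) = norm (f (of_real \<rho> * cis t)) / \<rho> ^ n / (2 * pi)"
        using \<rho> by (simp add: h_def norm_scaleC norm_divide norm_power norm_inverse norm_mult divide_simps)
      also have "\<dots> \<le> M / \<rho> ^ n / (2 * pi)"
        using \<rho> by (intro divide_right_mono M in_ball) auto
      finally show ?thesis .
    qed
    then have "norm (c n) \<le> M / \<rho> ^ n / (2 * pi) * Henstock_Kurzweil_Integration.content (cbox 0 (2*pi))"
      using inth M0 \<rho> by (intro has_integral_bound) (auto simp: cbox_interval)
    then show ?thesis by simp
  qed
  have coeff: "\<Lambda> (c n) = (deriv ^^ n) (\<lambda>z. \<Lambda> (f z)) 0 / fact n" if \<Lambda>: "clinear_functional \<Lambda>" for \<Lambda> n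
  proof -
    let ?g = "\<lambda>z. \<Lambda> (f z)"
    have hol: "?g holomorphic_on ball 0 R" using f by (rule holomorphic_functional[OF \<Lambda>])
    have sub: "cball 0 \<rho> \<subseteq> ball (0::complex) R" using \<rho> by auto
    have "((\<lambda>u. ?g u / (u - 0) ^ Suc n) has_contour_integral
             (2 * pi * \<i>) / fact n * (deriv ^^ n) ?g 0) (circlepath 0 \<rho>)"
      using \<rho> hol sub
      by (intro Cauchy_has_contour_integral_higher_derivative_circlepath
            holomorphic_on_imp_continuous_on) (auto elim!: holomorphic_on_subset)
    then have 1: "((\<lambda>t. ?g (0 + \<rho> * cis t) / (0 + \<rho> * cis t - 0) ^ Suc n * \<rho> * \<i> * cis t)
        has_integral (2 * pi * \<i>) / fact n * (deriv ^^ n) ?g 0) {0..2*pi}"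
      unfolding circlepath_def by (subst (asm) has_contour_integral_part_circlepath_iff) auto
    have "((\<lambda>t. \<Lambda> (h n t)) has_integral \<Lambda> (c n)) {0..2*pi}"
      using has_integral_linear[OF inth clinear_functional_bounded_linear[OF \<Lambda>]] by (simp add: o_def)
    from has_integral_mult_right[OF this, of "2 * pi * \<i>"]
    have 2: "((\<lambda>t. 2 * pi * \<i> * \<Lambda> (h n t)) has_integral 2 * pi * \<i> * \<Lambda> (c n)) {0..2*pi}" .
    have 3: "2 * pi * \<i> * \<Lambda> (h n t) = ?g (0 + \<rho> * cis t) / (0 + \<rho> * cis t - 0) ^ Suc n * \<rho> * \<i> * cis t" for t
    proof -
      define w where "w = of_real \<rho> * cis t"
      have nz: "w \<noteq> 0" using \<rho> by (simp add: w_def)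
      have "\<Lambda> (h n t) = inverse w ^ n / of_real (2 * pi) * ?g w"
        by (simp add: h_def clinear_functional_scale[OF \<Lambda>] w_def)
      then have "2 * pi * \<i> * \<Lambda> (h n t) = ?g w / w ^ Suc n * (\<i> * w)"
        using nz by (simp add: power_inverse divide_simps mult_ac)
      also have "\<dots> = ?g (0 + \<rho> * cis t) / (0 + \<rho> * cis t - 0) ^ Suc n * \<rho> * \<i> * cis t"
        by (simp only: w_def add_0 diff_zero mult.assoc mult.left_commute[of "\<i>" "complex_of_real \<rho>"])
      finally show ?thesis .
    qed
    have "2 * pi * \<i> * \<Lambda> (c n) = (2 * pi * \<i>) / fact n * (deriv ^^ n) ?g 0"
      using 2 unfolding 3 by (rule has_integral_unique) (rule 1)
    then show ?thesis by (simp add: field_simps)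
  qed
  have geo: "summable (\<lambda>n. norm (z ^ n *\<^sub>C c n))"
    and geo': "summable (\<lambda>n. norm ((of_nat (Suc n) * z ^ n) *\<^sub>C c (Suc n)))" if z: "z \<in> ball 0 \<rho>" for z
  proof -
    let ?q = "norm z / \<rho>"
    have q: "0 \<le> ?q" "?q < 1" using z \<rho> by auto
    show "summable (\<lambda>n. norm (z ^ n *\<^sub>C c n))"
    proof (rule summable_comparison_test')
      show "summable (\<lambda>n. M * ?q ^ n)" using q by (intro summable_mult summable_geometric) simp
      show "norm (norm (z ^ n *\<^sub>C c n)) \<le> M * ?q ^ n" for n
        using mult_left_mono[OF normc[of n], of "norm z ^ n"] by (simp add: norm_scaleC norm_power power_divide mult.commute)
    qed
    show "summable (\<lambda>n. norm ((of_nat (Suc n) * z ^ n) *\<^sub>C c (Suc n)))"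
    proof (rule summable_comparison_test')
      \<comment> \<open>Differentiating the geometric series termwise shows that
        \<open>Suc n * q ^ n\<close> is summable.\<close>
      have "summable (\<lambda>n. diffs (\<lambda>n. 1) n * ?q ^ n)"
        by (rule termdiff_converges[of _ 1]) (use q in \<open>auto intro: summable_geometric\<close>)
      then show "summable (\<lambda>n. M / \<rho> * (of_nat (Suc n) * ?q ^ n))"
        by (intro summable_mult) (simp add: diffs_def)
      show "norm (norm ((of_nat (Suc n) * z ^ n) *\<^sub>C c (Suc n))) \<le> M / \<rho> * (of_nat (Suc n) * ?q ^ n)" for n
      proof -
        have "norm ((of_nat (Suc n) * z ^ n) *\<^sub>C c (Suc n)) = real (Suc n) * norm z ^ n * norm (c (Suc n))"
          by (simp add: norm_scaleC norm_mult norm_power del: of_nat_Suc)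
        also have "\<dots> \<le> real (Suc n) * norm z ^ n * (M / \<rho> ^ Suc n)"
          by (intro mult_left_mono normc) auto
        finally show ?thesis by (simp add: power_divide field_simps)
      qed
    qed
  qed
  have "(\<lambda>n. z ^ n *\<^sub>C c n) sums f z \<and> (\<lambda>n. (of_nat (Suc n) * z ^ n) *\<^sub>C c (Suc n)) sums f' z"
    if z: "z \<in> ball 0 \<rho>" for z
  proof
    have zR: "z \<in> ball 0 R" using z \<rho> by auto
    have s: "(\<lambda>n. z ^ n *\<^sub>C c n) sums (\<Sum>n. z ^ n *\<^sub>C c n)"
      by (intro summable_sums summable_norm_cancel[OF geo[OF z]])
    have s': "(\<lambda>n. (of_nat (Suc n) * z ^ n) *\<^sub>C c (Suc n)) sums (\<Sum>n. (of_nat (Suc n) * z ^ n) *\<^sub>C c (Suc n))"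
      by (intro summable_sums summable_norm_cancel[OF geo'[OF z]])
    have "(\<Sum>n. z ^ n *\<^sub>C c n) = f z"
    proof (rule clinear_functionals_separate)
      fix \<Lambda> :: "'a \<Rightarrow> complex" assume \<Lambda>: "clinear_functional \<Lambda>"
      have hol: "(\<lambda>z. \<Lambda> (f z)) holomorphic_on ball 0 R" using f by (rule holomorphic_functional[OF \<Lambda>])
      have "(\<lambda>n. \<Lambda> (z ^ n *\<^sub>C c n)) sums \<Lambda> (\<Sum>n. z ^ n *\<^sub>C c n)"
        by (rule bounded_linear.sums[OF clinear_functional_bounded_linear[OF \<Lambda>] s])
      moreover have "(\<lambda>n. \<Lambda> (z ^ n *\<^sub>C c n)) sums \<Lambda> (f z)"
        using holomorphic_power_series[OF hol zR]
        by (simp add: clinear_functional_scale[OF \<Lambda>] coeff[OF \<Lambda>] mult.commute)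
      ultimately show "\<Lambda> (\<Sum>n. z ^ n *\<^sub>C c n) = \<Lambda> (f z)" by (rule sums_unique2)
    qed
    with s show "(\<lambda>n. z ^ n *\<^sub>C c n) sums f z" by simp
    have "(\<Sum>n. (of_nat (Suc n) * z ^ n) *\<^sub>C c (Suc n)) = f' z"
    proof (rule clinear_functionals_separate)
      fix \<Lambda> :: "'a \<Rightarrow> complex" assume \<Lambda>: "clinear_functional \<Lambda>"
      let ?g = "\<lambda>z. \<Lambda> (f z)"
      have hol: "deriv ?g holomorphic_on ball 0 R"
        using f by (intro holomorphic_deriv holomorphic_functional[OF \<Lambda>]) auto
      have "(\<lambda>n. \<Lambda> ((of_nat (Suc n) * z ^ n) *\<^sub>C c (Suc n))) sums \<Lambda> (\<Sum>n. (of_nat (Suc n) * z ^ n) *\<^sub>C c (Suc n))"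
        by (rule bounded_linear.sums[OF clinear_functional_bounded_linear[OF \<Lambda>] s'])
      moreover have "(\<lambda>n. \<Lambda> ((of_nat (Suc n) * z ^ n) *\<^sub>C c (Suc n))) sums deriv ?g z"
      proof -
        have "(deriv ^^ n) (deriv ?g) 0 / fact n * (z - 0) ^ n = \<Lambda> ((of_nat (Suc n) * z ^ n) *\<^sub>C c (Suc n))" for n
          by (simp add: clinear_functional_scale[OF \<Lambda>] coeff[OF \<Lambda>] funpow_swap1 del: of_nat_Suc)
        then show ?thesis using holomorphic_power_series[OF hol zR] by simp
      qed
      moreover have "deriv ?g z = \<Lambda> (f' z)"
        by (rule DERIV_imp_deriv[OF has_cderiv_functional[OF \<Lambda> f[OF zR]]])
      ultimately show "\<Lambda> (\<Sum>n. (of_nat (Suc n) * z ^ n) *\<^sub>C c (Suc n)) = \<Lambda> (f' z)"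
        using sums_unique2 by simp
    qed
    with s' show "(\<lambda>n. (of_nat (Suc n) * z ^ n) *\<^sub>C c (Suc n)) sums f' z" by simp
  qed
  with normc that show ?thesis by blast
qed

section \<open>Discs and the dual extremal problem\<close>

lemma sums_scaleC_at_0:
  fixes c :: "nat \<Rightarrow> 'a::complex_normed_vector"
  assumes "(\<lambda>n. (a n * 0 ^ n) *\<^sub>C c n) sums s"
  shows "s = a 0 *\<^sub>C c 0"
proof (rule sums_unique2[OF assms])
  have "(\<lambda>n. (a n * 0 ^ n) *\<^sub>C c n) sums (\<Sum>n\<in>{0}. (a n * 0 ^ n) *\<^sub>C c n)"
    by (rule sums_finite) (auto simp: power_0_left)
  then show "(\<lambda>n. (a n * 0 ^ n) *\<^sub>C c n) sums (a 0 *\<^sub>C c 0)" by simp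
qed

lemma hol_mapsD:
  assumes "f \<in> hol_maps S D" "z \<in> S"
  shows "has_cderiv f (cderiv f z) z" "f z \<in> D"
  using assms cderivI by (fastforce simp: hol_maps_def)+

lemma hol_mapsI:
  "(\<And>z. z \<in> S \<Longrightarrow> has_cderiv f (f' z) z) \<Longrightarrow> (\<And>z. z \<in> S \<Longrightarrow> f z \<in> D) \<Longrightarrow> f \<in> hol_maps S D"
  by (auto simp: hol_maps_def)

lemma hol_maps_taylor:
  fixes f :: "complex \<Rightarrow> 'a::cbanach"
  assumes f: "f \<in> hol_maps (ball 0 R) D" and M: "\<And>d. d \<in> D \<Longrightarrow> norm d \<le> M"
    and \<rho>: "0 < \<rho>" "\<rho> < R"
  obtains c where "\<And>n. norm (c n) \<le> M / \<rho> ^ n"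
    "\<And>z. z \<in> ball 0 \<rho> \<Longrightarrow> (\<lambda>n. z ^ n *\<^sub>C c n) sums f z"
    "\<And>z. z \<in> ball 0 \<rho> \<Longrightarrow> (\<lambda>n. (of_nat (Suc n) * z ^ n) *\<^sub>C c (Suc n)) sums cderiv f z"
    "c 0 = f 0" "c 1 = cderiv f 0"
proof -
  obtain c where c: "\<And>n. norm (c n) \<le> M / \<rho> ^ n"
    "\<And>z. z \<in> ball 0 \<rho> \<Longrightarrow> (\<lambda>n. z ^ n *\<^sub>C c n) sums f z"
    "\<And>z. z \<in> ball 0 \<rho> \<Longrightarrow> (\<lambda>n. (of_nat (Suc n) * z ^ n) *\<^sub>C c (Suc n)) sums cderiv f z"
  proof (rule vector_taylor[where f = f and f' = "cderiv f" and R = R and \<rho> = \<rho> and M = M])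
    show "has_cderiv f (cderiv f z) z" if "z \<in> ball 0 R" for z by (rule hol_mapsD(1)[OF f that])
    show "norm (f z) \<le> M" if "z \<in> ball 0 R" for z by (rule M[OF hol_mapsD(2)[OF f that]])
  qed (use \<rho> in auto)
  have 0: "0 \<in> ball (0::complex) \<rho>" using \<rho> by simp
  have "c 0 = f 0" using sums_scaleC_at_0[of "\<lambda>_. 1" c "f 0"] c(2)[OF 0] by simp
  moreover have "c 1 = cderiv f 0"
    using sums_scaleC_at_0[of "\<lambda>n. of_nat (Suc n)" "\<lambda>n. c (Suc n)" "cderiv f 0"] c(3)[OF 0] by simp
  ultimately show ?thesis using that c by blast
qed

section \<open>First bounds for the metric and polynomial discs\<close>

lemma bounded_norm_bound:
  assumes "bounded D"
  obtains M where "M > 0" "\<And>d. d \<in> D \<Longrightarrow> norm d \<le> M"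
  using assms by (auto simp: bounded_pos)

lemma kobayashi_le:
  assumes "\<eta> > 0" "f \<in> hol_maps (ball 0 1) D" "f 0 = p" "\<eta> *\<^sub>R cderiv f 0 = v"
  shows "kobayashi D p v \<le> \<eta>"
  unfolding kobayashi_def using assms by (intro cInf_lower bdd_belowI[of _ 0]) auto

lemma kobayashi_ltE:
  assumes "open D" "p \<in> D" "kobayashi D p v < \<eta>"
  obtains \<eta>0 f where "0 < \<eta>0" "\<eta>0 < \<eta>" "f \<in> hol_maps (ball 0 1) D" "f 0 = p" "\<eta>0 *\<^sub>R cderiv f 0 = v"
proof -
  let ?S = "{\<eta>. \<eta> > 0 \<and> (\<exists>f\<in>hol_maps (ball 0 1) D. f 0 = p \<and> \<eta> *\<^sub>R cderiv f 0 = v)}"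
  have "bdd_below ?S" by (rule bdd_belowI[of _ 0]) auto
  then have "\<exists>\<eta>0\<in>?S. \<eta>0 < \<eta>"
    using kobayashi_set_nonempty[OF assms(1,2)] assms(3) unfolding kobayashi_def
    by (subst (asm) cInf_less_iff) auto
  then show ?thesis using that by blast
qed

text \<open>Cauchy's estimate at radius 1/2 bounds the derivative at 0 of every competing disc by
  \<open>2 * M\<close>.\<close>

lemma kobayashi_pos:
  fixes D :: "'a::cbanach set"
  assumes D: "open D" "bounded D" "p \<in> D" and v: "v \<noteq> 0"
  shows "kobayashi D p v > 0"
proof -
  obtain M where M: "M > 0" "\<And>d. d \<in> D \<Longrightarrow> norm d \<le> M" using bounded_norm_bound[OF D(2)] by blast
  have "norm v / (2 * M) \<le> \<eta>"
    if \<eta>: "\<eta> > 0" and f: "f \<in> hol_maps (ball 0 1) D" "f 0 = p" "\<eta> *\<^sub>R cderiv f 0 = v" for \<eta> f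
  proof -
    obtain c where c: "\<And>n. norm (c n) \<le> M / (1 / 2) ^ n" "c 1 = cderiv f 0"
      by (rule hol_maps_taylor[OF f(1) M(2), of "1 / 2"]) auto
    then have "norm v \<le> \<eta> * (2 * M)"
      using c(1)[of 1] c(2) \<eta> by (simp add: mult.commute flip: f(3))
    then show ?thesis using M(1) by (simp add: field_simps)
  qed
  then have "norm v / (2 * M) \<le> kobayashi D p v"
    unfolding kobayashi_def using kobayashi_set_nonempty[OF D(1,3)] by (intro cInf_greatest) auto
  moreover have "norm v / (2 * M) > 0" using v M(1) by simp
  ultimately show ?thesis by linarith
qed

lemma norm_tail_geometric:
  fixes a :: "nat \<Rightarrow> 'a::banach"
  assumes s: "a sums s" and a: "\<And>n. norm (a n) \<le> M * q ^ n" and q: "0 \<le> q" "q < 1"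
  shows "norm (s - (\<Sum>i<n. a i)) \<le> M * q ^ n / (1 - q)"
proof -
  have geo: "(\<lambda>i. M * q ^ n * q ^ i) sums (M * q ^ n * (1 / (1 - q)))"
    using q by (intro sums_mult geometric_sums) simp
  have le: "norm (a (i + n)) \<le> M * q ^ n * q ^ i" for i
    using a[of "i + n"] by (simp add: power_add mult_ac)
  have "(\<lambda>i. a (i + n)) sums (s - (\<Sum>i<n. a i))" using s by (subst sums_iff_shift) simp
  then have "s - (\<Sum>i<n. a i) = (\<Sum>i. a (i + n))" by (rule sums_unique)
  also have "norm \<dots> \<le> (\<Sum>i. M * q ^ n * q ^ i)"
    using le by (intro norm_suminf_le sums_summable[OF geo]) auto
  also have "\<dots> = M * q ^ n / (1 - q)" using sums_unique[OF geo] by simp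
  finally show ?thesis .
qed

text \<open>The strict inequality is spent on shrinking a competitor, which leaves room inside
  \<open>D\<close> for replacing it by a Taylor polynomial. Polynomials are defined beyond the
  closed disc, so they can be composed with maps of the circle, and they reduce residues to finite
  sums.\<close>

lemma polynomial_disc:
  fixes D :: "'a::cbanach set"
  assumes D: "open D" "bounded D" "p \<in> D" and k: "kobayashi D p v < \<eta>"
  obtains n a where "a 0 = p" "\<eta> *\<^sub>R a 1 = v" "\<And>z. z \<in> cball 0 1 \<Longrightarrow> (\<Sum>i<n. z ^ i *\<^sub>C a i) \<in> D" "n \<ge> 2"
proof -
  obtain M where M: "M > 0" "\<And>d. d \<in> D \<Longrightarrow> norm d \<le> M" using bounded_norm_bound[OF D(2)] by blast
  obtain \<eta>0 f where f: "0 < \<eta>0" "\<eta>0 < \<eta>" "f \<in> hol_maps (ball 0 1) D" "f 0 = p" "\<eta>0 *\<^sub>R cderiv f 0 = v"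
    using kobayashi_ltE[OF D(1,3) k] by blast
  \<comment> \<open>Shrinking by exactly this ratio turns the derivative \<open>v / \<eta>0\<close>
    into \<open>v / \<eta>\<close>. The larger radius \<open>\<rho>'\<close> then provides
    coefficient bounds with geometric decay on the circle of radius \<open>\<rho>\<close>.\<close>
  define \<rho> where "\<rho> = \<eta>0 / \<eta>"
  have \<rho>: "0 < \<rho>" "\<rho> < 1" using f(1,2) by (auto simp: \<rho>_def)
  define \<rho>' where "\<rho>' = (\<rho> + 1) / 2"
  have \<rho>': "0 < \<rho>'" "\<rho> < \<rho>'" "\<rho>' < 1" using \<rho> by (auto simp: \<rho>'_def)
  obtain c where c: "\<And>n. norm (c n) \<le> M / \<rho>' ^ n"
    "\<And>z. z \<in> ball 0 \<rho>' \<Longrightarrow> (\<lambda>n. z ^ n *\<^sub>C c n) sums f z" "c 0 = f 0" "c 1 = cderiv f 0"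
    using hol_maps_taylor[OF f(3) M(2) \<rho>'(1,3)] by metis
  have contf: "continuous_on (ball 0 1) f"
    using hol_mapsD(1)[OF f(3)] by (rule continuous_on_has_cderiv)
  have sub: "cball 0 \<rho> \<subseteq> ball (0::complex) 1" using \<rho> by auto
  have "compact (f ` cball 0 \<rho>)" by (intro compact_continuous_image continuous_on_subset[OF contf sub]) simp
  moreover have "f ` cball 0 \<rho> \<subseteq> D" using hol_mapsD(2)[OF f(3)] sub by auto
  ultimately obtain e where e: "e > 0" "(\<Union>y\<in>f ` cball 0 \<rho>. ball y e) \<subseteq> D"
    using compact_subset_open_imp_ball_epsilon_subset[OF _ D(1)] by metis
  define q where "q = \<rho> / \<rho>'"
  have q: "0 \<le> q" "q < 1" using \<rho> \<rho>' by (auto simp: q_def)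
  have "(\<lambda>n. M * q ^ n / (1 - q)) \<longlonglongrightarrow> M * 0 / (1 - q)"
    using q by (intro tendsto_intros LIMSEQ_power_zero) auto
  then have "\<forall>\<^sub>F n in sequentially. M * q ^ n / (1 - q) < e" using e(1) by (simp add: order_tendsto_iff)
  then have "\<forall>\<^sub>F n in sequentially. M * q ^ n / (1 - q) < e \<and> n \<ge> 2"
    by (intro eventually_conj eventually_ge_at_top)
  then obtain n where n: "M * q ^ n / (1 - q) < e" "n \<ge> 2" using eventually_happens by force
  define a where "a = (\<lambda>i. of_real (\<rho> ^ i) *\<^sub>C c i)"
  show ?thesis
  proof (rule that[of a])
    show "a 0 = p" by (simp add: a_def c(3) f(4))
    have "a 1 = \<rho> *\<^sub>R cderiv f 0" using c(4) by (simp add: a_def scaleC_of_real)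
    then show "\<eta> *\<^sub>R a 1 = v" using f(1,2) by (simp add: \<rho>_def flip: f(5))
    show "n \<ge> 2" by fact
    fix z :: complex assume z: "z \<in> cball 0 1"
    define w where "w = of_real \<rho> * z"
    have w: "w \<in> cball 0 \<rho>" using z \<rho> by (simp add: w_def norm_mult mult_left_le)
    have "norm (w ^ i *\<^sub>C c i) \<le> M * q ^ i" for i
    proof -
      have "norm (w ^ i *\<^sub>C c i) \<le> \<rho> ^ i * (M / \<rho>' ^ i)"
        using w \<rho> unfolding norm_scaleC norm_power
        by (intro mult_mono power_mono c(1)) auto
      then show ?thesis by (simp add: q_def power_divide mult.commute)
    qed
    then have "norm (f w - (\<Sum>i<n. w ^ i *\<^sub>C c i)) \<le> M * q ^ n / (1 - q)"
      using w \<rho>' q by (intro norm_tail_geometric c(2)) auto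
    then have "(\<Sum>i<n. w ^ i *\<^sub>C c i) \<in> ball (f w) e" using n(1) by (simp add: dist_norm)
    then have "(\<Sum>i<n. w ^ i *\<^sub>C c i) \<in> D" using e(2) w by blast
    then show "(\<Sum>i<n. z ^ i *\<^sub>C a i) \<in> D"
      by (simp add: a_def w_def power_mult_distrib scaleC_scaleC mult.commute)
  qed
qed

text \<open>If \<open>\<eta>1 < kobayashi D x v\<close>, no disc \<open>\<zeta> \<mapsto> x + \<zeta> v / \<eta>1 + \<zeta>\<^sup>2 b(\<zeta>)\<close> maps the unit circle into
  \<open>D\<close>.  The functional \<open>L\<close> separates these discs from the continuous maps of the circle into \<open>D\<close>.\<close>

locale dual_functional =
  fixes D :: "'a::cbanach set" and x v :: 'a and \<eta>1 :: real and L :: "(complex \<Rightarrow> 'a) \<Rightarrow> complex"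
  assumes L_add: "\<lbrakk>continuous_on (sphere 0 1) u; continuous_on (sphere 0 1) w\<rbrakk>
      \<Longrightarrow> L (\<lambda>\<zeta>. u \<zeta> + w \<zeta>) = L u + L w"
    and L_scale: "continuous_on (sphere 0 1) u \<Longrightarrow> L (\<lambda>\<zeta>. c *\<^sub>C u \<zeta>) = c * L u"
    and L_cong: "(\<And>\<zeta>. \<zeta> \<in> sphere 0 1 \<Longrightarrow> u \<zeta> = w \<zeta>) \<Longrightarrow> L u = L w"
    and L_hol: "R > 1 \<Longrightarrow> (\<And>z. z \<in> ball 0 R \<Longrightarrow> has_cderiv b (b' z) z) \<Longrightarrow> L (\<lambda>\<zeta>. \<zeta>\<^sup>2 *\<^sub>C b \<zeta>) = 0"
    and L_le: "\<lbrakk>continuous_on (sphere 0 1) u; \<And>\<zeta>. \<zeta> \<in> sphere 0 1 \<Longrightarrow> u \<zeta> \<in> D\<rbrakk>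
      \<Longrightarrow> Re (L u) \<le> Re (L (\<lambda>_. x)) + 1 / \<eta>1"
    and L_v: "Re (L (\<lambda>\<zeta>. \<zeta> *\<^sub>C v)) = 1"

text \<open>As a bounded function of the angle, a continuous map of the circle becomes a vector of a
  normed space, to which separation applies.\<close>

definition on_circle :: "(complex \<Rightarrow> 'a::real_normed_vector) \<Rightarrow> real \<Rightarrow>\<^sub>C 'a" where
  "on_circle u = Bcontfun (\<lambda>\<theta>. u (cis \<theta>))"

lemma apply_on_circle:
  assumes "continuous_on (sphere 0 1) u"
  shows "apply_bcontfun (on_circle u) \<theta> = u (cis \<theta>)"
proof -
  have "bounded (u ` sphere 0 1)"
    by (intro compact_imp_bounded compact_continuous_image assms) simp
  then have "bounded (range (\<lambda>\<theta>. u (cis \<theta>)))"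
    by (rule bounded_subset) (auto simp: image_iff)
  moreover have "continuous_on UNIV (\<lambda>\<theta>. u (cis \<theta>))"
    by (intro continuous_on_compose2[OF assms] continuous_intros) auto
  ultimately show ?thesis
    unfolding on_circle_def by (subst Bcontfun_inverse) (auto simp: bcontfun_def)
qed

lemma ex_dual_functional:
  fixes D :: "'a::cbanach set"
  assumes D: "open D" "convex D" "x \<in> D" and \<eta>1: "0 < \<eta>1" "\<eta>1 < kobayashi D x v"
  obtains L where "dual_functional D x v \<eta>1 L"
proof -
  let ?S = "sphere (0::complex) 1"
  have J_eqI: "on_circle u = U" if "continuous_on ?S u" "\<And>\<theta>. u (cis \<theta>) = apply_bcontfun U \<theta>"
    for u :: "complex \<Rightarrow> 'a" and U
    using that by (intro bcontfun_eqI) (simp add: apply_on_circle)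
  have J_add: "on_circle (\<lambda>\<zeta>. u \<zeta> + w \<zeta>) = on_circle u + on_circle w"
    if "continuous_on ?S u" "continuous_on ?S w" for u w :: "complex \<Rightarrow> 'a"
    using that by (intro J_eqI continuous_intros) (auto simp: apply_on_circle)
  have J_scale: "on_circle (\<lambda>\<zeta>. r *\<^sub>R u \<zeta>) = r *\<^sub>R on_circle u"
    if "continuous_on ?S u" for r and u :: "complex \<Rightarrow> 'a"
    using that by (intro J_eqI continuous_intros) (auto simp: apply_on_circle)
  \<comment> \<open>The vectors of this space are functions on the whole line, not necessarily
    periodic. The margin \<open>e\<close>, uniform in the angle, makes the set open in the sup norm;
    for maps from the circle compactness supplies it.\<close>
  define A where "A = {U :: real \<Rightarrow>\<^sub>C 'a. \<exists>e>0. \<forall>\<theta>. ball (U \<theta>) e \<subseteq> D}"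
  \<comment> \<open>Holomorphy across the circle makes the restrictions to it continuous and the
    maximum principle applicable.\<close>
  define nice where "nice = (\<lambda>b :: complex \<Rightarrow> 'a. \<exists>R b'. R > 1 \<and> (\<forall>z\<in>ball 0 R. has_cderiv b (b' z) z))"
  have nice_cont: "continuous_on (cball 0 1) b" "continuous_on ?S b" if "nice b" for b
  proof -
    obtain R b' where R: "R > 1" "\<And>z. z \<in> ball 0 R \<Longrightarrow> has_cderiv b (b' z) z"
      using \<open>nice b\<close> unfolding nice_def by blast
    have "continuous_on (ball 0 R) b" using R(2) by (rule continuous_on_has_cderiv)
    then show "continuous_on (cball 0 1) b" "continuous_on ?S b"
      by (auto intro: continuous_on_subset simp: subset_iff R(1) order.strict_trans1)
  qed
  have nice_scaleC: "nice (\<lambda>\<zeta>. c *\<^sub>C b \<zeta>)" if "nice b" for b c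
  proof -
    obtain R b' where R: "R > 1" "\<And>z. z \<in> ball 0 R \<Longrightarrow> has_cderiv b (b' z) z"
      using \<open>nice b\<close> unfolding nice_def by blast
    show ?thesis
      unfolding nice_def using R(1)
      by (intro exI[of _ R] exI[of _ "\<lambda>z. 0 *\<^sub>C b z + c *\<^sub>C b' z"] conjI ballI has_cderiv_scaleC R(2)) auto
  qed
  have nice_scale: "nice (\<lambda>\<zeta>. r *\<^sub>R b \<zeta>)" if "nice b" for b r
    using nice_scaleC[OF that, of "of_real r"] by (simp add: scaleC_of_real)
  have nice_add: "nice (\<lambda>\<zeta>. b \<zeta> + d \<zeta>)" if "nice b" "nice d" for b d
  proof -
    obtain R b' where R: "R > 1" "\<And>z. z \<in> ball 0 R \<Longrightarrow> has_cderiv b (b' z) z"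
      using \<open>nice b\<close> unfolding nice_def by blast
    obtain R2 d' where R2: "R2 > 1" "\<And>z. z \<in> ball 0 R2 \<Longrightarrow> has_cderiv d (d' z) z"
      using \<open>nice d\<close> unfolding nice_def by blast
    show ?thesis
      unfolding nice_def using R R2
      by (intro exI[of _ "min R R2"] exI[of _ "\<lambda>z. b' z + d' z"]) (auto intro: has_cderiv_add)
  qed
  have nice_0: "nice (\<lambda>_. 0)"
    unfolding nice_def by (intro exI[of _ 2] exI[of _ "\<lambda>_. 0"]) (auto intro: has_cderiv_const)
  define disc where "disc = (\<lambda>b \<zeta>. x + \<zeta> *\<^sub>C ((1 / \<eta>1) *\<^sub>R v) + \<zeta>\<^sup>2 *\<^sub>C b \<zeta>)"
  have disc_cont: "continuous_on ?S (disc b)" if "nice b" for b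
    unfolding disc_def by (intro continuous_intros nice_cont that)
  define m where "m = (\<lambda>b. on_circle (disc b))"
  define C where "C = (\<Union>b\<in>Collect nice. (\<lambda>U. m b - U) ` A)"
  have open_A: "open A"
    unfolding open_dist
  proof safe
    fix U assume "U \<in> A"
    then obtain e where e: "e > 0" "\<And>\<theta>. ball (U \<theta>) e \<subseteq> D" by (auto simp: A_def)
    have "U' \<in> A" if U': "dist U' U < e / 2" for U'
    proof -
      have "ball (U' \<theta>) (e / 2) \<subseteq> ball (U \<theta>) e" for \<theta>
      proof
        fix y assume "y \<in> ball (U' \<theta>) (e / 2)"
        moreover have "dist (U' \<theta>) (U \<theta>) < e / 2" using dist_bounded[of U' \<theta> U] U' by linarith
        ultimately show "y \<in> ball (U \<theta>) e"
          using dist_triangle[of "U \<theta>" y "U' \<theta>"] by (simp add: dist_commute)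
      qed
      then show ?thesis
        unfolding A_def using e by (intro CollectI exI[of _ "e / 2"]) (auto intro: order_trans)
    qed
    then show "\<exists>e>0. \<forall>U'. dist U' U < e \<longrightarrow> U' \<in> A" using e(1) by (intro exI[of _ "e / 2"]) auto
  qed
  have convex_A: "s *\<^sub>R U + t *\<^sub>R W \<in> A" if st: "s \<ge> 0" "t \<ge> 0" "s + t = 1" and UW: "U \<in> A" "W \<in> A" for s t U W
  proof -
    obtain e1 where e1: "e1 > 0" "\<And>\<theta>. ball (U \<theta>) e1 \<subseteq> D" using UW by (auto simp: A_def)
    obtain e2 where e2: "e2 > 0" "\<And>\<theta>. ball (W \<theta>) e2 \<subseteq> D" using UW by (auto simp: A_def)
    define e where "e = min e1 e2"
    have "y \<in> D" if y: "y \<in> ball (s *\<^sub>R U \<theta> + t *\<^sub>R W \<theta>) e" for \<theta> y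
    proof -
      define d where "d = y - (s *\<^sub>R U \<theta> + t *\<^sub>R W \<theta>)"
      have d: "norm d < e" using y by (simp add: d_def dist_norm norm_minus_commute)
      have "U \<theta> + d \<in> D" "W \<theta> + d \<in> D"
        using d e1(2)[of \<theta>] e2(2)[of \<theta>] by (auto simp: e_def subset_iff dist_norm)
      then have "s *\<^sub>R (U \<theta> + d) + t *\<^sub>R (W \<theta> + d) \<in> D" using st by (intro convexD[OF D(2)])
      also have "s *\<^sub>R (U \<theta> + d) + t *\<^sub>R (W \<theta> + d) = s *\<^sub>R U \<theta> + t *\<^sub>R W \<theta> + (s + t) *\<^sub>R d"
        by (simp add: algebra_simps)
      finally show ?thesis using st by (simp add: d_def)
    qed
    then show ?thesis
      unfolding A_def using e1(1) e2(1) by (intro CollectI exI[of _ e]) (auto simp: e_def)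
  qed
  have m_convex: "s *\<^sub>R m b + t *\<^sub>R m d = m (\<lambda>\<zeta>. s *\<^sub>R b \<zeta> + t *\<^sub>R d \<zeta>)"
    if st: "s + t = 1" and bd: "nice b" "nice d" for s t b d
  proof -
    have "m (\<lambda>\<zeta>. s *\<^sub>R b \<zeta> + t *\<^sub>R d \<zeta>) = on_circle (\<lambda>\<zeta>. s *\<^sub>R disc b \<zeta> + t *\<^sub>R disc d \<zeta>)"
      unfolding m_def
    proof (intro arg_cong[where f = on_circle] ext)
      fix \<zeta>
      define y where "y = x + \<zeta> *\<^sub>C ((1 / \<eta>1) *\<^sub>R v)"
      have "y = s *\<^sub>R y + t *\<^sub>R y" using st by (simp flip: scaleR_add_left)
      moreover have "disc b' \<zeta> = y + \<zeta>\<^sup>2 *\<^sub>C b' \<zeta>" for b' by (simp add: disc_def y_def)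
      ultimately show "disc (\<lambda>\<zeta>. s *\<^sub>R b \<zeta> + t *\<^sub>R d \<zeta>) \<zeta> = s *\<^sub>R disc b \<zeta> + t *\<^sub>R disc d \<zeta>"
        by (simp add: scaleC.add_right scaleC.scaleR_right scaleR_add_right add_ac)
    qed
    also have "\<dots> = s *\<^sub>R m b + t *\<^sub>R m d"
      unfolding m_def using disc_cont bd
      by (subst J_add J_scale | intro continuous_intros | simp)+
    finally show ?thesis by simp
  qed
  have open_C: "open C"
  proof -
    have "(\<lambda>U. m b - U) ` A = (+) (m b) ` uminus ` A" for b by (auto simp: image_image)
    then show ?thesis
      unfolding C_def by (auto intro!: open_UN open_translation open_negations open_A)
  qed
  have convex_C: "convex C"
  proof (rule convexI)
    fix Y Z and s t :: real assume Y: "Y \<in> C" and Z: "Z \<in> C" and st: "0 \<le> s" "0 \<le> t" "s + t = 1"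
    obtain b U where b: "nice b" "U \<in> A" "Y = m b - U" using Y by (auto simp: C_def)
    obtain d W where d: "nice d" "W \<in> A" "Z = m d - W" using Z by (auto simp: C_def)
    have "s *\<^sub>R Y + t *\<^sub>R Z = (s *\<^sub>R m b + t *\<^sub>R m d) - (s *\<^sub>R U + t *\<^sub>R W)"
      by (simp add: b d algebra_simps)
    also have "\<dots> = m (\<lambda>\<zeta>. s *\<^sub>R b \<zeta> + t *\<^sub>R d \<zeta>) - (s *\<^sub>R U + t *\<^sub>R W)"
      by (simp only: m_convex[OF st(3) b(1) d(1)])
    finally show "s *\<^sub>R Y + t *\<^sub>R Z \<in> C"
      unfolding C_def using convex_A[OF st b(2) d(2)] nice_add[OF nice_scale[OF b(1)] nice_scale[OF d(1)]]
      by blast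
  qed
  \<comment> \<open>Otherwise some \<open>disc b\<close> maps the circle into \<open>D\<close>,
    hence also the disc by the maximum principle, and \<open>\<eta>1\<close> would compete in the
    infimum that defines the metric.\<close>
  have "0 \<notin> C"
  proof
    assume "0 \<in> C"
    then obtain b where b: "nice b" "m b \<in> A" by (auto simp: C_def)
    obtain R b' where R: "R > 1" "\<And>z. z \<in> ball 0 R \<Longrightarrow> has_cderiv b (b' z) z"
      using b(1) unfolding nice_def by blast
    define g' where "g' = (\<lambda>z. (0 + 1 *\<^sub>C ((1 / \<eta>1) *\<^sub>R v)) + ((2 * z) *\<^sub>C b z + z\<^sup>2 *\<^sub>C b' z))"
    have der: "has_cderiv (disc b) (g' z) z" if "z \<in> ball 0 R" for z
      unfolding disc_def g'_def
      by (intro has_cderiv_add has_cderiv_const has_cderiv_scaleC_const has_cderiv_scaleC R(2) that)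
         (auto intro!: derivative_eq_intros)
    have bd: "disc b z \<in> D" if "z \<in> ?S" for z
    proof -
      have "z \<noteq> 0" "norm z = 1" using that by auto
      then have "cis (Arg z) = z" by (simp add: cis_Arg sgn_div_norm)
      then obtain \<theta> where \<theta>: "z = cis \<theta>" by metis
      have "m b \<theta> \<in> D" using b(2) centre_in_ball unfolding A_def by blast
      then show ?thesis using apply_on_circle[OF disc_cont[OF b(1)]] \<theta> by (simp add: m_def)
    qed
    have "disc b z \<in> D" if "z \<in> cball 0 1" for z
      by (rule convex_maximum_principle[OF D(1,2) der bd that]) (use R(1) in auto)
    then have "disc b \<in> hol_maps (ball 0 1) D"
      using R(1) by (intro hol_mapsI[where f' = g'] der) auto
    moreover have "disc b 0 = x" by (simp add: disc_def scaleC.zero_left)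
    moreover have "\<eta>1 *\<^sub>R cderiv (disc b) 0 = v"
      using R(1) \<eta>1 by (subst cderivI[OF der]) (auto simp: g'_def scaleC.zero_left)
    ultimately have "kobayashi D x v \<le> \<eta>1" by (intro kobayashi_le \<eta>1)
    with \<eta>1 show False by simp
  qed
  with open_C convex_C obtain l where l: "bounded_linear l" "\<And>c. c \<in> C \<Longrightarrow> (0::real) < l c"
    using separate_open_convex_zero by blast
  interpret l: bounded_linear l by fact
  have in_A: "on_circle u \<in> A" if u: "continuous_on ?S u" "\<And>\<zeta>. \<zeta> \<in> ?S \<Longrightarrow> u \<zeta> \<in> D" for u
  proof -
    have "compact (u ` ?S)" by (intro compact_continuous_image u) simp
    moreover have "u ` ?S \<subseteq> D" using u(2) by auto
    ultimately obtain e where e: "e > 0" "(\<Union>y\<in>u ` ?S. ball y e) \<subseteq> D"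
      using compact_subset_open_imp_ball_epsilon_subset[OF _ D(1)] by metis
    have "ball (u (cis \<theta>)) e \<subseteq> D" for \<theta>
    proof -
      have "cis \<theta> \<in> ?S" by simp
      then show ?thesis using e(2) by blast
    qed
    then show ?thesis unfolding A_def using e(1) apply_on_circle[OF u(1)] by auto
  qed
  have lt: "l U < l (m b)" if "U \<in> A" "nice b" for U b
    using l(2)[of "m b - U"] that by (auto simp: C_def l.diff)
  define \<beta> where "\<beta> = l (on_circle (\<lambda>\<zeta>. \<zeta> *\<^sub>C v))"
  have m_eq: "l (m b) = l (on_circle (\<lambda>_. x)) + \<beta> / \<eta>1 + l (on_circle (\<lambda>\<zeta>. \<zeta>\<^sup>2 *\<^sub>C b \<zeta>))" if b: "nice b" for b
  proof -
    have "m b = on_circle (\<lambda>_. x) + (1 / \<eta>1) *\<^sub>R on_circle (\<lambda>\<zeta>. \<zeta> *\<^sub>C v) + on_circle (\<lambda>\<zeta>. \<zeta>\<^sup>2 *\<^sub>C b \<zeta>)"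
      unfolding m_def disc_def scaleC.scaleR_right using nice_cont(2)[OF b]
      by (subst J_add J_scale | intro continuous_intros | simp)+
    then show ?thesis by (simp add: l.add l.scaleR \<beta>_def)
  qed
  \<comment> \<open>On an affine family a functional that is bounded below is constant: for a
    nonzero value the chosen multiple of \<open>b\<close> would push \<open>l (m b)\<close> down to
    the value of \<open>l\<close> at the constant map \<open>x\<close>.\<close>
  have ann: "l (on_circle (\<lambda>\<zeta>. \<zeta>\<^sup>2 *\<^sub>C b \<zeta>)) = 0" if b: "nice b" for b
  proof (rule ccontr)
    assume nz: "l (on_circle (\<lambda>\<zeta>. \<zeta>\<^sup>2 *\<^sub>C b \<zeta>)) \<noteq> 0"
    define \<alpha> where "\<alpha> = l (on_circle (\<lambda>\<zeta>. \<zeta>\<^sup>2 *\<^sub>C b \<zeta>))"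
    define t where "t = - (\<beta> / \<eta>1) / \<alpha>"
    have "on_circle (\<lambda>\<zeta>. \<zeta>\<^sup>2 *\<^sub>C (t *\<^sub>R b \<zeta>)) = t *\<^sub>R on_circle (\<lambda>\<zeta>. \<zeta>\<^sup>2 *\<^sub>C b \<zeta>)"
      unfolding scaleC.scaleR_right using nice_cont(2)[OF b] by (intro J_scale continuous_intros)
    then have "l (m (\<lambda>\<zeta>. t *\<^sub>R b \<zeta>)) = l (on_circle (\<lambda>_. x)) + \<beta> / \<eta>1 + t * \<alpha>"
      using m_eq[OF nice_scale[OF b]] by (simp add: l.scaleR \<alpha>_def)
    moreover have "l (on_circle (\<lambda>_. x)) < l (m (\<lambda>\<zeta>. t *\<^sub>R b \<zeta>))"
      using D(3) by (intro lt in_A nice_scale b) auto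
    ultimately show False using nz by (simp add: t_def \<alpha>_def)
  qed
  have le: "l (on_circle u) < l (on_circle (\<lambda>_. x)) + \<beta> / \<eta>1"
    if "continuous_on ?S u" "\<And>\<zeta>. \<zeta> \<in> ?S \<Longrightarrow> u \<zeta> \<in> D" for u
    using lt[OF in_A[OF that] nice_0] m_eq[OF nice_0] ann[OF nice_0] by simp
  \<comment> \<open>The constant map \<open>x\<close> takes values in \<open>D\<close>, and the
    strict inequality for it makes the normalisation by \<open>\<beta>\<close> possible.\<close>
  have "\<beta> > 0" using le[of "\<lambda>_. x"] D(3) \<eta>1 by (simp add: zero_less_divide_iff)
  define L where "L = (\<lambda>u. Complex (l (on_circle u) / \<beta>) (- l (on_circle (\<lambda>\<zeta>. \<i> *\<^sub>C u \<zeta>)) / \<beta>))"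
  have J_cscale: "l (on_circle (\<lambda>\<zeta>. c *\<^sub>C u \<zeta>)) = Re c * l (on_circle u) + Im c * l (on_circle (\<lambda>\<zeta>. \<i> *\<^sub>C u \<zeta>))"
    if u: "continuous_on ?S u" for c u
  proof -
    have "c *\<^sub>C y = Re c *\<^sub>R y + Im c *\<^sub>R (\<i> *\<^sub>C y)" for y :: 'a
      by (simp add: scaleR_scaleC scaleC_scaleC scaleC_add_left[symmetric] complex_eq[of c, symmetric] mult.commute)
    then have "on_circle (\<lambda>\<zeta>. c *\<^sub>C u \<zeta>) = on_circle (\<lambda>\<zeta>. Re c *\<^sub>R u \<zeta> + Im c *\<^sub>R (\<i> *\<^sub>C u \<zeta>))" by simp
    also have "\<dots> = Re c *\<^sub>R on_circle u + Im c *\<^sub>R on_circle (\<lambda>\<zeta>. \<i> *\<^sub>C u \<zeta>)"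
      using u by (subst J_add J_scale | intro continuous_intros | simp)+
    finally show ?thesis by (simp add: l.add l.scaleR)
  qed
  have "dual_functional D x v \<eta>1 L"
  proof
    fix u w :: "complex \<Rightarrow> 'a"
    assume uw: "continuous_on ?S u" "continuous_on ?S w"
    have "on_circle (\<lambda>\<zeta>. \<i> *\<^sub>C (u \<zeta> + w \<zeta>)) = on_circle (\<lambda>\<zeta>. \<i> *\<^sub>C u \<zeta>) + on_circle (\<lambda>\<zeta>. \<i> *\<^sub>C w \<zeta>)"
      unfolding scaleC.add_right using uw by (intro J_add continuous_intros)
    then show "L (\<lambda>\<zeta>. u \<zeta> + w \<zeta>) = L u + L w"
      using uw by (simp add: L_def J_add l.add complex_eq_iff add_divide_distrib)
  next
    fix u :: "complex \<Rightarrow> 'a" and c assume u: "continuous_on ?S u"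
    show "L (\<lambda>\<zeta>. c *\<^sub>C u \<zeta>) = c * L u"
      using J_cscale[OF u, of c] J_cscale[OF u, of "\<i> * c"]
      by (simp add: L_def complex_eq_iff scaleC_scaleC add_divide_distrib diff_divide_distrib)
  next
    fix u w :: "complex \<Rightarrow> 'a" assume eq: "\<And>\<zeta>. \<zeta> \<in> ?S \<Longrightarrow> u \<zeta> = w \<zeta>"
    have "u (cis \<theta>) = w (cis \<theta>)" for \<theta> using eq[of "cis \<theta>"] by simp
    then show "L u = L w" by (simp add: L_def on_circle_def)
  next
    fix R and b b' :: "complex \<Rightarrow> 'a"
    assume "1 < R" "\<And>z. z \<in> ball 0 R \<Longrightarrow> has_cderiv b (b' z) z"
    then have "nice b" unfolding nice_def by blast
    moreover have "(\<lambda>\<zeta>. \<i> *\<^sub>C \<zeta>\<^sup>2 *\<^sub>C b \<zeta>) = (\<lambda>\<zeta>. \<zeta>\<^sup>2 *\<^sub>C \<i> *\<^sub>C b \<zeta>)"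
      by (simp add: scaleC_scaleC mult.commute)
    ultimately show "L (\<lambda>\<zeta>. \<zeta>\<^sup>2 *\<^sub>C b \<zeta>) = 0"
      using ann[of b] ann[OF nice_scaleC, of b \<i>] by (simp add: L_def complex_eq_iff)
  next
    fix u :: "complex \<Rightarrow> 'a" assume "continuous_on ?S u" "\<And>\<zeta>. \<zeta> \<in> ?S \<Longrightarrow> u \<zeta> \<in> D"
    then have "l (on_circle u) / \<beta> \<le> (l (on_circle (\<lambda>_. x)) + \<beta> / \<eta>1) / \<beta>"
      using \<open>\<beta> > 0\<close> le[of u] by (intro divide_right_mono) auto
    then show "Re (L u) \<le> Re (L (\<lambda>_. x)) + 1 / \<eta>1"
      using \<open>\<beta> > 0\<close> by (simp add: L_def add_divide_distrib)
  next
    show "Re (L (\<lambda>\<zeta>. \<zeta> *\<^sub>C v)) = 1" using \<open>\<beta> > 0\<close> by (simp add: L_def \<beta>_def)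
  qed
  then show ?thesis by (rule that)
qed

lemma field_derivative_quadratic_bound:
  fixes F :: "complex \<Rightarrow> complex"
  assumes e: "e > 0" and le: "\<And>w. w \<in> ball z e \<Longrightarrow> norm (F w - F z - (w - z) * F') \<le> C * (norm (w - z))\<^sup>2"
  shows "(F has_field_derivative F') (at z)"
  unfolding has_field_derivative_iff
proof (rule LIM_zero_cancel)
  show "((\<lambda>w. (F w - F z) / (w - z) - F') \<longlongrightarrow> 0) (at z)"
  proof (rule Lim_null_comparison)
    have "\<forall>\<^sub>F w in at z. w \<in> ball z e \<and> w \<noteq> z"
      using e by (auto simp: eventually_at dist_commute intro!: exI[of _ e])
    then show "\<forall>\<^sub>F w in at z. norm ((F w - F z) / (w - z) - F') \<le> C * norm (w - z)"
    proof eventually_elim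
      case (elim w)
      have "(F w - F z) / (w - z) - F' = (F w - F z - (w - z) * F') / (w - z)"
        using elim by (simp add: field_simps)
      also have "norm \<dots> \<le> C * (norm (w - z))\<^sup>2 / norm (w - z)"
        unfolding norm_divide using le elim by (intro divide_right_mono) auto
      finally show ?case using elim by (simp add: power2_eq_square)
    qed
    have "((\<lambda>w. C * norm (w - z)) \<longlongrightarrow> C * norm (z - z)) (at z)" by (intro tendsto_intros)
    then show "((\<lambda>w. C * norm (w - z)) \<longlongrightarrow> 0) (at z)" by simp
  qed
qed

section \<open>Pairing the dual functional with Cauchy kernels\<close>

locale normed_dual_functional = dual_functional +
  fixes \<epsilon> :: real
  assumes \<epsilon>: "\<epsilon> > 0" "ball x \<epsilon> \<subseteq> D" and \<eta>1: "\<eta>1 > 0"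
begin

abbreviation "S1 \<equiv> sphere (0::complex) 1"

lemma L_zero: "L (\<lambda>_. 0) = 0"
  using L_scale[of "\<lambda>_. 0" 0] by simp

lemma L_diff:
  assumes "continuous_on S1 u" "continuous_on S1 w"
  shows "L (\<lambda>\<zeta>. u \<zeta> - w \<zeta>) = L u - L w"
proof -
  have "L (\<lambda>\<zeta>. u \<zeta> + (-1) *\<^sub>C w \<zeta>) = L u + L (\<lambda>\<zeta>. (-1) *\<^sub>C w \<zeta>)"
    using assms by (intro L_add continuous_intros)
  then show ?thesis using L_scale[OF assms(2), of "-1"] by (simp add: scaleC.minus_left)
qed

lemma L_sum:
  assumes "finite I" "\<And>i. i \<in> I \<Longrightarrow> continuous_on S1 (u i)"
  shows "L (\<lambda>\<zeta>. \<Sum>i\<in>I. u i \<zeta>) = (\<Sum>i\<in>I. L (u i))"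
  using assms
proof (induction I rule: finite_induct)
  case (insert i I)
  then have "L (\<lambda>\<zeta>. u i \<zeta> + (\<Sum>i\<in>I. u i \<zeta>)) = L (u i) + L (\<lambda>\<zeta>. \<Sum>i\<in>I. u i \<zeta>)"
    by (intro L_add continuous_intros) auto
  then show ?case using insert by simp
qed (simp add: L_zero)

definition K where "K = 2 / (\<epsilon> * \<eta>1)"

lemma K_pos: "K > 0" using \<epsilon> \<eta>1 by (simp add: K_def)

text \<open>The one-sided bound \<open>L_le\<close> becomes a bound of the norm: \<open>u\<close> is
  rotated until \<open>L u\<close> is a nonnegative real and scaled to size
  \<open>\<epsilon> / 2\<close>, so that adding it to \<open>x\<close> does not leave
  \<open>D\<close>.\<close>

lemma L_bound:
  assumes u: "continuous_on S1 u" and B: "B \<ge> 0" "\<And>\<zeta>. \<zeta> \<in> S1 \<Longrightarrow> norm (u \<zeta>) \<le> B"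
  shows "norm (L u) \<le> K * B"
proof (cases "B = 0")
  case True
  then have "L u = L (\<lambda>_. 0)" using B(2) by (intro L_cong) simp
  then show ?thesis using True L_zero by simp
next
  case False
  with B(1) have Bpos: "B > 0" by simp
  obtain c where c: "norm c = 1" "c * L u = of_real (norm (L u))"
  proof (cases "L u = 0")
    case True then show ?thesis using that[of 1] by simp
  next
    case False
    have "cnj (L u) * L u = of_real (norm (L u) * norm (L u))"
      using complex_norm_square[of "L u"] by (simp add: power2_eq_square mult.commute)
    then show ?thesis
      using False by (intro that[of "cnj (L u) / of_real (norm (L u))"]) (auto simp: norm_divide)
  qed
  define d where "d = of_real (\<epsilon> / (2 * B)) * c"
  have nd: "norm d = \<epsilon> / (2 * B)" using c(1) Bpos \<epsilon>(1) by (simp add: d_def norm_mult norm_divide)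
  have du: "continuous_on S1 (\<lambda>\<zeta>. d *\<^sub>C u \<zeta>)" using u by (intro continuous_intros)
  have "Re (L (\<lambda>\<zeta>. x + d *\<^sub>C u \<zeta>)) \<le> Re (L (\<lambda>_. x)) + 1 / \<eta>1"
  proof (rule L_le)
    fix \<zeta> assume "\<zeta> \<in> S1"
    then have "norm (d *\<^sub>C u \<zeta>) \<le> \<epsilon> / (2 * B) * B"
      unfolding norm_scaleC nd using B \<epsilon>(1) by (intro mult_left_mono) auto
    then have "norm (d *\<^sub>C u \<zeta>) < \<epsilon>" using Bpos \<epsilon>(1) by simp
    then show "x + d *\<^sub>C u \<zeta> \<in> D" using \<epsilon>(2) by (auto simp: subset_iff dist_norm)
  qed (intro continuous_intros u)
  also have "L (\<lambda>\<zeta>. x + d *\<^sub>C u \<zeta>) = L (\<lambda>_. x) + d * L u"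
    using L_add[OF continuous_on_const du] L_scale[OF u] by simp
  also have "d * L u = of_real (\<epsilon> / (2 * B) * norm (L u))"
    by (simp only: d_def mult.assoc c(2) of_real_mult)
  finally have "\<epsilon> / (2 * B) * norm (L u) \<le> 1 / \<eta>1" by simp
  then show ?thesis using Bpos \<epsilon>(1) \<eta>1 by (simp add: K_def field_simps)
qed

definition pair :: "(complex \<Rightarrow> complex) \<Rightarrow> 'a \<Rightarrow> complex" where
  "pair h \<nu> = L (\<lambda>\<zeta>. h \<zeta> *\<^sub>C \<nu>)"

lemma pair_bound:
  assumes "continuous_on S1 h" "\<And>\<zeta>. \<zeta> \<in> S1 \<Longrightarrow> norm (h \<zeta>) \<le> B" "B \<ge> 0"
  shows "norm (pair h \<nu>) \<le> K * (B * norm \<nu>)"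
  unfolding pair_def using assms
  by (intro L_bound continuous_intros) (auto simp: norm_scaleC intro!: mult_right_mono)

lemma pair_cong: "(\<And>\<zeta>. \<zeta> \<in> S1 \<Longrightarrow> h \<zeta> = h' \<zeta>) \<Longrightarrow> pair h \<nu> = pair h' \<nu>"
  unfolding pair_def by (intro L_cong) simp

lemma pair_add_left:
  "continuous_on S1 h \<Longrightarrow> continuous_on S1 h' \<Longrightarrow> pair (\<lambda>\<zeta>. h \<zeta> + h' \<zeta>) \<nu> = pair h \<nu> + pair h' \<nu>"
  unfolding pair_def scaleC_add_left by (intro L_add continuous_intros)

lemma pair_diff_left:
  "continuous_on S1 h \<Longrightarrow> continuous_on S1 h' \<Longrightarrow> pair (\<lambda>\<zeta>. h \<zeta> - h' \<zeta>) \<nu> = pair h \<nu> - pair h' \<nu>"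
  unfolding pair_def scaleC.diff_left by (intro L_diff continuous_intros)

lemma pair_mult_left: "continuous_on S1 h \<Longrightarrow> pair (\<lambda>\<zeta>. c * h \<zeta>) \<nu> = c * pair h \<nu>"
  unfolding pair_def scaleC_scaleC[symmetric] by (intro L_scale continuous_intros)

lemma pair_scale: "continuous_on S1 h \<Longrightarrow> pair h (c *\<^sub>C \<nu>) = c * pair h \<nu>"
  unfolding pair_def scaleC_left_commute[of _ c] by (intro L_scale continuous_intros)

lemma pair_add: "continuous_on S1 h \<Longrightarrow> pair h (\<nu> + \<mu>) = pair h \<nu> + pair h \<mu>"
  unfolding pair_def scaleC_add_right by (intro L_add continuous_intros)

lemma pair_diff: "continuous_on S1 h \<Longrightarrow> pair h (\<nu> - \<mu>) = pair h \<nu> - pair h \<mu>"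
  unfolding pair_def scaleC.diff_right by (intro L_diff continuous_intros)

lemma pair_sum: "continuous_on S1 h \<Longrightarrow> finite I \<Longrightarrow> pair h (\<Sum>i\<in>I. \<nu> i) = (\<Sum>i\<in>I. pair h (\<nu> i))"
  unfolding pair_def scaleC.sum_right by (intro L_sum continuous_intros)

text \<open>Cauchy kernels with the factor that \<open>L\<close> needs: as \<open>L\<close>
  annihilates the square of the variable times holomorphic maps, only polar parts at
  \<open>a\<close> matter, and \<open>k1 a\<close> and \<open>k2 a\<close> span these up to order
  two.\<close>

definition k1 :: "complex \<Rightarrow> complex \<Rightarrow> complex" where "k1 a \<zeta> = \<zeta>\<^sup>2 / (\<zeta> - a)"
definition k2 :: "complex \<Rightarrow> complex \<Rightarrow> complex" where "k2 a \<zeta> = \<zeta>\<^sup>2 / (\<zeta> - a)\<^sup>2"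

lemma S1_diff: "norm a < 1 \<Longrightarrow> \<zeta> \<in> S1 \<Longrightarrow> \<zeta> - a \<noteq> 0"
  by auto

lemma S1_diff_ge: "norm a \<le> 1 / 2 \<Longrightarrow> \<zeta> \<in> S1 \<Longrightarrow> norm (\<zeta> - a) \<ge> 1 / 2"
  using norm_triangle_ineq2[of \<zeta> a] by simp

lemma cont_k1: "norm a < 1 \<Longrightarrow> continuous_on S1 (k1 a)"
  and cont_k2: "norm a < 1 \<Longrightarrow> continuous_on S1 (k2 a)"
  unfolding k1_def k2_def by (intro continuous_intros; use S1_diff in auto)+

lemma k1_bound: "norm a \<le> 1 / 2 \<Longrightarrow> \<zeta> \<in> S1 \<Longrightarrow> norm (k1 a \<zeta>) \<le> 2"
  using S1_diff_ge[of a \<zeta>] by (simp add: k1_def norm_divide norm_power divide_le_eq)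

lemma k2_bound: "norm a \<le> 1 / 2 \<Longrightarrow> \<zeta> \<in> S1 \<Longrightarrow> norm (k2 a \<zeta>) \<le> 4"
  using S1_diff_ge[of a \<zeta>] power_mono[of "1 / 2" "norm (\<zeta> - a)" 2]
  by (simp add: k2_def norm_divide norm_power divide_le_eq power_divide)

lemma pair_k1_bound: "norm a \<le> 1 / 2 \<Longrightarrow> norm (pair (k1 a) \<nu>) \<le> 2 * K * norm \<nu>"
  using pair_bound[OF cont_k1 k1_bound, of a \<nu>] by (simp add: mult_ac)

lemma pair_k2_bound: "norm a \<le> 1 / 2 \<Longrightarrow> norm (pair (k2 a) \<nu>) \<le> 4 * K * norm \<nu>"
  using pair_bound[OF cont_k2 k2_bound, of a \<nu>] by (simp add: mult_ac)

lemma pair_k1_deriv: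
  assumes a: "norm a < 1 / 2"
  shows "((\<lambda>a. pair (k1 a) \<nu>) has_field_derivative pair (k2 a) \<nu>) (at a)"
proof (rule field_derivative_quadratic_bound)
  show "1 / 2 - norm a > 0" using a by simp
  fix b assume b: "b \<in> ball a (1 / 2 - norm a)"
  then have nb: "norm b < 1 / 2" using norm_triangle_ineq2[of b a] by (simp add: dist_norm norm_minus_commute)
  let ?h = "\<lambda>\<zeta>. k1 b \<zeta> - k1 a \<zeta> - (b - a) * k2 a \<zeta>"
  have ca: "continuous_on S1 (k1 a)" "continuous_on S1 (k1 b)" "continuous_on S1 (k2 a)"
    using a nb by (auto intro!: cont_k1 cont_k2)
  have "pair (k1 b) \<nu> - pair (k1 a) \<nu> - (b - a) * pair (k2 a) \<nu> = pair ?h \<nu>"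
    using ca by (simp add: pair_diff_left pair_mult_left continuous_on_diff continuous_on_mult)
  also have "norm \<dots> \<le> K * (8 * (norm (b - a))\<^sup>2 * norm \<nu>)"
  proof (rule pair_bound)
    show "continuous_on S1 ?h" using ca by (intro continuous_intros)
    fix \<zeta> assume \<zeta>: "\<zeta> \<in> S1"
    have nz: "\<zeta> - a \<noteq> 0" "\<zeta> - b \<noteq> 0" using a nb \<zeta> by auto
    define p where "p = \<zeta> - a"
    define r where "r = \<zeta> - b"
    have ba: "b - a = p - r" by (simp add: p_def r_def)
    have nz': "p \<noteq> 0" "r \<noteq> 0" using nz by (auto simp: p_def r_def)
    have "?h \<zeta> = \<zeta>\<^sup>2 / r - \<zeta>\<^sup>2 / p - (p - r) * (\<zeta>\<^sup>2 / p\<^sup>2)"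
      unfolding k1_def k2_def ba p_def[symmetric] r_def[symmetric] ..
    also have "\<dots> = \<zeta>\<^sup>2 * (p - r)\<^sup>2 / (p\<^sup>2 * r)"
      using nz' by (simp add: field_simps power2_eq_square)
    finally have "norm (?h \<zeta>) = (norm (b - a))\<^sup>2 / ((norm p)\<^sup>2 * norm r)"
      using \<zeta> by (simp add: norm_divide norm_mult norm_power ba)
    \<comment> \<open>Each of the three factors of the denominator is at least 1/2 on the
      circle.\<close>
    also have "\<dots> \<le> (norm (b - a))\<^sup>2 / (1 / 8)"
    proof (rule divide_left_mono)
      have "(1 / 2)\<^sup>2 * (1 / 2) \<le> (norm p)\<^sup>2 * norm r"
        using S1_diff_ge[of a \<zeta>] S1_diff_ge[of b \<zeta>] a nb \<zeta> unfolding p_def r_def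
        by (intro mult_mono power_mono) auto
      then show "1 / 8 \<le> (norm p)\<^sup>2 * norm r" by (simp add: power2_eq_square)
    qed (use nz' in auto)
    finally show "norm (?h \<zeta>) \<le> 8 * (norm (b - a))\<^sup>2" by simp
  qed simp
  finally show "norm (pair (k1 b) \<nu> - pair (k1 a) \<nu> - (b - a) * pair (k2 a) \<nu>)
      \<le> (8 * K * norm \<nu>) * (norm (b - a))\<^sup>2" by (simp add: mult_ac)
qed

text \<open>Two divisions by \<open>\<zeta> - a\<close> expand \<open>s\<close> at \<open>a\<close>
  to first order with a holomorphic remainder \<open>s2\<close>; the remainder contributes the
  square of the variable times a holomorphic map, which \<open>L\<close> kills.\<close>

lemma pair_residue:
  assumes s: "s holomorphic_on ball 0 R" and R: "R > 1" and a: "norm a < 1"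
  shows "pair (\<lambda>\<zeta>. \<zeta>\<^sup>2 * s \<zeta> / (\<zeta> - a)\<^sup>2) \<nu> = s a * pair (k2 a) \<nu> + deriv s a * pair (k1 a) \<nu>"
proof -
  define s1 where "s1 = (\<lambda>z. if z = a then deriv s a else (s z - s a) / (z - a))"
  define s2 where "s2 = (\<lambda>z. if z = a then deriv s1 a else (s1 z - s1 a) / (z - a))"
  have hol1: "s1 holomorphic_on ball 0 R" unfolding s1_def by (rule pole_lemma_open[OF s]) simp
  have hol2: "s2 holomorphic_on ball 0 R" unfolding s2_def by (rule pole_lemma_open[OF hol1]) simp
  have sub: "S1 \<subseteq> ball 0 R" using R by auto
  have c2: "continuous_on S1 s2"
    using holomorphic_on_imp_continuous_on[OF hol2] sub by (rule continuous_on_subset)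
  have "pair (\<lambda>\<zeta>. \<zeta>\<^sup>2 * s \<zeta> / (\<zeta> - a)\<^sup>2) \<nu>
      = pair (\<lambda>\<zeta>. (s a * k2 a \<zeta> + deriv s a * k1 a \<zeta>) + \<zeta>\<^sup>2 * s2 \<zeta>) \<nu>"
  proof (rule pair_cong)
    fix \<zeta> assume "\<zeta> \<in> S1"
    then have nz: "\<zeta> \<noteq> a" using a by auto
    define p where "p = \<zeta> - a"
    have p: "p \<noteq> 0" using nz by (simp add: p_def)
    have "s2 \<zeta> = ((s \<zeta> - s a) / p - deriv s a) / p" using nz by (simp add: s1_def s2_def p_def)
    then have "s \<zeta> = s a + deriv s a * p + s2 \<zeta> * p\<^sup>2"
      using p by (simp add: field_simps power2_eq_square)
    then show "\<zeta>\<^sup>2 * s \<zeta> / (\<zeta> - a)\<^sup>2 = (s a * k2 a \<zeta> + deriv s a * k1 a \<zeta>) + \<zeta>\<^sup>2 * s2 \<zeta>"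
      using p unfolding k1_def k2_def p_def[symmetric] by (simp add: field_simps power2_eq_square)
  qed
  also have "\<dots> = s a * pair (k2 a) \<nu> + deriv s a * pair (k1 a) \<nu> + pair (\<lambda>\<zeta>. \<zeta>\<^sup>2 * s2 \<zeta>) \<nu>"
    using cont_k1[OF a] cont_k2[OF a] c2
    by (subst pair_add_left pair_mult_left | intro continuous_intros | simp)+
  also have "pair (\<lambda>\<zeta>. \<zeta>\<^sup>2 * s2 \<zeta>) \<nu> = L (\<lambda>\<zeta>. \<zeta>\<^sup>2 *\<^sub>C (s2 \<zeta> *\<^sub>C \<nu>))"
    unfolding pair_def scaleC_scaleC ..
  also have "\<dots> = 0"
    by (rule L_hol[OF R, where b' = "\<lambda>z. deriv s2 z *\<^sub>C \<nu>"])
       (auto intro!: has_cderiv_scaleC_const holomorphic_derivI[OF hol2])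
  finally show ?thesis by simp
qed

lemma L_residue_sum:
  assumes I: "finite I" and s: "\<And>i. i \<in> I \<Longrightarrow> s i holomorphic_on ball 0 R" and R: "R > 1" and a: "norm a < 1"
  shows "L (\<lambda>\<zeta>. \<Sum>i\<in>I. (\<zeta>\<^sup>2 * s i \<zeta> / (\<zeta> - a)\<^sup>2) *\<^sub>C \<nu> i)
    = pair (k2 a) (\<Sum>i\<in>I. s i a *\<^sub>C \<nu> i) + pair (k1 a) (\<Sum>i\<in>I. deriv (s i) a *\<^sub>C \<nu> i)"
proof -
  have sub: "S1 \<subseteq> ball 0 R" using R by auto
  have cs: "continuous_on S1 (s i)" if "i \<in> I" for i
    using holomorphic_on_imp_continuous_on[OF s[OF that]] sub by (rule continuous_on_subset)
  have "L (\<lambda>\<zeta>. \<Sum>i\<in>I. (\<zeta>\<^sup>2 * s i \<zeta> / (\<zeta> - a)\<^sup>2) *\<^sub>C \<nu> i)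
      = (\<Sum>i\<in>I. L (\<lambda>\<zeta>. (\<zeta>\<^sup>2 * s i \<zeta> / (\<zeta> - a)\<^sup>2) *\<^sub>C \<nu> i))"
    using I a by (intro L_sum continuous_intros cs) auto
  also have "\<dots> = (\<Sum>i\<in>I. s i a * pair (k2 a) (\<nu> i) + deriv (s i) a * pair (k1 a) (\<nu> i))"
    using pair_residue[OF s R a] by (intro sum.cong) (auto simp: pair_def)
  also have "\<dots> = pair (k2 a) (\<Sum>i\<in>I. s i a *\<^sub>C \<nu> i) + pair (k1 a) (\<Sum>i\<in>I. deriv (s i) a *\<^sub>C \<nu> i)"
    using I cont_k1[OF a] cont_k2[OF a] by (simp add: pair_sum pair_scale sum.distrib)
  finally show ?thesis .
qed

text \<open>A pointwise convex combination of \<open>u\<close> and \<open>\<phi>\<close> stays in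
  \<open>D\<close> for any real weight, holomorphic or not, and \<open>L_le\<close> holds for all
  continuous maps of the circle.\<close>

lemma L_weighted:
  assumes D: "convex D" and u: "continuous_on S1 u" "\<And>\<zeta>. \<zeta> \<in> S1 \<Longrightarrow> u \<zeta> \<in> D"
    and \<phi>: "continuous_on S1 \<phi>" "\<And>\<zeta>. \<zeta> \<in> S1 \<Longrightarrow> \<phi> \<zeta> \<in> D"
    and W: "continuous_on S1 W" "\<And>\<zeta>. \<zeta> \<in> S1 \<Longrightarrow> 0 \<le> W \<zeta>" "\<And>\<zeta>. \<zeta> \<in> S1 \<Longrightarrow> W \<zeta> \<le> 1"
  shows "Re (L (\<lambda>\<zeta>. of_real (W \<zeta>) *\<^sub>C (u \<zeta> - \<phi> \<zeta>))) \<le> Re (L (\<lambda>_. x)) + 1 / \<eta>1 - Re (L \<phi>)"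
proof -
  have c: "continuous_on S1 (\<lambda>\<zeta>. of_real (W \<zeta>) *\<^sub>C (u \<zeta> - \<phi> \<zeta>))"
    by (intro continuous_intros u \<phi> W)
  have "Re (L (\<lambda>\<zeta>. \<phi> \<zeta> + of_real (W \<zeta>) *\<^sub>C (u \<zeta> - \<phi> \<zeta>))) \<le> Re (L (\<lambda>_. x)) + 1 / \<eta>1"
  proof (rule L_le)
    fix \<zeta> assume \<zeta>: "\<zeta> \<in> S1"
    have "W \<zeta> *\<^sub>R u \<zeta> + (1 - W \<zeta>) *\<^sub>R \<phi> \<zeta> \<in> D"
      using W(2,3)[OF \<zeta>] by (intro convexD[OF D] u(2) \<phi>(2) \<zeta>) auto
    then show "\<phi> \<zeta> + of_real (W \<zeta>) *\<^sub>C (u \<zeta> - \<phi> \<zeta>) \<in> D"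
      by (simp add: scaleC_of_real algebra_simps)
  qed (intro continuous_intros c \<phi>)
  then show ?thesis using L_add[OF \<phi>(1) c] by simp
qed

text \<open>Everything from degree two on is annihilated, so \<open>L\<close> sees only
  \<open>x\<close> and the derivative \<open>v / \<eta>2\<close>.\<close>

lemma L_disc:
  assumes "a 0 = x" "\<eta>2 *\<^sub>R a 1 = v" "\<eta>2 > 0" "n \<ge> 2"
  shows "Re (L (\<lambda>\<zeta>. \<Sum>i<n. \<zeta> ^ i *\<^sub>C a i)) = Re (L (\<lambda>_. x)) + 1 / \<eta>2"
proof -
  obtain m where n: "n = Suc (Suc m)" using assms(4) by (metis add_2_eq_Suc le_Suc_ex)
  have a1: "a 1 = of_real (1 / \<eta>2) *\<^sub>C v" using assms(2,3) unfolding scaleC_of_real by auto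
  define b where "b = (\<lambda>\<zeta>::complex. \<Sum>i<m. \<zeta> ^ i *\<^sub>C a (Suc (Suc i)))"
  have db: "has_cderiv b (\<Sum>i<m. (of_nat i * z ^ (i - 1)) *\<^sub>C a (Suc (Suc i))) z" for z
    unfolding b_def by (intro has_cderiv_sum has_cderiv_scaleC_const) (auto intro!: derivative_eq_intros)
  have cb: "continuous_on S1 b" using db by (rule continuous_on_has_cderiv)
  have "L (\<lambda>\<zeta>. \<Sum>i<n. \<zeta> ^ i *\<^sub>C a i)
      = L (\<lambda>\<zeta>. (x + of_real (1 / \<eta>2) *\<^sub>C (\<zeta> *\<^sub>C v)) + \<zeta>\<^sup>2 *\<^sub>C b \<zeta>)"
    unfolding n b_def sum.lessThan_Suc_shift
    using a1 assms(1)
    by (intro arg_cong[where f = L] ext)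
       (simp add: scaleC.sum_right scaleC_scaleC power2_eq_square mult_ac add_ac)
  also have "\<dots> = L (\<lambda>_. x) + of_real (1 / \<eta>2) * L (\<lambda>\<zeta>. \<zeta> *\<^sub>C v) + L (\<lambda>\<zeta>. \<zeta>\<^sup>2 *\<^sub>C b \<zeta>)"
    using cb by (subst L_add L_scale | intro continuous_intros | simp)+
  also have "L (\<lambda>\<zeta>. \<zeta>\<^sup>2 *\<^sub>C b \<zeta>) = 0" by (rule L_hol[OF _ db, of 2]) simp
  finally show ?thesis using L_v assms(3) by simp
qed

end

context normed_dual_functional
begin

text \<open>The weight \<open>\<kappa> / \<bar>\<zeta> - a\<bar>\<^sup>4\<close> equals \<open>\<kappa> \<zeta>\<^sup>2 / ((\<zeta> - a)\<^sup>2 (1 - cnj a \<zeta>)\<^sup>2)\<close> on the circle, so that \<open>L\<close> of the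
  weighted difference only depends on the values and first derivatives at \<open>a\<close>.\<close>

lemma disc_inequality:
  assumes D: "convex D"
    and \<phi>: "\<alpha> 0 = x" "\<eta>2 *\<^sub>R \<alpha> 1 = v" "\<eta>1 \<le> \<eta>2" "n \<ge> 2"
      "\<And>z. z \<in> cball 0 1 \<Longrightarrow> (\<Sum>i<n. z ^ i *\<^sub>C \<alpha> i) \<in> D"
    and \<psi>: "m \<ge> 2" "\<And>z. z \<in> cball 0 1 \<Longrightarrow> (\<Sum>i<m. z ^ i *\<^sub>C \<beta> i) \<in> D"
    and a: "norm a < 1 / 2"
  defines "p \<equiv> (\<Sum>i<n. a ^ i *\<^sub>C \<alpha> i)"
    and "p' \<equiv> (\<Sum>i<n. (of_nat i * a ^ (i - 1)) *\<^sub>C \<alpha> i)"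
    and "q \<equiv> 1 - (norm a)\<^sup>2"
  shows "norm (pair (k1 a) (\<beta> 1)) / q \<le> norm (pair (k1 a) p' - pair (k2 a) (\<beta> 0 - p))
    + 2 * norm a / q * norm (pair (k1 a) (\<beta> 0 - p)) + 16 * (1 / \<eta>1 - 1 / \<eta>2)"
proof -
  define \<delta> where "\<delta> = 1 / \<eta>1 - 1 / \<eta>2"
  have \<eta>2: "\<eta>2 > 0" using \<phi>(3) \<eta>1 by simp
  have \<delta>: "\<delta> \<ge> 0" using \<phi>(3) \<eta>1 by (simp add: \<delta>_def frac_le)
  have "(norm a)\<^sup>2 < (1 / 2)\<^sup>2" using a by (intro power_strict_mono) auto
  then have q: "0 < q" "q \<le> 1" by (auto simp: q_def power_divide)
  \<comment> \<open>A rotation of the second disc makes its contribution real and nonnegative, so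
    that a bound for a real part controls its modulus.\<close>
  obtain t where t: "norm t = 1" "t * pair (k1 a) (\<beta> 1) = of_real (norm (pair (k1 a) (\<beta> 1)))"
  proof (cases "pair (k1 a) (\<beta> 1) = 0")
    case True then show ?thesis using that[of 1] by simp
  next
    case False
    let ?P = "pair (k1 a) (\<beta> 1)"
    have "cnj ?P * ?P = of_real (norm ?P * norm ?P)"
      using complex_norm_square[of ?P] by (simp add: power2_eq_square mult.commute)
    then show ?thesis
      using False by (intro that[of "cnj ?P / of_real (norm ?P)"]) (auto simp: norm_divide)
  qed
  \<comment> \<open>The largest factor that keeps the weight below 1 on the circle. Its lower bound
    1/16 is the origin of the 16 in the conclusion.\<close>
  define \<kappa> where "\<kappa> = (1 - norm a) ^ 4"
  have "(1 / 2) ^ 4 \<le> \<kappa>" unfolding \<kappa>_def using a by (intro power_mono) auto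
  then have \<kappa>: "1 / 16 \<le> \<kappa>" by (simp add: power_divide)
  \<comment> \<open>A Blaschke factor vanishing at \<open>a\<close>: composed with it, the second
    disc has value \<open>\<beta> 0\<close> at \<open>a\<close> and derivative \<open>t / q\<close>
    times \<open>\<beta> 1\<close>, and its values on the circle stay in \<open>D\<close>. The
    factor \<open>E\<close> is the weight stripped of its double pole.\<close>
  define B where "B = (\<lambda>\<zeta>. t * (\<zeta> - a) / (1 - cnj a * \<zeta>))"
  define E where "E = (\<lambda>\<zeta>. of_real \<kappa> / (1 - cnj a * \<zeta>)\<^sup>2)"
  have nz: "1 - cnj a * \<zeta> \<noteq> 0" if "\<zeta> \<in> ball 0 2" for \<zeta>
  proof
    assume "1 - cnj a * \<zeta> = 0"
    then have "norm (cnj a * \<zeta>) = 1" by (simp add: right_minus_eq)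
    moreover have "norm (cnj a * \<zeta>) \<le> (1 / 2) * norm \<zeta>"
      unfolding norm_mult using a by (intro mult_right_mono) auto
    ultimately show False using that by simp
  qed
  have hB: "B holomorphic_on ball 0 2" and hE: "E holomorphic_on ball 0 2"
    unfolding B_def E_def using nz by (auto intro!: holomorphic_intros)
  have sub: "S1 \<subseteq> ball 0 2" by auto
  have cB: "continuous_on S1 B" and cE: "continuous_on S1 E"
    using hB hE sub holomorphic_on_imp_continuous_on continuous_on_subset by blast+
  have circ: "1 - cnj a * \<zeta> = \<zeta> * cnj (\<zeta> - a)" if "\<zeta> \<in> S1" for \<zeta>
  proof -
    have "\<zeta> * cnj \<zeta> = 1" using that by (simp flip: complex_norm_square)
    then show ?thesis by (simp add: algebra_simps)
  qed
  define W where "W = (\<lambda>\<zeta>. \<kappa> / norm (\<zeta> - a) ^ 4)"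
  have W_eq: "of_real (W \<zeta>) = \<zeta>\<^sup>2 * E \<zeta> / (\<zeta> - a)\<^sup>2" if \<zeta>: "\<zeta> \<in> S1" for \<zeta>
  proof -
    define b where "b = \<zeta> - a"
    define c where "c = cnj b"
    have z: "\<zeta> \<noteq> 0" "b \<noteq> 0" "c \<noteq> 0" using \<zeta> a by (auto simp: b_def c_def)
    have "(b * c)\<^sup>2 = (of_real ((norm b)\<^sup>2))\<^sup>2" unfolding c_def by (simp only: complex_norm_square)
    also have "\<dots> = of_real (norm b ^ 4)" by (simp flip: power_mult)
    finally have "of_real (norm b ^ 4) = (b * c)\<^sup>2" ..
    then show ?thesis
      unfolding W_def E_def circ[OF \<zeta>] b_def[symmetric] c_def[symmetric] using z
      by (simp add: power_mult_distrib)
  qed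
  have normB: "norm (B \<zeta>) = 1" if \<zeta>: "\<zeta> \<in> S1" for \<zeta>
    using \<zeta> a t(1) unfolding B_def circ[OF \<zeta>] by (auto simp: norm_divide norm_mult simp del: complex_cnj_diff)
  define u where "u = (\<lambda>\<zeta>. \<Sum>i<m. B \<zeta> ^ i *\<^sub>C \<beta> i)"
  define \<phi>' where "\<phi>' = (\<lambda>\<zeta>. \<Sum>i<n. \<zeta> ^ i *\<^sub>C \<alpha> i)"
  have cu: "continuous_on S1 u" "continuous_on S1 \<phi>'"
    unfolding u_def \<phi>'_def by (intro continuous_intros cB)+
  have "Re (L (\<lambda>\<zeta>. of_real (W \<zeta>) *\<^sub>C (u \<zeta> - \<phi>' \<zeta>))) \<le> Re (L (\<lambda>_. x)) + 1 / \<eta>1 - Re (L \<phi>')"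
  proof (rule L_weighted[OF D cu(1) _ cu(2)])
    show "u \<zeta> \<in> D" if "\<zeta> \<in> S1" for \<zeta> unfolding u_def using normB[OF that] by (intro \<psi>) simp
    show "\<phi>' \<zeta> \<in> D" if "\<zeta> \<in> S1" for \<zeta> unfolding \<phi>'_def using that by (intro \<phi>) auto
    show "continuous_on S1 W" unfolding W_def using a by (intro continuous_intros) auto
    show "0 \<le> W \<zeta>" for \<zeta> unfolding W_def using \<kappa> by simp
    show "W \<zeta> \<le> 1" if "\<zeta> \<in> S1" for \<zeta>
    proof -
      have "1 - norm a \<le> norm (\<zeta> - a)" using norm_triangle_ineq2[of \<zeta> a] that by simp
      then have "\<kappa> \<le> norm (\<zeta> - a) ^ 4" unfolding \<kappa>_def using a by (intro power_mono) auto
      then show ?thesis unfolding W_def using a by (simp add: divide_le_eq_1)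
    qed
  qed
  also have "\<dots> = \<delta>" unfolding \<phi>'_def using L_disc[OF \<phi>(1,2) \<eta>2 \<phi>(4)] by (simp add: \<delta>_def)
  finally have Re_le: "Re (L (\<lambda>\<zeta>. of_real (W \<zeta>) *\<^sub>C (u \<zeta> - \<phi>' \<zeta>))) \<le> \<delta>" .
  define sB where "sB = (\<lambda>i \<zeta>. B \<zeta> ^ i * E \<zeta>)"
  define s\<phi> where "s\<phi> = (\<lambda>(i::nat) \<zeta>. \<zeta> ^ i * E \<zeta>)"
  have hs: "sB i holomorphic_on ball 0 2" "s\<phi> i holomorphic_on ball 0 2" for i
    unfolding sB_def s\<phi>_def by (intro holomorphic_intros hB hE)+
  have cs: "continuous_on S1 (sB i)" "continuous_on S1 (s\<phi> i)" for i
    unfolding sB_def s\<phi>_def by (intro continuous_intros cB cE)+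
  have "L (\<lambda>\<zeta>. of_real (W \<zeta>) *\<^sub>C (u \<zeta> - \<phi>' \<zeta>))
     = L (\<lambda>\<zeta>. (\<Sum>i<m. (\<zeta>\<^sup>2 * sB i \<zeta> / (\<zeta> - a)\<^sup>2) *\<^sub>C \<beta> i) - (\<Sum>i<n. (\<zeta>\<^sup>2 * s\<phi> i \<zeta> / (\<zeta> - a)\<^sup>2) *\<^sub>C \<alpha> i))"
    by (rule L_cong, subst W_eq, assumption)
       (simp add: u_def \<phi>'_def sB_def s\<phi>_def scaleC.diff_right scaleC.sum_right scaleC_scaleC mult_ac)
  also have "\<dots> = L (\<lambda>\<zeta>. \<Sum>i<m. (\<zeta>\<^sup>2 * sB i \<zeta> / (\<zeta> - a)\<^sup>2) *\<^sub>C \<beta> i)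
      - L (\<lambda>\<zeta>. \<Sum>i<n. (\<zeta>\<^sup>2 * s\<phi> i \<zeta> / (\<zeta> - a)\<^sup>2) *\<^sub>C \<alpha> i)"
    using a by (intro L_diff continuous_intros cs) auto
  also have "\<dots> = (pair (k2 a) (\<Sum>i<m. sB i a *\<^sub>C \<beta> i) + pair (k1 a) (\<Sum>i<m. deriv (sB i) a *\<^sub>C \<beta> i))
      - (pair (k2 a) (\<Sum>i<n. s\<phi> i a *\<^sub>C \<alpha> i) + pair (k1 a) (\<Sum>i<n. deriv (s\<phi> i) a *\<^sub>C \<alpha> i))"
    using a by (simp add: L_residue_sum[OF _ hs(1)] L_residue_sum[OF _ hs(2)])
  finally have L_eq: "L (\<lambda>\<zeta>. of_real (W \<zeta>) *\<^sub>C (u \<zeta> - \<phi>' \<zeta>)) =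
      (pair (k2 a) (\<Sum>i<m. sB i a *\<^sub>C \<beta> i) + pair (k1 a) (\<Sum>i<m. deriv (sB i) a *\<^sub>C \<beta> i))
      - (pair (k2 a) (\<Sum>i<n. s\<phi> i a *\<^sub>C \<alpha> i) + pair (k1 a) (\<Sum>i<n. deriv (s\<phi> i) a *\<^sub>C \<alpha> i))" .
  define Q where "Q = complex_of_real q"
  have Q: "Q \<noteq> 0" using q by (simp add: Q_def)
  have Qa: "1 - cnj a * a = Q"
    by (simp add: Q_def q_def complex_norm_square mult.commute del: of_real_power)
  have dB: "(B has_field_derivative t / Q) (at a)"
    unfolding B_def using Q Qa
    by (auto intro!: derivative_eq_intros simp: power2_eq_square mult_ac)
  have dE: "(E has_field_derivative of_real \<kappa> * (2 * cnj a) / Q ^ 3) (at a)"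
  proof -
    have "((\<lambda>w. of_real \<kappa> / w\<^sup>2) has_field_derivative - 2 * of_real \<kappa> / Q ^ 3) (at (1 - cnj a * a))"
      unfolding Qa using Q
      by (auto intro!: derivative_eq_intros simp: divide_simps power2_eq_square power3_eq_cube)
    moreover have "((\<lambda>\<zeta>. 1 - cnj a * \<zeta>) has_field_derivative - cnj a) (at a)"
      by (auto intro!: derivative_eq_intros)
    ultimately have "((\<lambda>\<zeta>. of_real \<kappa> / (1 - cnj a * \<zeta>)\<^sup>2) has_field_derivative
        - 2 * of_real \<kappa> / Q ^ 3 * - cnj a) (at a)" by (rule DERIV_chain2)
    then show ?thesis by (simp add: E_def mult_ac)
  qed
  have Ba: "B a = 0" and Ea: "E a = of_real \<kappa> / Q\<^sup>2" using Qa by (auto simp: B_def E_def)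
  \<comment> \<open>\<open>T\<close> is the value and \<open>A\<close> the logarithmic derivative of
    \<open>E\<close> at \<open>a\<close>.\<close>
  define T where "T = of_real \<kappa> / Q\<^sup>2"
  define A where "A = 2 * cnj a / Q"
  have dE': "(E has_field_derivative T * A) (at a)"
    using dE Q by (simp add: T_def A_def power2_eq_square power3_eq_cube mult_ac)
  have dsB: "deriv (sB i) a = of_nat i * 0 ^ (i - 1) * (t / Q) * T + 0 ^ i * (T * A)" for i
    unfolding sB_def
    by (rule DERIV_imp_deriv) (use dB dE' Ba Ea in \<open>auto intro!: derivative_eq_intros simp: T_def mult_ac\<close>)
  have ds\<phi>: "deriv (s\<phi> i) a = of_nat i * a ^ (i - 1) * T + a ^ i * (T * A)" for i
    unfolding s\<phi>_def
    by (rule DERIV_imp_deriv) (use dE' Ea in \<open>auto intro!: derivative_eq_intros simp: T_def mult_ac\<close>)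
  obtain m' where m': "m = Suc (Suc m')" using \<psi>(1) by (metis add_2_eq_Suc le_Suc_ex)
  have 1: "(\<Sum>i<m. sB i a *\<^sub>C \<beta> i) = T *\<^sub>C \<beta> 0"
    unfolding m' sum.lessThan_Suc_shift by (simp add: sB_def Ba Ea T_def)
  have 2: "(\<Sum>i<m. deriv (sB i) a *\<^sub>C \<beta> i) = (T * A) *\<^sub>C \<beta> 0 + (T * (t / Q)) *\<^sub>C \<beta> 1"
    unfolding m' sum.lessThan_Suc_shift by (simp add: dsB mult_ac)
  have 3: "(\<Sum>i<n. s\<phi> i a *\<^sub>C \<alpha> i) = T *\<^sub>C p"
    unfolding p_def scaleC.sum_right scaleC_scaleC s\<phi>_def Ea T_def by (simp add: mult_ac)
  have 4: "(\<Sum>i<n. deriv (s\<phi> i) a *\<^sub>C \<alpha> i) = T *\<^sub>C p' + (T * A) *\<^sub>C p"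
    unfolding p_def p'_def scaleC.sum_right scaleC_scaleC sum.distrib[symmetric] ds\<phi> scaleC_add_left
    by (simp add: mult_ac)
  have a1: "norm a < 1" using a by simp
  note kk = cont_k1[OF a1] cont_k2[OF a1]
  define X where "X = pair (k1 a) p' - pair (k2 a) (\<beta> 0 - p)"
  define Y where "Y = pair (k1 a) (\<beta> 0 - p)"
  \<comment> \<open>The term \<open>A * Y\<close> is the price for the weight not being holomorphic
    in \<open>a\<close>; it is small once \<open>\<beta> 0\<close> is close to
    \<open>p\<close>.\<close>
  have "L (\<lambda>\<zeta>. of_real (W \<zeta>) *\<^sub>C (u \<zeta> - \<phi>' \<zeta>)) = T * (t * pair (k1 a) (\<beta> 1) / Q + A * Y - X)"
    unfolding L_eq 1 2 3 4 X_def Y_def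
    by (simp add: pair_add pair_diff pair_scale kk) (simp add: algebra_simps)
  also have "\<dots> = of_real (\<kappa> / q\<^sup>2) * (of_real (norm (pair (k1 a) (\<beta> 1)) / q) + A * Y - X)"
    unfolding t(2) by (simp add: T_def Q_def)
  finally have "\<kappa> / q\<^sup>2 * (norm (pair (k1 a) (\<beta> 1)) / q + Re (A * Y) - Re X) \<le> \<delta>"
    using Re_le by simp
  moreover have "\<kappa> / q\<^sup>2 > 0" using \<kappa> q by simp
  ultimately have "norm (pair (k1 a) (\<beta> 1)) / q + Re (A * Y) - Re X \<le> \<delta> / (\<kappa> / q\<^sup>2)"
    by (simp only: pos_le_divide_eq mult.commute)
  also have "\<dots> \<le> \<delta> / (1 / 16)"
  proof (rule divide_left_mono)
    have "\<kappa> / 1 \<le> \<kappa> / q\<^sup>2" using \<kappa> q power_le_one[of q 2] by (intro divide_left_mono) auto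
    then show "1 / 16 \<le> \<kappa> / q\<^sup>2" using \<kappa> by linarith
  qed (use \<delta> \<kappa> q in auto)
  finally have "norm (pair (k1 a) (\<beta> 1)) / q \<le> Re X - Re (A * Y) + 16 * \<delta>" by simp
  moreover have "Re X \<le> norm X" by (rule complex_Re_le_cmod)
  moreover have "- Re (A * Y) \<le> norm A * norm Y"
    using abs_Re_le_cmod[of "A * Y"] by (simp add: norm_mult)
  moreover have "norm A = 2 * norm a / q" using q by (simp add: A_def Q_def norm_divide norm_mult)
  ultimately have "norm (pair (k1 a) (\<beta> 1)) / q \<le> norm X + 2 * norm a / q * norm Y + 16 * \<delta>" by simp
  then show ?thesis by (simp add: X_def Y_def \<delta>_def)
qed

lemma holomorphic_pair_k1: "(\<lambda>a. pair (k1 a) \<nu>) holomorphic_on ball 0 (1 / 2)"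
  unfolding holomorphic_on_open[OF open_ball]
proof
  fix a :: complex assume "a \<in> ball 0 (1 / 2)"
  then have "norm a < 1 / 2" by simp
  then show "\<exists>f'. ((\<lambda>a. pair (k1 a) \<nu>) has_field_derivative f') (at a)"
    using pair_k1_deriv by blast
qed

lemma holomorphic_pair_k2: "(\<lambda>a. pair (k2 a) \<nu>) holomorphic_on ball 0 (1 / 2)"
proof -
  have "deriv (\<lambda>a. pair (k1 a) \<nu>) holomorphic_on ball 0 (1 / 2)"
    by (intro holomorphic_deriv holomorphic_pair_k1) simp
  moreover have "deriv (\<lambda>a. pair (k1 a) \<nu>) a = pair (k2 a) \<nu>" if "a \<in> ball 0 (1 / 2)" for a
    using that by (intro DERIV_imp_deriv pair_k1_deriv) simp
  ultimately show ?thesis by (rule holomorphic_transform) auto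
qed

text \<open>Along \<open>f\<close> the point \<open>a\<close> is taken to be \<open>\<eta>2 z\<close>, so that \<open>f z\<close> and the nearly extremal disc at
  \<open>a\<close> agree to second order.  \<open>N\<close> and \<open>H\<close> come from the third Taylor polynomial of \<open>f\<close>.\<close>

lemma disc_estimate:
  assumes D: "open D" "convex D" "bounded D" and xD: "x \<in> D" and M: "\<And>d. d \<in> D \<Longrightarrow> norm d \<le> M"
    and f: "f \<in> hol_maps (ball 0 R0) D"
    and c: "\<And>i. norm (c i) \<le> M / \<rho> ^ i"
      "\<And>z. z \<in> ball 0 \<rho> \<Longrightarrow> (\<lambda>i. z ^ i *\<^sub>C c i) sums f z"
      "\<And>z. z \<in> ball 0 \<rho> \<Longrightarrow> (\<lambda>i. (of_nat (Suc i) * z ^ i) *\<^sub>C c (Suc i)) sums cderiv f z"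
      "c 0 = x" "c 1 = v" "0 < \<rho>" "\<rho> < R0"
    and k: "k > 0" "k / 2 < \<eta>1" "\<eta>1 < \<eta>2" "\<eta>2 < 2 * k" "kobayashi D x v < \<eta>2"
    and r1: "0 < r1" "r1 \<le> \<rho> / 4" "r1 \<le> 1 / (16 * k)"
  defines "K0 \<equiv> 4 / (\<epsilon> * k)"
  defines "C3 \<equiv> 2 * K0 * (16 * M / \<rho> ^ 4)"
  defines "C4 \<equiv> 16 * k * K0 * (2 * M / \<rho>\<^sup>2 + 32 * M * k\<^sup>2) + 2 * K0 * M / \<rho> ^ 3"
  obtains N H where "N holomorphic_on ball 0 r1" "H holomorphic_on ball 0 r1"
    "\<And>z. z \<in> ball 0 r1 \<Longrightarrow> norm (N z) \<le> 6 * K0 * M / \<rho>"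
    "\<And>z. z \<in> ball 0 r1 \<Longrightarrow> norm (H z) \<le> 28 * K0 * M"
    "norm (N 0) \<ge> 1" "N 0 = of_real \<eta>2 * H 0"
    "\<And>z. z \<in> ball 0 r1 \<Longrightarrow> norm (N z) - C3 * norm z ^ 3
      \<le> kobayashi D (f z) (cderiv f z) * ((1 - (\<eta>2 * norm z)\<^sup>2) * (norm (H z) + C4 * norm z ^ 3 + 16 * (1 / \<eta>1 - 1 / \<eta>2)))"
proof -
  have \<eta>2: "\<eta>2 > 0" using k by linarith
  have M0: "M \<ge> 0" using M[OF xD] norm_ge_zero order_trans by blast
  \<comment> \<open>\<open>K0\<close> majorises \<open>K\<close> for every
    \<open>\<eta>1 > k / 2\<close>, so the constants built from it do not depend on the choice of
    \<open>\<eta>1\<close> and \<open>\<eta>2\<close>.\<close>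
  have K0: "0 < K" "K \<le> K0" "0 < K0"
  proof -
    show "0 < K" by (rule K_pos)
    have "K = (4 / \<epsilon>) / (2 * \<eta>1)" using \<epsilon>(1) by (simp add: K_def field_simps)
    also have "\<dots> \<le> (4 / \<epsilon>) / k" using \<epsilon>(1) k(1,2) by (intro divide_left_mono) auto
    finally show "K \<le> K0" using \<epsilon>(1) by (simp add: K0_def field_simps)
    then show "0 < K0" using K_pos by linarith
  qed
  obtain n \<alpha> where \<phi>: "\<alpha> 0 = x" "\<eta>2 *\<^sub>R \<alpha> 1 = v" "\<And>z. z \<in> cball 0 1 \<Longrightarrow> (\<Sum>i<n. z ^ i *\<^sub>C \<alpha> i) \<in> D" "n \<ge> 2"
    using polynomial_disc[OF D(1,3) xD k(5)] by metis
  define p where "p = (\<lambda>a. \<Sum>i<n. a ^ i *\<^sub>C \<alpha> i)"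
  define p' where "p' = (\<lambda>a. \<Sum>i<n. (of_nat i * a ^ (i - 1)) *\<^sub>C \<alpha> i)"
  have dp: "has_cderiv p (p' a) a" for a
    unfolding p_def p'_def by (intro has_cderiv_sum has_cderiv_scaleC_const) (auto intro!: derivative_eq_intros)
  have p_hol: "p \<in> hol_maps (ball 0 1) D"
    using \<phi>(3) dp by (intro hol_mapsI[where f' = p']) (auto simp: p_def)
  obtain d where d: "\<And>i. norm (d i) \<le> M / (1 / 2) ^ i"
    "\<And>z. z \<in> ball 0 (1 / 2) \<Longrightarrow> (\<lambda>i. z ^ i *\<^sub>C d i) sums p z"
    "\<And>z. z \<in> ball 0 (1 / 2) \<Longrightarrow> (\<lambda>i. (of_nat (Suc i) * z ^ i) *\<^sub>C d (Suc i)) sums p' z"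
    "d 0 = p 0" "d 1 = p' 0"
  proof (rule hol_maps_taylor[OF p_hol M, of "1 / 2", unfolded cderivI[OF dp]])
    fix c :: "nat \<Rightarrow> 'a"
    assume c: "\<And>i. norm (c i) \<le> M / (1 / 2) ^ i"
      "\<And>z. z \<in> ball 0 (1 / 2) \<Longrightarrow> (\<lambda>i. z ^ i *\<^sub>C c i) sums p z"
      "\<And>z. z \<in> ball 0 (1 / 2) \<Longrightarrow> (\<lambda>i. (of_nat (Suc i) * z ^ i) *\<^sub>C c (Suc i)) sums p' z"
      "c 0 = p 0" "c 1 = p' 0"
    show thesis by (rule that[OF c])
  qed simp_all
  obtain n' where n': "n = Suc (Suc n')" using \<phi>(4) by (metis add_2_eq_Suc le_Suc_ex)
  have p0: "p 0 = x" "p' 0 = \<alpha> 1"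
    unfolding p_def p'_def n' sum.lessThan_Suc_shift by (simp_all add: \<phi>(1))
  have v: "v = \<eta>2 *\<^sub>R \<alpha> 1" using \<phi>(2) by (rule sym)
  \<comment> \<open>Degree three for \<open>f\<close> and two for its derivative leave errors of
    order at least three, and polynomials make \<open>N\<close> and \<open>H\<close> finite sums of
    scalar holomorphic functions.\<close>
  define f3 where "f3 = (\<lambda>z. \<Sum>i<4. z ^ i *\<^sub>C c i)"
  define f3' where "f3' = (\<lambda>z. \<Sum>i<3. (of_nat (Suc i) * z ^ i) *\<^sub>C c (Suc i))"
  \<comment> \<open>\<open>N\<close> pairs the truncated derivative of \<open>f\<close>.
    \<open>H\<close> collects the terms of \<open>disc_inequality\<close> that depend
    holomorphically on \<open>a\<close>, including the pairing of the second-order difference with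
    \<open>k2\<close>.\<close>
  define N where "N = (\<lambda>z. pair (k1 (of_real \<eta>2 * z)) (f3' z))"
  define H where "H = (\<lambda>z. pair (k1 (of_real \<eta>2 * z)) (p' (of_real \<eta>2 * z))
      - pair (k2 (of_real \<eta>2 * z)) (f3 z - p (of_real \<eta>2 * z)))"
  have az: "norm (of_real \<eta>2 * z) \<le> 2 * k * norm z" "norm (of_real \<eta>2 * z) < 1 / 8" if "z \<in> ball 0 r1" for z :: complex
  proof -
    show 1: "norm (of_real \<eta>2 * z) \<le> 2 * k * norm z"
      unfolding norm_mult using \<eta>2 k by (intro mult_right_mono) auto
    have "norm z < 1 / (16 * k)" using that r1 by simp
    then have "2 * k * norm z < 1 / 8" using k(1) by (simp add: field_simps)
    with 1 show "norm (of_real \<eta>2 * z) < 1 / 8" by linarith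
  qed
  have az2: "of_real \<eta>2 * z \<in> ball 0 (1 / 2)" "norm (of_real \<eta>2 * z) < 1" if "z \<in> ball 0 r1" for z :: complex
    using az[OF that] by auto
  have holk: "(\<lambda>z. pair (k1 (of_real \<eta>2 * z)) \<nu>) holomorphic_on ball 0 r1"
    "(\<lambda>z. pair (k2 (of_real \<eta>2 * z)) \<nu>) holomorphic_on ball 0 r1" for \<nu>
  proof -
    have *: "(\<lambda>z. of_real \<eta>2 * z) holomorphic_on ball 0 r1" by (intro holomorphic_intros)
    have im: "(\<lambda>z. of_real \<eta>2 * z) ` ball 0 r1 \<subseteq> ball (0::complex) (1 / 2)" using az2(1) by blast
    show "(\<lambda>z. pair (k1 (of_real \<eta>2 * z)) \<nu>) holomorphic_on ball 0 r1"
      using holomorphic_on_compose_gen[OF * holomorphic_pair_k1 im] by (simp add: o_def)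
    show "(\<lambda>z. pair (k2 (of_real \<eta>2 * z)) \<nu>) holomorphic_on ball 0 r1"
      using holomorphic_on_compose_gen[OF * holomorphic_pair_k2 im] by (simp add: o_def)
  qed
  have "(\<lambda>z. \<Sum>i<3. (of_nat (Suc i) * z ^ i) * pair (k1 (of_real \<eta>2 * z)) (c (Suc i))) holomorphic_on ball 0 r1"
    by (intro holomorphic_intros holk)
  then have holN: "N holomorphic_on ball 0 r1"
    by (rule holomorphic_transform)
       (simp add: N_def f3'_def pair_sum pair_scale cont_k1 az2 del: of_nat_Suc)
  have "(\<lambda>z. (\<Sum>i<n. (of_nat i * (of_real \<eta>2 * z) ^ (i - 1)) * pair (k1 (of_real \<eta>2 * z)) (\<alpha> i))
      - ((\<Sum>i<4. z ^ i * pair (k2 (of_real \<eta>2 * z)) (c i))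
        - (\<Sum>i<n. (of_real \<eta>2 * z) ^ i * pair (k2 (of_real \<eta>2 * z)) (\<alpha> i)))) holomorphic_on ball 0 r1"
    by (intro holomorphic_intros holk)
  then have holH: "H holomorphic_on ball 0 r1"
    by (rule holomorphic_transform)
       (simp add: H_def f3_def p_def p'_def pair_sum pair_scale pair_diff cont_k1 cont_k2 az2)
  have k1K: "norm (pair (k1 (of_real \<eta>2 * z)) \<nu>) \<le> 2 * K0 * norm \<nu>"
    and k2K: "norm (pair (k2 (of_real \<eta>2 * z)) \<nu>) \<le> 4 * K0 * norm \<nu>" if "z \<in> ball 0 r1" for z \<nu>
  proof -
    have "norm (pair (k1 (of_real \<eta>2 * z)) \<nu>) \<le> 2 * K * norm \<nu>"
      using az[OF that] by (intro pair_k1_bound) simp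
    also have "\<dots> \<le> 2 * K0 * norm \<nu>" using K0 by (intro mult_right_mono) auto
    finally show "norm (pair (k1 (of_real \<eta>2 * z)) \<nu>) \<le> 2 * K0 * norm \<nu>" .
    have "norm (pair (k2 (of_real \<eta>2 * z)) \<nu>) \<le> 4 * K * norm \<nu>"
      using az[OF that] by (intro pair_k2_bound) simp
    also have "\<dots> \<le> 4 * K0 * norm \<nu>" using K0 by (intro mult_right_mono) auto
    finally show "norm (pair (k2 (of_real \<eta>2 * z)) \<nu>) \<le> 4 * K0 * norm \<nu>" .
  qed
  have zq: "norm z / \<rho> < 1 / 4" "z \<in> ball 0 \<rho>" "z \<in> ball 0 R0" if "z \<in> ball 0 r1" for z :: complex
    using that r1 c(6,7) by (auto simp: field_simps)
  have fterm: "norm (z ^ i *\<^sub>C c i) \<le> M * (norm z / \<rho>) ^ i" for z i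
    using mult_left_mono[OF c(1)[of i], of "norm z ^ i"] by (simp add: norm_scaleC norm_power power_divide mult.commute)
  have geom: "B * q ^ m / (1 - q) \<le> 2 * B * q ^ m" if "0 \<le> q" "q \<le> 1 / 2" "B \<ge> 0" for B q :: real and m
  proof -
    have "B * q ^ m / (1 - q) \<le> B * q ^ m / (1 / 2)" using that by (intro divide_left_mono) auto
    then show ?thesis by simp
  qed
  \<comment> \<open>Absorbs the factor produced by differentiation, at the cost of doubling the
    geometric ratio.\<close>
  have Suc_le: "real (Suc i) \<le> 2 ^ i" for i by (induction i) auto
  have ftail: "norm (f z - (\<Sum>i<m. z ^ i *\<^sub>C c i)) \<le> 2 * M * (norm z / \<rho>) ^ m" if z: "z \<in> ball 0 r1" for z m
  proof -
    have "norm (f z - (\<Sum>i<m. z ^ i *\<^sub>C c i)) \<le> M * (norm z / \<rho>) ^ m / (1 - norm z / \<rho>)"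
      using zq[OF z] c(6) by (intro norm_tail_geometric c(2) fterm) auto
    also have "\<dots> \<le> 2 * M * (norm z / \<rho>) ^ m" using zq[OF z] M0 c(6) by (intro geom) auto
    finally show ?thesis .
  qed
  have f'term: "norm ((of_nat (Suc i) * z ^ i) *\<^sub>C c (Suc i)) \<le> M / \<rho> * (2 * norm z / \<rho>) ^ i" for z i
  proof -
    have "norm ((of_nat (Suc i) * z ^ i) *\<^sub>C c (Suc i)) = real (Suc i) * norm z ^ i * norm (c (Suc i))"
      by (simp add: norm_scaleC norm_mult norm_power del: of_nat_Suc)
    also have "\<dots> \<le> 2 ^ i * norm z ^ i * (M / \<rho> ^ Suc i)"
      by (intro mult_mono c(1) mult_right_mono Suc_le) auto
    finally show ?thesis by (simp add: power_divide power_mult_distrib mult_ac)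
  qed
  have f'tail: "norm (cderiv f z - f3' z) \<le> 16 * M / \<rho> ^ 4 * norm z ^ 3" if z: "z \<in> ball 0 r1" for z :: complex
  proof -
    have "norm (cderiv f z - f3' z) \<le> M / \<rho> * (2 * norm z / \<rho>) ^ 3 / (1 - 2 * norm z / \<rho>)"
      unfolding f3'_def using zq[OF z] c(6) by (intro norm_tail_geometric c(3) f'term) auto
    also have "\<dots> \<le> 2 * (M / \<rho>) * (2 * norm z / \<rho>) ^ 3" using zq[OF z] M0 c(6) by (intro geom) auto
    also have "\<dots> = 16 * M / \<rho> ^ 4 * norm z ^ 3"
      using c(6) by (simp add: power_divide power_mult_distrib field_simps eval_nat_numeral)
    finally show ?thesis .
  qed
  have f3'_bound: "norm (f3' z) \<le> 3 * M / \<rho>" if z: "z \<in> ball 0 r1" for z :: complex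
  proof -
    have "norm (f3' z) \<le> (\<Sum>i<3::nat. M / \<rho> * 1)"
      unfolding f3'_def
    proof (rule sum_norm_le)
      fix i
      have "norm ((of_nat (Suc i) * z ^ i) *\<^sub>C c (Suc i)) \<le> M / \<rho> * (2 * norm z / \<rho>) ^ i" by (rule f'term)
      also have "\<dots> \<le> M / \<rho> * 1"
        using zq[OF z] M0 c(6) by (intro mult_left_mono power_le_one) auto
      finally show "norm ((of_nat (Suc i) * z ^ i) *\<^sub>C c (Suc i)) \<le> M / \<rho> * 1" .
    qed
    then show ?thesis by simp
  qed
  have f3_bound: "norm (f3 z) \<le> 4 * M" if z: "z \<in> ball 0 r1" for z :: complex
  proof -
    have "norm (f3 z) \<le> (\<Sum>i<4::nat. M * 1)"
      unfolding f3_def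
    proof (rule sum_norm_le)
      fix i
      have "norm (z ^ i *\<^sub>C c i) \<le> M * (norm z / \<rho>) ^ i" by (rule fterm)
      also have "\<dots> \<le> M * 1"
        using zq[OF z] M0 c(6) by (intro mult_left_mono power_le_one) auto
      finally show "norm (z ^ i *\<^sub>C c i) \<le> M * 1" .
    qed
    then show ?thesis by simp
  qed
  have pterm: "norm (a ^ i *\<^sub>C d i) \<le> M * (2 * norm a) ^ i" for a i
    using mult_left_mono[OF d(1)[of i], of "norm a ^ i"]
    by (simp add: norm_scaleC norm_power power_divide power_mult_distrib mult_ac)
  have ptail: "norm (p a - (x + a *\<^sub>C \<alpha> 1)) \<le> 8 * M * (norm a)\<^sup>2" if a: "norm a < 1 / 8" for a
  proof -
    have "(\<Sum>i<2. a ^ i *\<^sub>C d i) = x + a *\<^sub>C \<alpha> 1"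
      using d(4,5) p0 by (simp add: numeral_2_eq_2)
    moreover have "norm (p a - (\<Sum>i<2. a ^ i *\<^sub>C d i)) \<le> M * (2 * norm a) ^ 2 / (1 - 2 * norm a)"
      using a by (intro norm_tail_geometric d(2) pterm) auto
    moreover have "\<dots> \<le> 2 * M * (2 * norm a) ^ 2" using a M0 by (intro geom) auto
    ultimately show ?thesis by (simp add: power_mult_distrib)
  qed
  have p'_bound: "norm (p' a) \<le> 4 * M" if a: "norm a < 1 / 8" for a
  proof -
    have p'term: "norm ((of_nat (Suc i) * a ^ i) *\<^sub>C d (Suc i)) \<le> 2 * M * (4 * norm a) ^ i" for i
    proof -
      have "norm ((of_nat (Suc i) * a ^ i) *\<^sub>C d (Suc i)) = real (Suc i) * norm a ^ i * norm (d (Suc i))"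
        by (simp add: norm_scaleC norm_mult norm_power del: of_nat_Suc)
      also have "\<dots> \<le> 2 ^ i * norm a ^ i * (M / (1 / 2) ^ Suc i)"
        by (intro mult_mono d(1) mult_right_mono Suc_le) auto
      also have "\<dots> = 2 * M * (2 ^ i * 2 ^ i * norm a ^ i)" by (simp add: power_divide mult_ac)
      also have "(2::real) ^ i * 2 ^ i = 4 ^ i" by (simp flip: power_mult_distrib)
      finally show ?thesis by (simp add: power_mult_distrib)
    qed
    have "norm (p' a - (\<Sum>i<0. (of_nat (Suc i) * a ^ i) *\<^sub>C d (Suc i))) \<le> 2 * M * (4 * norm a) ^ 0 / (1 - 4 * norm a)"
      using a by (intro norm_tail_geometric d(3) p'term) auto
    moreover have "\<dots> \<le> 2 * (2 * M) * (4 * norm a) ^ 0" using a M0 by (intro geom) auto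
    ultimately show ?thesis by simp
  qed
  \<comment> \<open>Both maps have the same first-order part \<open>x + z *\<^sub>C v\<close>,
    because \<open>\<eta>2 *\<^sub>R \<alpha> 1 = v\<close>. A further factor \<open>norm a\<close>
    will make this cubic.\<close>
  have second_order: "norm (f z - p (of_real \<eta>2 * z)) \<le> (2 * M / \<rho>\<^sup>2 + 32 * M * k\<^sup>2) * (norm z)\<^sup>2"
    if z: "z \<in> ball 0 r1" for z :: complex
  proof -
    let ?a = "of_real \<eta>2 * z"
    have "(\<Sum>i<2. z ^ i *\<^sub>C c i) = x + ?a *\<^sub>C \<alpha> 1"
      using c(4,5) v by (simp add: numeral_2_eq_2 scaleR_scaleC scaleC_scaleC mult.commute)
    then have "norm (f z - (x + ?a *\<^sub>C \<alpha> 1)) \<le> 2 * M * (norm z / \<rho>)\<^sup>2" using ftail[OF z, of 2] by simp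
    moreover have "norm (p ?a - (x + ?a *\<^sub>C \<alpha> 1)) \<le> 8 * M * (2 * k * norm z)\<^sup>2"
      using ptail[OF az(2)[OF z]] mult_left_mono[OF power_mono[OF az(1)[OF z], of 2], of "8 * M"] M0 by simp
    moreover have "norm (f z - p ?a) \<le> norm (f z - (x + ?a *\<^sub>C \<alpha> 1)) + norm (p ?a - (x + ?a *\<^sub>C \<alpha> 1))"
      using norm_triangle_ineq4[of "f z - (x + ?a *\<^sub>C \<alpha> 1)" "p ?a - (x + ?a *\<^sub>C \<alpha> 1)"] by simp
    ultimately show ?thesis by (simp add: power_mult_distrib power_divide algebra_simps)
  qed
  define \<delta> where "\<delta> = 1 / \<eta>1 - 1 / \<eta>2"
  have main: "norm (N z) - C3 * norm z ^ 3
      \<le> kobayashi D (f z) (cderiv f z) * ((1 - (\<eta>2 * norm z)\<^sup>2) * (norm (H z) + C4 * norm z ^ 3 + 16 * \<delta>))"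
    if z: "z \<in> ball 0 r1" for z :: complex
  proof -
    define a where "a = of_real \<eta>2 * z"
    have a: "norm a < 1 / 8" "norm a \<le> 2 * k * norm z" using az[OF z] by (auto simp: a_def)
    have cka: "continuous_on S1 (k1 a)" "continuous_on S1 (k2 a)" using a by (auto intro!: cont_k1 cont_k2)
    define q where "q = 1 - (norm a)\<^sup>2"
    have "(norm a)\<^sup>2 \<le> (1 / 8)\<^sup>2" using a by (intro power_mono) auto
    then have q: "1 / 2 \<le> q" by (simp add: q_def power2_eq_square)
    have fz: "f z \<in> D" by (rule hol_mapsD(2)[OF f zq(3)[OF z]])
    define G where "G = norm (H z) + C4 * norm z ^ 3 + 16 * \<delta>"
    \<comment> \<open>Polynomial discs exist only for \<open>\<eta>\<close> strictly above the
      metric; the value itself is reached by letting \<open>\<eta>\<close> decrease to it.\<close>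
    have step: "norm (N z) - C3 * norm z ^ 3 \<le> \<eta> * (q * G)" if \<eta>: "kobayashi D (f z) (cderiv f z) < \<eta>" "\<eta> > 0" for \<eta>
    proof -
      obtain m \<beta> where \<psi>: "\<beta> 0 = f z" "\<eta> *\<^sub>R \<beta> 1 = cderiv f z"
          "\<And>z. z \<in> cball 0 1 \<Longrightarrow> (\<Sum>i<m. z ^ i *\<^sub>C \<beta> i) \<in> D" "m \<ge> 2"
        using polynomial_disc[OF D(1,3) fz \<eta>(1)] by metis
      have "norm (pair (k1 a) (\<beta> 1)) / q \<le> norm (pair (k1 a) (p' a) - pair (k2 a) (\<beta> 0 - p a))
          + 2 * norm a / q * norm (pair (k1 a) (\<beta> 0 - p a)) + 16 * \<delta>"
        unfolding p_def p'_def q_def \<delta>_def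
        by (rule disc_inequality[OF D(2) \<phi>(1,2) _ \<phi>(4,3) \<psi>(4,3)]) (use a k(3) in auto)
      moreover have "norm (pair (k1 a) (p' a) - pair (k2 a) (f z - p a)) \<le> norm (H z) + 2 * K0 * M / \<rho> ^ 3 * norm z ^ 3"
      proof -
        have "pair (k1 a) (p' a) - pair (k2 a) (f z - p a) = H z - pair (k2 a) (f z - f3 z)"
          unfolding H_def a_def[symmetric] by (simp add: pair_diff cka)
        then have "norm (pair (k1 a) (p' a) - pair (k2 a) (f z - p a)) \<le> norm (H z) + norm (pair (k2 a) (f z - f3 z))"
          using norm_triangle_ineq4[of "H z" "pair (k2 a) (f z - f3 z)"] by simp
        also have "norm (pair (k2 a) (f z - f3 z)) \<le> 4 * K0 * (2 * M * (norm z / \<rho>) ^ 4)"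
          using k2K[OF z] mult_left_mono[OF ftail[OF z, of 4], of "4 * K0"] K0
          unfolding a_def f3_def by (meson order_trans mult_nonneg_nonneg zero_le_numeral less_imp_le)
        also have "\<dots> \<le> 4 * K0 * (2 * M * ((norm z / \<rho>) ^ 3 * (1 / 4)))"
          using zq(1)[OF z] K0 M0 c(6) unfolding power_Suc2[of _ 3, simplified]
          by (intro mult_left_mono) auto
        finally show ?thesis by (simp add: power_divide)
      qed
      moreover have "2 * norm a / q * norm (pair (k1 a) (f z - p a))
          \<le> (16 * k * K0 * (2 * M / \<rho>\<^sup>2 + 32 * M * k\<^sup>2)) * norm z ^ 3"
      proof -
        have "2 * norm a / q \<le> 2 * norm a / (1 / 2)" using q by (intro divide_left_mono) auto
        also have "\<dots> \<le> 8 * k * norm z" using a by simp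
        finally have 1: "2 * norm a / q \<le> 8 * k * norm z" .
        have "norm (pair (k1 a) (f z - p a)) \<le> 2 * K0 * norm (f z - p a)" unfolding a_def by (rule k1K[OF z])
        also have "\<dots> \<le> 2 * K0 * ((2 * M / \<rho>\<^sup>2 + 32 * M * k\<^sup>2) * (norm z)\<^sup>2)"
          unfolding a_def using K0 by (intro mult_left_mono second_order z) auto
        finally have "2 * norm a / q * norm (pair (k1 a) (f z - p a))
            \<le> 8 * k * norm z * (2 * K0 * ((2 * M / \<rho>\<^sup>2 + 32 * M * k\<^sup>2) * (norm z)\<^sup>2))"
          using 1 k(1) by (intro mult_mono) auto
        then show ?thesis by (simp add: power3_eq_cube power2_eq_square mult_ac)
      qed
      ultimately have "norm (pair (k1 a) (\<beta> 1)) / q \<le> G"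
        unfolding G_def C4_def \<psi>(1) by (simp add: distrib_right)
      then have 2: "norm (pair (k1 a) (\<beta> 1)) \<le> q * G" using q by (simp add: field_simps)
      have "N z = pair (k1 a) (cderiv f z) - pair (k1 a) (cderiv f z - f3' z)"
        unfolding N_def a_def[symmetric] by (simp add: pair_diff cka)
      then have "norm (N z) \<le> norm (pair (k1 a) (cderiv f z)) + norm (pair (k1 a) (cderiv f z - f3' z))"
        using norm_triangle_ineq4 by metis
      also have "norm (pair (k1 a) (cderiv f z - f3' z)) \<le> 2 * K0 * norm (cderiv f z - f3' z)"
        unfolding a_def by (rule k1K[OF z])
      also have "\<dots> \<le> 2 * K0 * (16 * M / \<rho> ^ 4 * norm z ^ 3)"
        using K0 by (intro mult_left_mono f'tail z) auto
      also have "\<dots> = C3 * norm z ^ 3" by (simp add: C3_def)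
      also have "norm (pair (k1 a) (cderiv f z)) = \<eta> * norm (pair (k1 a) (\<beta> 1))"
        using \<eta>(2) pair_scale[OF cka(1), of "of_real \<eta>" "\<beta> 1"] unfolding \<psi>(2)[symmetric] scaleC_of_real
        by (simp add: norm_mult)
      also have "\<dots> \<le> \<eta> * (q * G)" using 2 \<eta>(2) by (intro mult_left_mono) auto
      finally show ?thesis by simp
    qed
    define k0 where "k0 = kobayashi D (f z) (cderiv f z)"
    have k0: "k0 \<ge> 0"
      unfolding k0_def kobayashi_def using kobayashi_set_nonempty[OF D(1) fz]
      by (intro cInf_greatest) auto
    have "norm (N z) - C3 * norm z ^ 3 \<le> k0 * (q * G)"
    proof (rule tendsto_lowerbound)
      show "((\<lambda>\<eta>. \<eta> * (q * G)) \<longlongrightarrow> k0 * (q * G)) (at_right k0)" by (intro tendsto_intros)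
      have "\<forall>\<^sub>F \<eta> in at_right k0. k0 < \<eta>" by (rule eventually_at_right_less)
      then show "\<forall>\<^sub>F \<eta> in at_right k0. norm (N z) - C3 * norm z ^ 3 \<le> \<eta> * (q * G)"
      proof eventually_elim
        case (elim \<eta>)
        then show ?case using k0 by (intro step) (auto simp: k0_def)
      qed
    qed simp
    moreover have "(norm a)\<^sup>2 = (\<eta>2 * norm z)\<^sup>2" using \<eta>2 by (simp add: a_def norm_mult)
    ultimately show ?thesis unfolding k0_def q_def G_def by simp
  qed
  have f30: "f3 0 = x" "f3' 0 = v"
    using c(4,5) unfolding f3_def f3'_def
    by (simp_all add: numeral_3_eq_3 eval_nat_numeral power_0_left)
  \<comment> \<open>At \<open>a = 0\<close> the kernel \<open>k1\<close> is the variable itself, so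
    the normalisation \<open>L_v\<close> applies.\<close>
  have N0: "N 0 = L (\<lambda>\<zeta>. \<zeta> *\<^sub>C v)"
    unfolding N_def pair_def k1_def using f30
    by (intro L_cong) (auto simp: power2_eq_square)
  have N0_ge: "norm (N 0) \<ge> 1" using L_v complex_Re_le_cmod[of "N 0"] unfolding N0 by linarith
  \<comment> \<open>At 0 both discs pass through \<open>x\<close>, so the \<open>k2\<close> term of
    \<open>H\<close> vanishes.\<close>
  have N0H: "N 0 = of_real \<eta>2 * H 0"
  proof -
    have "H 0 = pair (k1 0) (\<alpha> 1)"
      unfolding H_def using f30 p0 pair_diff[OF cont_k2, of 0 x x] by simp
    moreover have "N 0 = pair (k1 0) (of_real \<eta>2 *\<^sub>C \<alpha> 1)"
      unfolding N_def using f30 v by (simp add: scaleC_of_real)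
    ultimately show ?thesis using pair_scale[OF cont_k1[of 0]] by simp
  qed
  show ?thesis
  proof (rule that[OF holN holH _ _ N0_ge N0H])
    fix z :: complex assume z: "z \<in> ball 0 r1"
    show "norm (N z) \<le> 6 * K0 * M / \<rho>"
      using k1K[OF z, of "f3' z"] mult_left_mono[OF f3'_bound[OF z], of "2 * K0"] K0
      by (simp add: N_def)
    have pz: "norm (p (of_real \<eta>2 * z)) \<le> M"
      using az2(2)[OF z] by (intro M hol_mapsD(2)[OF p_hol]) simp
    have "norm (f3 z - p (of_real \<eta>2 * z)) \<le> 5 * M"
      using norm_triangle_ineq4[of "f3 z" "p (of_real \<eta>2 * z)"] f3_bound[OF z] pz by linarith
    then have "4 * K0 * norm (f3 z - p (of_real \<eta>2 * z)) \<le> 4 * K0 * (5 * M)"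
      using K0 by (intro mult_left_mono) auto
    moreover have "2 * K0 * norm (p' (of_real \<eta>2 * z)) \<le> 2 * K0 * (4 * M)"
      using K0 p'_bound[OF az(2)[OF z]] by (intro mult_left_mono) auto
    ultimately show "norm (H z) \<le> 28 * K0 * M"
      using k1K[OF z, of "p' (of_real \<eta>2 * z)"] k2K[OF z, of "f3 z - p (of_real \<eta>2 * z)"]
        norm_triangle_ineq4[of "pair (k1 (of_real \<eta>2 * z)) (p' (of_real \<eta>2 * z))"
          "pair (k2 (of_real \<eta>2 * z)) (f3 z - p (of_real \<eta>2 * z))"]
      unfolding H_def by linarith
    show "norm (N z) - C3 * norm z ^ 3
      \<le> kobayashi D (f z) (cderiv f z) * ((1 - (\<eta>2 * norm z)\<^sup>2) * (norm (H z) + C4 * norm z ^ 3 + 16 * (1 / \<eta>1 - 1 / \<eta>2)))"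
      using main[OF z] by (simp add: \<delta>_def)
  qed
qed

end

section \<open>Circle means\<close>

text \<open>\<open>nn_integral\<close> is monotone for arbitrary functions, so the comparison
  applies directly to the metric along a disc, whose measurability is not established.\<close>

lemma circle_mean_mono:
  assumes "\<And>\<theta>. u (z + of_real r * exp (\<i> * of_real \<theta>)) \<le> w (z + of_real r * exp (\<i> * of_real \<theta>))"
  shows "circle_mean u z r \<le> circle_mean w z r"
proof -
  let ?p = "\<lambda>\<theta>. z + of_real r * exp (\<i> * of_real \<theta>)"
  have "(\<integral>\<^sup>+\<theta>\<in>{0..2*pi}. e2ennreal (u (?p \<theta>)) \<partial>lborel) \<le> (\<integral>\<^sup>+\<theta>\<in>{0..2*pi}. e2ennreal (w (?p \<theta>)) \<partial>lborel)"
    by (intro nn_integral_mono mult_right_mono e2ennreal_mono assms) simp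
  moreover have "(\<integral>\<^sup>+\<theta>\<in>{0..2*pi}. e2ennreal (- w (?p \<theta>)) \<partial>lborel) \<le> (\<integral>\<^sup>+\<theta>\<in>{0..2*pi}. e2ennreal (- u (?p \<theta>)) \<partial>lborel)"
    using assms by (intro nn_integral_mono mult_right_mono e2ennreal_mono) (simp_all add: ereal_minus_le_minus)
  ultimately show ?thesis
    unfolding circle_mean_def less_eq_ennreal.rep_eq
    by (intro ereal_mult_left_mono ereal_minus_mono) auto
qed

lemma circle_mean_ereal:
  assumes g: "((\<lambda>\<theta>. w (z + of_real r * exp (\<i> * of_real \<theta>))) has_integral I) {0..2*pi}"
    and cont: "continuous_on {0..2*pi} (\<lambda>\<theta>. w (z + of_real r * exp (\<i> * of_real \<theta>)))"
  shows "circle_mean (\<lambda>z. ereal (w z)) z r = ereal (I / (2 * pi))"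
proof -
  define g where "g = (\<lambda>\<theta>. w (z + of_real r * exp (\<i> * of_real \<theta>)))"
  have int: "set_integrable lborel {0..2*pi} g"
    using cont unfolding g_def by (rule borel_integrable_atLeastAtMost')
  then have int': "integrable lborel (\<lambda>\<theta>. indicator {0..2*pi} \<theta> * g \<theta>)" by (simp add: set_integrable_def)
  define A where "A = (\<integral>\<^sup>+\<theta>. ennreal (indicator {0..2*pi} \<theta> * g \<theta>) \<partial>lborel)"
  define B where "B = (\<integral>\<^sup>+\<theta>. ennreal (- (indicator {0..2*pi} \<theta> * g \<theta>)) \<partial>lborel)"
  have fin: "A \<noteq> \<infinity>" "B \<noteq> \<infinity>" using int' unfolding A_def B_def real_integrable_def by auto
  have "I = integral {0..2*pi} g" using g unfolding g_def by (simp add: integral_unique)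
  also have "\<dots> = (LINT \<theta>:{0..2*pi}|lborel. g \<theta>)" using set_borel_integral_eq_integral(2)[OF int] by simp
  also have "\<dots> = enn2real A - enn2real B"
    using real_lebesgue_integral_def[OF int'] by (simp add: set_lebesgue_integral_def A_def B_def)
  finally have I: "I = enn2real A - enn2real B" .
  have "(\<integral>\<^sup>+\<theta>\<in>{0..2*pi}. e2ennreal (ereal (g \<theta>)) \<partial>lborel) = A"
    unfolding A_def by (intro nn_integral_cong) (auto simp: indicator_def)
  moreover have "(\<integral>\<^sup>+\<theta>\<in>{0..2*pi}. e2ennreal (- ereal (g \<theta>)) \<partial>lborel) = B"
    unfolding B_def by (intro nn_integral_cong) (auto simp: indicator_def)
  ultimately have "circle_mean (\<lambda>z. ereal (w z)) z r = ereal (1 / (2 * pi)) * (enn2ereal A - enn2ereal B)"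
    unfolding circle_mean_def g_def by simp
  also have "enn2ereal A - enn2ereal B = ereal I"
    using fin unfolding I by (cases A; cases B) auto
  finally show ?thesis by simp
qed

text \<open>On a disc a zero-free \<open>F\<close> has a holomorphic logarithm \<open>g\<close>;
  Cauchy's formula gives the mean of \<open>g\<close>, and \<open>Re g\<close> is the logarithm of
  the modulus.\<close>

lemma mean_log_norm_holomorphic:
  assumes F: "F holomorphic_on ball 0 R" "\<And>z. z \<in> ball 0 R \<Longrightarrow> F z \<noteq> 0" and r: "0 < r" "r < R"
  shows "((\<lambda>\<theta>. ln (norm (F (of_real r * exp (\<i> * of_real \<theta>))))) has_integral 2 * pi * ln (norm (F 0))) {0..2*pi}"
proof -
  obtain g where g: "g holomorphic_on ball 0 R" "\<And>z. z \<in> ball 0 R \<Longrightarrow> exp (g z) = F z"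
    by (rule holomorphic_logarithm_exists[OF _ _ F, of 0]) (use r in auto)
  have ln_eq: "ln (norm (F z)) = Re (g z)" if "z \<in> ball 0 R" for z
    using g(2)[OF that] by (metis ln_exp norm_exp_eq_Re)
  have sub: "cball 0 r \<subseteq> ball (0::complex) R" using r by auto
  have "((\<lambda>u. g u / (u - 0)) has_contour_integral (2 * of_real pi * \<i> * g 0)) (circlepath 0 r)"
    using r g(1) sub
    by (intro Cauchy_integral_circlepath holomorphic_on_imp_continuous_on)
       (auto elim!: holomorphic_on_subset)
  then have "((\<lambda>\<theta>. g (0 + r * cis \<theta>) / (0 + r * cis \<theta> - 0) * r * \<i> * cis \<theta>)
      has_integral (2 * of_real pi * \<i> * g 0)) {0..2*pi}"
    unfolding circlepath_def by (subst (asm) has_contour_integral_part_circlepath_iff) auto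
  then have "((\<lambda>\<theta>. \<i> * g (r * cis \<theta>)) has_integral (2 * of_real pi * \<i> * g 0)) {0..2*pi}"
    using r by (simp add: mult.commute)
  from has_integral_mult_right[OF this, of "- \<i>"]
  have "((\<lambda>\<theta>. g (r * cis \<theta>)) has_integral (of_real (2 * pi) * g 0)) {0..2*pi}"
    by (simp add: algebra_simps)
  from has_integral_linear[OF this bounded_linear_Re]
  have "((\<lambda>\<theta>. Re (g (r * cis \<theta>))) has_integral (2 * pi * Re (g 0))) {0..2*pi}"
    by (simp add: o_def)
  then show ?thesis
    using r by (simp add: ln_eq norm_mult cis_conv_exp)
qed

text \<open>Around each point of the half disc a disc of radius \<open>r / 4\<close> fits inside the
  domain, so Cauchy's estimate bounds the derivative by \<open>4 * B / r\<close>.\<close>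

lemma holomorphic_growth:
  assumes F: "F holomorphic_on ball 0 r" "\<And>z. z \<in> ball 0 r \<Longrightarrow> norm (F z) \<le> B" and z: "norm z < r / 2"
  shows "norm (F z - F 0) \<le> 4 * B / r * norm z"
proof -
  have r: "r > 0" using z norm_ge_zero[of z] by linarith
  have "norm (F z - F 0) \<le> 4 * B / r * norm (z - 0)"
  proof (rule field_differentiable_bound)
    show "convex (ball (0::complex) (r / 2))" by simp
    fix w :: complex assume w: "w \<in> ball 0 (r / 2)"
    have wr: "w \<in> ball 0 r" using w r by auto
    show "(F has_field_derivative deriv F w) (at w within ball 0 (r / 2))"
      by (rule holomorphic_derivI[OF F(1) _ wr]) simp
    have sub: "cball w (r / 4) \<subseteq> ball 0 r"
    proof
      fix y assume "y \<in> cball w (r / 4)"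
      then show "y \<in> ball 0 r" using w r norm_triangle_ineq2[of y w] by (simp add: dist_norm norm_minus_commute)
    qed
    have "norm ((deriv ^^ 1) F w) \<le> fact 1 * B / (r / 4) ^ 1"
    proof (rule Cauchy_inequality)
      show "F holomorphic_on ball w (r / 4)" using F(1) sub ball_subset_cball by (meson holomorphic_on_subset)
      show "continuous_on (cball w (r / 4)) F"
        using holomorphic_on_imp_continuous_on[OF F(1)] sub by (rule continuous_on_subset)
      show "norm (F y) \<le> B" if "norm (w - y) = r / 4" for y
        using that sub by (intro F(2)) (auto simp: dist_norm)
    qed (use r in simp)
    then show "norm (deriv F w) \<le> 4 * B / r" by (simp add: mult.commute)
  qed (use z r in auto)
  then show ?thesis by simp
qed

text \<open>Takes logarithms in the inequality of \<open>disc_estimate\<close>, with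
  \<open>t\<close> the squared modulus of \<open>a\<close>. The bound \<open>ln q \<le> - t\<close>
  produces the curvature term; the lower bounds on \<open>n\<close> and \<open>h\<close> let the
  errors enter linearly.\<close>

lemma ln_perturbed_quotient_bound:
  fixes n h k q t e1 e2 h0 :: real
  assumes le: "n - e1 \<le> k * (q * (h + e2))" and n: "n \<ge> 1 / 2" and h: "h \<ge> h0" "h0 > 0"
    and e: "0 \<le> e1" "e1 \<le> 1 / 4" "0 \<le> e2" and q: "q = 1 - t" "0 < q"
  shows "k > 0" "ln k \<ge> ln n - ln h + t - 4 * e1 - e2 / h0"
proof -
  have "0 < n - e1" using n e by linarith
  then have "0 < k * (q * (h + e2))" using le by linarith
  moreover have he: "0 < h + e2" using h e by linarith
  moreover have "0 < q * (h + e2)" using he q(2) by simp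
  ultimately show k: "k > 0" using zero_less_mult_pos2 by blast
  have "ln (n - e1) \<le> ln (k * (q * (h + e2)))" using \<open>0 < n - e1\<close> le by (subst ln_le_cancel_iff) auto
  also have "\<dots> = ln k + (ln q + ln (h + e2))" using k q(2) he by (simp add: ln_mult)
  also have "ln q \<le> - t" using ln_le_minus_one[OF q(2)] q(1) by simp
  also have "ln (h + e2) \<le> ln h + e2 / h0"
  proof -
    have hpos: "h > 0" using h by linarith
    have pos: "0 \<le> e2 / h" using hpos e by simp
    have "h + e2 = h * (1 + e2 / h)" using hpos by (simp add: distrib_left)
    then have "ln (h + e2) = ln h + ln (1 + e2 / h)" using hpos pos by (simp add: ln_mult)
    also have "ln (1 + e2 / h) \<le> e2 / h" by (intro ln_add_one_self_le_self pos)
    also have "e2 / h \<le> e2 / h0" using h hpos e by (intro divide_left_mono) auto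
    finally show ?thesis by simp
  qed
  finally have 1: "ln (n - e1) \<le> ln k + (- t + (ln h + e2 / h0))" by simp
  define s where "s = e1 / n"
  have s: "0 \<le> s" "s \<le> 1 / 2" "s \<le> 2 * e1"
  proof -
    show "0 \<le> s" using e n by (simp add: s_def)
    have "e1 / n \<le> e1 / (1 / 2)" using e n by (intro divide_left_mono) auto
    then show "s \<le> 2 * e1" by (simp add: s_def)
    then show "s \<le> 1 / 2" using e by linarith
  qed
  have "n - e1 = n * (1 - s)" using n by (simp add: s_def field_simps)
  then have "ln (n - e1) = ln n + ln (1 - s)" using n s by (simp add: ln_mult)
  moreover have "- s - 2 * s\<^sup>2 \<le> ln (1 - s)" using s by (intro ln_one_minus_pos_lower_bound) auto
  moreover have "2 * s\<^sup>2 \<le> s" using s mult_left_mono[of s "1 / 2" s] by (simp add: power2_eq_square)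
  ultimately show "ln k \<ge> ln n - ln h + t - 4 * e1 - e2 / h0" using 1 s(3) by linarith
qed

section \<open>Means of the logarithm of the metric along a disc\<close>

lemma elog_square: "t > 0 \<Longrightarrow> elog (t\<^sup>2) = ereal (2 * ln t)"
  by (simp add: elog_def ln_realpow)

text \<open>The order of choices matters: \<open>C\<close> and \<open>r0\<close> depend on
  \<open>D\<close>, \<open>f\<close>, \<open>k\<close> and the radii only. The bracket around
  \<open>k\<close> depends on \<open>s\<close>, which tends to 0 at fixed \<open>r\<close>.\<close>

lemma kobayashi_circle_mean_lower:
  fixes D :: "'a::cbanach set"
  assumes D: "open D" "convex D" "bounded D" and xD: "x \<in> D" and v: "v \<noteq> 0"
    and f: "f \<in> hol_maps (ball 0 R0) D" "R0 > 0" "f 0 = x" "cderiv f 0 = v"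
  defines "k \<equiv> kobayashi D x v"
  obtains C r0 where "r0 > 0"
    "\<And>r. 0 < r \<Longrightarrow> r < r0 \<Longrightarrow> ereal (2 * ln k + 2 * k\<^sup>2 * r\<^sup>2 - C * r ^ 3)
        \<le> circle_mean (\<lambda>z. elog ((kobayashi D (f z) (cderiv f z))\<^sup>2)) 0 r"
proof -
  have k: "k > 0" unfolding k_def by (rule kobayashi_pos[OF D(1,3) xD v])
  obtain M where M: "M > 0" "\<And>d. d \<in> D \<Longrightarrow> norm d \<le> M" using bounded_norm_bound[OF D(3)] by blast
  obtain \<epsilon> where \<epsilon>: "\<epsilon> > 0" "ball x \<epsilon> \<subseteq> D" using D(1) xD open_contains_ball by blast
  define \<rho> where "\<rho> = R0 / 2"
  have \<rho>: "0 < \<rho>" "\<rho> < R0" using f(2) by (auto simp: \<rho>_def)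
  obtain c where c: "\<And>i. norm (c i) \<le> M / \<rho> ^ i"
      "\<And>z. z \<in> ball 0 \<rho> \<Longrightarrow> (\<lambda>i. z ^ i *\<^sub>C c i) sums f z"
      "\<And>z. z \<in> ball 0 \<rho> \<Longrightarrow> (\<lambda>i. (of_nat (Suc i) * z ^ i) *\<^sub>C c (Suc i)) sums cderiv f z"
      "c 0 = f 0" "c 1 = cderiv f 0"
  proof ((rule hol_maps_taylor[OF f(1) M(2) \<rho>]; assumption?), goal_cases)
    case (1 c)
    show thesis by (rule that[OF 1(2-)])
  qed
  define r1 where "r1 = min (\<rho> / 4) (1 / (16 * k))"
  have r1: "0 < r1" "r1 \<le> \<rho> / 4" "r1 \<le> 1 / (16 * k)" using \<rho> k by (auto simp: r1_def)
  define K0 where "K0 = 4 / (\<epsilon> * k)"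
  define C3 where "C3 = 2 * K0 * (16 * M / \<rho> ^ 4)"
  define C4 where "C4 = 16 * k * K0 * (2 * M / \<rho>\<^sup>2 + 32 * M * k\<^sup>2) + 2 * K0 * M / \<rho> ^ 3"
  have K0: "K0 > 0" using \<epsilon> k by (simp add: K0_def)
  have C3: "C3 > 0" and C4: "C4 > 0"
    using K0 M(1) \<rho> k by (auto simp: C3_def C4_def intro!: add_pos_pos mult_pos_pos divide_pos_pos)
  define BN where "BN = 4 * (6 * K0 * M / \<rho>) / r1"
  define BH where "BH = 4 * (28 * K0 * M) / r1"
  have BN: "BN > 0" and BH: "BH > 0" using K0 M(1) \<rho> r1 by (auto simp: BN_def BH_def)
  \<comment> \<open>The entries, in order: \<open>r ^ 3 \<le> r\<close>; the growth estimate
    applies; \<open>N\<close> stays above 1/2; \<open>H\<close> stays above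
    \<open>1 / (4 * k)\<close>; the error \<open>C3 * r ^ 3\<close> stays below 1/4.\<close>
  define r0 where "r0 = Min {1, r1 / 2, 1 / (2 * BN), 1 / (4 * k * BH), 1 / (4 * C3)}"
  have r0: "r0 > 0" "r0 \<le> 1" "r0 \<le> r1 / 2" "r0 \<le> 1 / (2 * BN)" "r0 \<le> 1 / (4 * k * BH)" "r0 \<le> 1 / (4 * C3)"
    using r1 BN BH k C3 by (auto simp: r0_def)
  \<comment> \<open>Twice the coefficients with which \<open>ln_perturbed_quotient_bound\<close>
    returns the cubic errors: 4 for \<open>C3\<close> and \<open>4 * k\<close> for
    \<open>C4\<close>. The same division by \<open>1 / (4 * k)\<close>, doubled, turns the defect
    \<open>32 * s / k\<close> into \<open>256 * s\<close>.\<close>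
  define C where "C = 8 * C3 + 8 * k * C4"
  define u where "u = (\<lambda>z. elog ((kobayashi D (f z) (cderiv f z))\<^sup>2))"
  have approx: "ereal (2 * ln k + 2 * k\<^sup>2 * r\<^sup>2 - C * r ^ 3 - 256 * s) \<le> circle_mean u 0 r"
    if r: "0 < r" "r < r0" and s: "0 < s" "s < 1 / 2" for r s
  proof -
    \<comment> \<open>With these values the defect \<open>1 / \<eta>1 - 1 / \<eta>2\<close> is
      exactly \<open>2 * s / k\<close>.\<close>
    define \<eta>1 where "\<eta>1 = k / (1 + s)"
    define \<eta>2 where "\<eta>2 = k / (1 - s)"
    have \<eta>: "k / 2 < \<eta>1" "\<eta>1 < k" "k < \<eta>2" "\<eta>2 < 2 * k" "0 < \<eta>1"
      using k s by (auto simp: \<eta>1_def \<eta>2_def field_simps)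
    have \<delta>: "1 / \<eta>1 - 1 / \<eta>2 = 2 * s / k" using k s by (simp add: \<eta>1_def \<eta>2_def field_simps)
    obtain L where L: "dual_functional D x v \<eta>1 L"
      using ex_dual_functional[OF D(1,2) xD \<eta>(5)] \<eta>(2) unfolding k_def by blast
    interpret dual_functional D x v \<eta>1 L by (rule L)
    interpret normed_dual_functional D x v \<eta>1 L \<epsilon>
      by unfold_locales (use \<epsilon> \<eta> in auto)
    have kob2: "kobayashi D x v < \<eta>2" using \<eta>(3) by (simp add: k_def)
    have \<eta>12: "\<eta>1 < \<eta>2" using \<eta> by simp
    obtain N H where N: "N holomorphic_on ball 0 r1" and H: "H holomorphic_on ball 0 r1"
      and Nb: "\<And>z. z \<in> ball 0 r1 \<Longrightarrow> norm (N z) \<le> 6 * K0 * M / \<rho>"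
      and Hb: "\<And>z. z \<in> ball 0 r1 \<Longrightarrow> norm (H z) \<le> 28 * K0 * M"
      and N0: "norm (N 0) \<ge> 1" and NH: "N 0 = of_real \<eta>2 * H 0"
      and est: "\<And>z. z \<in> ball 0 r1 \<Longrightarrow> norm (N z) - C3 * norm z ^ 3
      \<le> kobayashi D (f z) (cderiv f z) * ((1 - (\<eta>2 * norm z)\<^sup>2) * (norm (H z) + C4 * norm z ^ 3 + 16 * (1 / \<eta>1 - 1 / \<eta>2)))"
    proof ((rule disc_estimate[OF D xD M(2) f(1) c(1-3) c(4)[unfolded f(3)] c(5)[unfolded f(4)]
          \<rho> k \<eta>(1) \<eta>12 \<eta>(4) kob2 r1]; assumption?), goal_cases)
      case (1 N H)
      show thesis by (rule that[OF 1(2-)[folded K0_def, folded C3_def C4_def]])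
    qed
    have H0: "norm (H 0) \<ge> 1 / (2 * k)"
    proof -
      have "1 \<le> \<eta>2 * norm (H 0)" using N0 \<eta> k unfolding NH by (simp add: norm_mult)
      also have "\<dots> \<le> 2 * k * norm (H 0)" using \<eta> by (intro mult_right_mono) auto
      finally show ?thesis using k by (simp add: field_simps)
    qed
    have Nge: "norm (N z) \<ge> 1 / 2" and Hge: "norm (H z) \<ge> 1 / (4 * k)" if z: "z \<in> ball 0 r0" for z
    proof -
      have z': "norm z < r1 / 2" "norm z \<le> 1 / (2 * BN)" "norm z \<le> 1 / (4 * k * BH)" using z r0 by auto
      have "norm (N z - N 0) \<le> BN * norm z" unfolding BN_def by (rule holomorphic_growth[OF N Nb z'(1)])
      also have "\<dots> \<le> 1 / 2" using z'(2) BN by (simp add: field_simps)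
      finally show "norm (N z) \<ge> 1 / 2" using N0 norm_triangle_ineq3[of "N z" "N 0"] by linarith
      have "norm (H z - H 0) \<le> BH * norm z" unfolding BH_def by (rule holomorphic_growth[OF H Hb z'(1)])
      also have "\<dots> \<le> 1 / (4 * k)" using z'(3) BH k by (simp add: field_simps)
      finally have "norm (H z) \<ge> 1 / (2 * k) - 1 / (4 * k)" using H0 norm_triangle_ineq3[of "H z" "H 0"] by linarith
      then show "norm (H z) \<ge> 1 / (4 * k)" by (simp add: field_simps)
    qed
    \<comment> \<open>On the zero-free disc this minorant is harmonic in \<open>z\<close>, the
      \<open>r\<close> terms being constants, so its mean is its value at 0.\<close>
    define g where "g = (\<lambda>z. 2 * ln (norm (N z)) - 2 * ln (norm (H z)) + (2 * k\<^sup>2 * r\<^sup>2 - C * r ^ 3 - 256 * s))"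
    have point: "ereal (g z) \<le> u z" if z: "norm z = r" for z
    proof -
      let ?K = "kobayashi D (f z) (cderiv f z)"
      let ?e1 = "C3 * r ^ 3" let ?e2 = "C4 * r ^ 3 + 32 * s / k"
      have zb: "z \<in> ball 0 r0" "z \<in> ball 0 r1" using z r r0 by auto
      have le: "norm (N z) - ?e1 \<le> ?K * ((1 - (\<eta>2 * r)\<^sup>2) * (norm (H z) + ?e2))"
        using est[OF zb(2)] unfolding z \<delta> by (simp add: add_ac)
      have e1: "0 \<le> ?e1" "?e1 \<le> 1 / 4"
      proof -
        show "0 \<le> ?e1" using C3 r by simp
        have "r ^ 3 \<le> r ^ 1" using r r0 by (intro power_decreasing) auto
        then have "?e1 \<le> C3 * r" using C3 by simp
        also have "\<dots> \<le> C3 * (1 / (4 * C3))" using r r0 C3 by (intro mult_left_mono) auto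
        finally show "?e1 \<le> 1 / 4" using C3 by simp
      qed
      have e2: "0 \<le> ?e2" using C4 r s k by simp
      have "\<eta>2 * r \<le> 2 * k * r1" using \<eta> r r0 r1 k by (intro mult_mono) auto
      also have "\<dots> \<le> 2 * k * (1 / (16 * k))" using r1 k by (intro mult_left_mono) auto
      finally have "\<eta>2 * r \<le> 1 / 8" using k by simp
      then have "(\<eta>2 * r)\<^sup>2 \<le> (1 / 8)\<^sup>2" using \<eta> k r by (intro power_mono) auto
      then have q: "0 < 1 - (\<eta>2 * r)\<^sup>2" by (simp add: power2_eq_square)
      have k4: "0 < 1 / (4 * k)" using k by simp
      note bd = ln_perturbed_quotient_bound[OF le Nge[OF zb(1)] Hge[OF zb(1)] k4 e1 e2 refl q]
      have "(k * r)\<^sup>2 \<le> (\<eta>2 * r)\<^sup>2" using \<eta> k r by (intro power_mono mult_right_mono) auto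
      then have kr: "k\<^sup>2 * r\<^sup>2 \<le> (\<eta>2 * r)\<^sup>2" by (simp add: power_mult_distrib)
      have "?e2 / (1 / (4 * k)) = 4 * k * C4 * r ^ 3 + 128 * s" using k by (simp add: field_simps)
      then have "g z \<le> 2 * ln ?K" using bd(2) kr by (simp add: g_def C_def algebra_simps)
      then show ?thesis using bd(1) by (simp add: u_def elog_square)
    qed
    have "circle_mean (\<lambda>z. ereal (g z)) 0 r
        = ereal ((2 * (2 * pi * ln (norm (N 0))) - 2 * (2 * pi * ln (norm (H 0)))
          + (2 * pi) * (2 * k\<^sup>2 * r\<^sup>2 - C * r ^ 3 - 256 * s)) / (2 * pi))"
    proof (rule circle_mean_ereal)
      have sub: "ball 0 r0 \<subseteq> ball (0::complex) r1" using r0 r1 by auto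
      have nz: "N z \<noteq> 0" "H z \<noteq> 0" if "z \<in> ball 0 r0" for z
        using Nge[OF that] Hge[OF that] k by auto
      have iN: "((\<lambda>\<theta>. ln (norm (N (of_real r * exp (\<i> * of_real \<theta>))))) has_integral 2 * pi * ln (norm (N 0))) {0..2*pi}"
        by (rule mean_log_norm_holomorphic[OF holomorphic_on_subset[OF N sub] nz(1) r])
      have iH: "((\<lambda>\<theta>. ln (norm (H (of_real r * exp (\<i> * of_real \<theta>))))) has_integral 2 * pi * ln (norm (H 0))) {0..2*pi}"
        by (rule mean_log_norm_holomorphic[OF holomorphic_on_subset[OF H sub] nz(2) r])
      have "((\<lambda>\<theta>::real. 2 * k\<^sup>2 * r\<^sup>2 - C * r ^ 3 - 256 * s) has_integral
          (2 * pi) * (2 * k\<^sup>2 * r\<^sup>2 - C * r ^ 3 - 256 * s)) {0..2*pi}"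
        using has_integral_const_real[of "2 * k\<^sup>2 * r\<^sup>2 - C * r ^ 3 - 256 * s" 0 "2 * pi"] by simp
      from has_integral_add[OF has_integral_diff[OF has_integral_mult_right[OF iN, of 2] has_integral_mult_right[OF iH, of 2]] this]
      show "((\<lambda>\<theta>. g (0 + of_real r * exp (\<i> * of_real \<theta>))) has_integral
          (2 * (2 * pi * ln (norm (N 0))) - 2 * (2 * pi * ln (norm (H 0)))
          + (2 * pi) * (2 * k\<^sup>2 * r\<^sup>2 - C * r ^ 3 - 256 * s))) {0..2*pi}"
        by (simp add: g_def)
      have cN: "continuous_on (ball 0 r0) N" "continuous_on (ball 0 r0) H"
        using holomorphic_on_imp_continuous_on N H sub continuous_on_subset by blast+
      have mem: "of_real r * exp (\<i> * of_real \<theta>) \<in> ball 0 r0" for \<theta> :: real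
        using r by (simp add: norm_mult)
      have ce: "continuous_on {0..2*pi} (\<lambda>\<theta>. of_real r * exp (\<i> * of_real \<theta>))" by (intro continuous_intros)
      have im: "(\<lambda>\<theta>. of_real r * exp (\<i> * of_real \<theta>)) ` {0..2*pi} \<subseteq> ball 0 r0" using mem by blast
      have "continuous_on {0..2*pi} (\<lambda>\<theta>. N (of_real r * exp (\<i> * of_real \<theta>)))"
        "continuous_on {0..2*pi} (\<lambda>\<theta>. H (of_real r * exp (\<i> * of_real \<theta>)))"
        by (rule continuous_on_compose2[OF cN(1) ce im] continuous_on_compose2[OF cN(2) ce im])+
      then show "continuous_on {0..2*pi} (\<lambda>\<theta>. g (0 + of_real r * exp (\<i> * of_real \<theta>)))"
        unfolding g_def using nz[OF mem] by (intro continuous_intros) auto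
    qed
    also have "(2 * (2 * pi * ln (norm (N 0))) - 2 * (2 * pi * ln (norm (H 0)))
          + (2 * pi) * (2 * k\<^sup>2 * r\<^sup>2 - C * r ^ 3 - 256 * s)) / (2 * pi)
        = 2 * (ln (norm (N 0)) - ln (norm (H 0))) + (2 * k\<^sup>2 * r\<^sup>2 - C * r ^ 3 - 256 * s)"
      by (simp add: field_simps)
    \<comment> \<open>The relation \<open>N 0 = \<eta>2 H 0\<close> cancels the unknown size of
      \<open>L\<close>; what remains is at least \<open>ln k\<close>.\<close>
    also have "ln (norm (N 0)) - ln (norm (H 0)) = ln \<eta>2"
    proof -
      have "norm (H 0) > 0" using H0 k by (smt (verit) divide_pos_pos)
      then show ?thesis unfolding NH using \<eta> k by (simp add: norm_mult ln_mult)
    qed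
    finally have mean: "circle_mean (\<lambda>z. ereal (g z)) 0 r
      = ereal (2 * ln \<eta>2 + (2 * k\<^sup>2 * r\<^sup>2 - C * r ^ 3 - 256 * s))" .
    have "ln k \<le> ln \<eta>2" using k \<eta> by simp
    then have "ereal (2 * ln k + 2 * k\<^sup>2 * r\<^sup>2 - C * r ^ 3 - 256 * s) \<le> circle_mean (\<lambda>z. ereal (g z)) 0 r"
      unfolding mean by simp
    also have "\<dots> \<le> circle_mean u 0 r"
      using r by (intro circle_mean_mono point) (simp add: norm_mult)
    finally show ?thesis .
  qed
  show ?thesis
  proof (rule that[OF r0(1)])
    fix r assume r: "0 < r" "r < r0"
    have "ereal (2 * ln k + 2 * k\<^sup>2 * r\<^sup>2 - C * r ^ 3) \<le> circle_mean u 0 r"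
    proof (rule ereal_le_epsilon2)
      fix e :: real assume e: "0 < e"
      define s where "s = min (e / 256) (1 / 4)"
      have s: "0 < s" "s < 1 / 2" "256 * s \<le> e" using e by (auto simp: s_def min_def)
      have "ereal (2 * ln k + 2 * k\<^sup>2 * r\<^sup>2 - C * r ^ 3) \<le> ereal (2 * ln k + 2 * k\<^sup>2 * r\<^sup>2 - C * r ^ 3 - 256 * s) + ereal e"
        using s by simp
      also have "\<dots> \<le> circle_mean u 0 r + ereal e" by (intro add_right_mono approx r s)
      finally show "ereal (2 * ln k + 2 * k\<^sup>2 * r\<^sup>2 - C * r ^ 3) \<le> circle_mean u 0 r + ereal e" .
    qed
    then show "ereal (2 * ln k + 2 * k\<^sup>2 * r\<^sup>2 - C * r ^ 3)
        \<le> circle_mean (\<lambda>z. elog ((kobayashi D (f z) (cderiv f z))\<^sup>2)) 0 r"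
      by (simp add: u_def)
  qed
qed

text \<open>After division by \<open>r\<^sup>2\<close> the cubic error vanishes with
  \<open>r\<close>, and the factor 4 of the Laplacian turns \<open>2 * k\<^sup>2\<close> into
  \<open>8 * k\<^sup>2\<close>.\<close>

theorem kobayashi_laplacian_lower:
  fixes D :: "'a::cbanach set"
  assumes D: "open D" "convex D" "bounded D" and xD: "x \<in> D" and v: "v \<noteq> 0"
    and f: "f \<in> hol_maps (ball 0 R0) D" "R0 > 0" "f 0 = x" "cderiv f 0 = v"
  shows "ereal (8 * (kobayashi D x v)\<^sup>2) \<le> gen_laplacian (\<lambda>z. elog ((kobayashi D (f z) (cderiv f z))\<^sup>2)) 0"
proof -
  define k where "k = kobayashi D x v"
  have k: "k > 0" unfolding k_def by (rule kobayashi_pos[OF D(1,3) xD v])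
  define u where "u = (\<lambda>z. elog ((kobayashi D (f z) (cderiv f z))\<^sup>2))"
  obtain C r0 where C: "r0 > 0"
    "\<And>r. 0 < r \<Longrightarrow> r < r0 \<Longrightarrow> ereal (2 * ln k + 2 * k\<^sup>2 * r\<^sup>2 - C * r ^ 3) \<le> circle_mean u 0 r"
  proof (rule kobayashi_circle_mean_lower[OF assms], goal_cases)
    case (1 C r0)
    show thesis by (rule that[OF 1(2-)[folded k_def u_def]])
  qed
  have u0: "u 0 = ereal (2 * ln k)" using k by (simp add: u_def f k_def elog_square)
  have lim: "((\<lambda>r. ereal (2 * k\<^sup>2 - C * r)) \<longlongrightarrow> ereal (2 * k\<^sup>2 - C * 0)) (at_right 0)"
    by (intro tendsto_intros)
  have "ereal (2 * k\<^sup>2) = Liminf (at_right 0) (\<lambda>r. ereal (2 * k\<^sup>2 - C * r))"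
    using lim_imp_Liminf[OF _ lim] by simp
  also have "\<dots> \<le> Liminf (at_right 0) (\<lambda>r. ereal (1 / r\<^sup>2) * (circle_mean u 0 r - u 0))"
  proof (rule Liminf_mono)
    have "\<forall>\<^sub>F r in at_right 0. r \<in> {0<..<r0}" by (rule eventually_at_right_real[OF C(1)])
    then show "\<forall>\<^sub>F r in at_right 0. ereal (2 * k\<^sup>2 - C * r) \<le> ereal (1 / r\<^sup>2) * (circle_mean u 0 r - u 0)"
    proof eventually_elim
      case (elim r)
      then have r: "0 < r" "r < r0" by auto
      have "ereal (2 * k\<^sup>2 - C * r) = ereal (1 / r\<^sup>2) * (ereal (2 * ln k + 2 * k\<^sup>2 * r\<^sup>2 - C * r ^ 3) - u 0)"
        using r unfolding u0 by (simp add: field_simps power2_eq_square power3_eq_cube)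
      also have "\<dots> \<le> ereal (1 / r\<^sup>2) * (circle_mean u 0 r - u 0)"
        by (intro ereal_mult_left_mono ereal_minus_mono C r) auto
      finally show ?case .
    qed
  qed
  finally have "4 * ereal (2 * k\<^sup>2) \<le> gen_laplacian u 0"
    unfolding gen_laplacian_def by (intro ereal_mult_left_mono) auto
  then show ?thesis by (simp add: u_def k_def)
qed

section \<open>Extremal discs in taut domains\<close>

definition net_compact :: "'a::complex_normed_vector topology \<Rightarrow> 'a set \<Rightarrow> bool" where
  "net_compact \<tau> D \<longleftrightarrow> (\<forall>(I :: ((complex \<Rightarrow> 'a) set \<times> (complex \<Rightarrow> 'a)) set) le f.
     directed_on I le \<and> (\<forall>a\<in>I. f a \<in> hol_maps (ball 0 1) D) \<longrightarrow> has_taut_subnet \<tau> D I le f)"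

lemma taut_alt: "taut D \<longleftrightarrow> (\<exists>\<tau>. locally_convex_topology \<tau> \<and> Hausdorff_space \<tau> \<and> net_compact \<tau> D)"
  by (simp add: taut_def net_compact_def)

text \<open>Centres in one compact set exclude compact divergence. A convergent subnet of a sequence
  need not contain a subsequence, so only the cluster property is kept: in every tail some term is
  close.\<close>

lemma net_compact_cluster:
  fixes f :: "nat \<Rightarrow> complex \<Rightarrow> 'a::complex_normed_vector"
  assumes T: "net_compact \<tau> D" and f: "\<And>n. f n \<in> hol_maps (ball 0 1) D"
    and L: "compact L" "L \<subseteq> D" "\<And>n. f n 0 \<in> L"
  obtains g where "g \<in> hol_maps (ball 0 1) D"
    "\<And>U K N. openin \<tau> U \<Longrightarrow> 0 \<in> U \<Longrightarrow> compact K \<Longrightarrow> K \<subseteq> ball 0 1 \<Longrightarrow> \<exists>n\<ge>N. \<forall>z\<in>K. f n z - g z \<in> U"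
proof -
  have "has_taut_subnet \<tau> D UNIV (\<le>) f"
  proof (rule every_net_has_taut_subnet)
    show "has_taut_subnet \<tau> D I' le' f'"
      if "directed_on I' le'" "\<forall>a\<in>I'. f' a \<in> hol_maps (ball 0 1) D"
      for I' :: "((complex \<Rightarrow> 'a) set \<times> (complex \<Rightarrow> 'a)) set" and le' f'
      using T that unfolding net_compact_def by blast
    show "directed_on (UNIV :: nat set) (\<le>)"
      unfolding directed_on_def by (auto intro: order_trans) (meson linear order_refl)
  qed (rule f)
  then obtain J :: "(nat \<times> (complex \<Rightarrow> 'a) set) set" and leJ h where J: "subnet_map UNIV (\<le>) J leJ h"
    and alt: "compactly_divergent D J leJ (f \<circ> h)
      \<or> (\<exists>g\<in>hol_maps (ball 0 1) D. converges_on_compacta \<tau> J leJ (f \<circ> h) g)"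
    unfolding has_taut_subnet_def by blast
  have dir: "directed_on J leJ" using J by (simp add: subnet_map_def)
  have "\<not> compactly_divergent D J leJ (f \<circ> h)"
  proof
    assume "compactly_divergent D J leJ (f \<circ> h)"
    then have "compact {0::complex} \<and> {0::complex} \<subseteq> ball 0 1 \<and> compact L \<and> L \<subseteq> D \<longrightarrow>
        (\<exists>a0\<in>J. \<forall>a\<in>J. leJ a0 a \<longrightarrow> (f \<circ> h) a ` {0} \<inter> L = {})"
      unfolding compactly_divergent_def by - (erule allE[of _ "{0::complex}"], erule allE[of _ L], assumption)
    then obtain a0 where a0: "a0 \<in> J" "\<forall>a\<in>J. leJ a0 a \<longrightarrow> (f \<circ> h) a ` {0} \<inter> L = {}"
      using L(1,2) by auto
    moreover have "leJ a0 a0" using dir a0(1) by (simp add: directed_on_def)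
    ultimately show False using a0 L(3)[of "h a0"] by auto
  qed
  with alt obtain g where g: "g \<in> hol_maps (ball 0 1) D" "converges_on_compacta \<tau> J leJ (f \<circ> h) g" by blast
  show ?thesis
  proof (rule that[OF g(1)])
    fix U and K :: "complex set" and N :: nat assume UK: "openin \<tau> U" "0 \<in> U" "compact K" "K \<subseteq> ball 0 1"
    then obtain a where a: "a \<in> J" "\<forall>b\<in>J. leJ a b \<longrightarrow> (\<forall>z\<in>K. (f \<circ> h) b z - g z \<in> U)"
      using g(2) unfolding converges_on_compacta_def by blast
    obtain b where b: "b \<in> J" "\<forall>j\<in>J. leJ b j \<longrightarrow> N \<le> h j"
      using J unfolding subnet_map_def by blast
    obtain c where "c \<in> J" "leJ a c" "leJ b c" using dir a(1) b(1) unfolding directed_on_def by blast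
    then show "\<exists>n\<ge>N. \<forall>z\<in>K. f n z - g z \<in> U" using a(2) b(2) by (intro exI[of _ "h c"]) auto
  qed
qed

lemma compact_insert_range_limit:
  fixes p :: "nat \<Rightarrow> 'a::topological_space"
  assumes lim: "p \<longlonglongrightarrow> l"
  shows "compact (insert l (range p))"
proof (rule compactI)
  fix C assume C: "\<forall>t\<in>C. open t" "insert l (range p) \<subseteq> \<Union>C"
  then obtain c where c: "c \<in> C" "l \<in> c" by blast
  then have "\<forall>\<^sub>F n in sequentially. p n \<in> c" using lim C(1) topological_tendstoD by blast
  then obtain N where N: "\<And>n. n \<ge> N \<Longrightarrow> p n \<in> c" unfolding eventually_sequentially by blast
  have "\<forall>n. \<exists>t\<in>C. p n \<in> t" using C(2) by blast
  then obtain t where t: "\<And>n. t n \<in> C" "\<And>n. p n \<in> t n" by metis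
  have "p n \<in> \<Union>(insert c (t ` {..<N}))" for n
    using N t(2) by (cases "n < N") auto
  then show "\<exists>C'\<subseteq>C. finite C' \<and> insert l (range p) \<subseteq> \<Union>C'"
    using c t(1) by (intro exI[of _ "insert c (t ` {..<N})"]) auto
qed

section \<open>Locally convex topologies and the norm topology\<close>

locale lc_topology =
  fixes \<tau> :: "'a::complex_normed_vector topology"
  assumes lc: "locally_convex_topology \<tau>" and haus: "Hausdorff_space \<tau>"
begin

lemma topspace_UNIV [simp]: "topspace \<tau> = UNIV"
  using lc by (simp add: locally_convex_topology_def)

lemma openin_translate:
  assumes "openin \<tau> U"
  shows "openin \<tau> {w. w + a \<in> U}"
proof -
  have "continuous_map \<tau> (prod_topology \<tau> \<tau>) (\<lambda>w. (w, a))"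
    by (intro continuous_map_pairedI continuous_map_id[unfolded id_def]) simp
  moreover have "continuous_map (prod_topology \<tau> \<tau>) \<tau> (\<lambda>(x, y). x + y)"
    using lc by (simp add: locally_convex_topology_def)
  ultimately have "continuous_map \<tau> \<tau> ((\<lambda>(x, y). x + y) \<circ> (\<lambda>w. (w, a)))" by (rule continuous_map_compose)
  then show ?thesis using openin_continuous_map_preimage[OF _ assms] by (fastforce simp: o_def)
qed

lemma continuous_scale: "continuous_map (prod_topology euclidean \<tau>) \<tau> (\<lambda>(c, x). c *\<^sub>C x)"
  using lc by (simp add: locally_convex_topology_def)

lemma openin_dilate:
  assumes "openin \<tau> U"
  shows "openin \<tau> {w. c *\<^sub>C w \<in> U}"
proof -
  have "continuous_map \<tau> (prod_topology euclidean \<tau>) (\<lambda>w. (c, w))"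
    by (intro continuous_map_pairedI continuous_map_id[unfolded id_def]) simp
  then have "continuous_map \<tau> \<tau> ((\<lambda>(c, x). c *\<^sub>C x) \<circ> (\<lambda>w. (c, w)))"
    using continuous_scale by (rule continuous_map_compose)
  then show ?thesis using openin_continuous_map_preimage[OF _ assms] by (fastforce simp: o_def)
qed

lemma convex_nhd_avoiding:
  assumes "e \<noteq> 0"
  obtains V where "openin \<tau> V" "0 \<in> V" "convex V" "e \<notin> V"
proof -
  obtain U W where "openin \<tau> U" "openin \<tau> W" "0 \<in> U" "e \<in> W" "disjnt U W"
    using haus assms unfolding Hausdorff_space_def by (metis UNIV_I topspace_UNIV)
  then have "e \<notin> U" by (auto simp: disjnt_def)
  moreover obtain V where "openin \<tau> V" "0 \<in> V" "convex V" "V \<subseteq> U"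
    using lc \<open>openin \<tau> U\<close> \<open>0 \<in> U\<close> unfolding locally_convex_topology_def by blast
  ultimately show ?thesis using that by blast
qed

text \<open>Norm-convergent sequences of constant maps have \<open>\<tau>\<close>-cluster points.  Applied to \<open>x + (n + 1) y\<^sub>n\<close>
  this shows that \<open>y\<^sub>n\<close> clusters at \<open>0\<close> for \<open>\<tau>\<close> as soon as \<open>(n + 1) y\<^sub>n\<close> tends to \<open>0\<close> in norm.\<close>

lemma net_compact_imp_coarser:
  assumes T: "net_compact \<tau> D" and D: "open D" "x \<in> D" and U: "openin \<tau> U" "0 \<in> U"
  shows "\<exists>e>0. ball 0 e \<subseteq> U"
proof (rule ccontr)
  assume no: "\<not> (\<exists>e>0. ball 0 e \<subseteq> U)"
  obtain \<epsilon> where \<epsilon>: "\<epsilon> > 0" "ball x \<epsilon> \<subseteq> D" using D open_contains_ball by blast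
  \<comment> \<open>The square leaves one factor \<open>Suc n\<close> to spare: even
    \<open>real (Suc n) *\<^sub>R y n\<close> tends to 0 and keeps the points \<open>p n\<close> in
    the ball.\<close>
  have "\<exists>y. norm y < \<epsilon> / (real (Suc n))\<^sup>2 \<and> y \<notin> U" for n
  proof -
    have "\<epsilon> / (real (Suc n))\<^sup>2 > 0" using \<epsilon> by simp
    then have "\<not> ball 0 (\<epsilon> / (real (Suc n))\<^sup>2) \<subseteq> U" using no by blast
    then show ?thesis by (auto simp: subset_iff)
  qed
  then obtain y where y: "\<And>n. norm (y n) < \<epsilon> / (real (Suc n))\<^sup>2" "\<And>n. y n \<notin> U" by metis
  define p where "p = (\<lambda>n. x + real (Suc n) *\<^sub>R y n)"
  have np: "norm (real (Suc n) *\<^sub>R y n) \<le> \<epsilon> / real (Suc n)" for n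
    using mult_left_mono[OF less_imp_le[OF y(1)[of n]], of "real (Suc n)"]
    by (simp add: power2_eq_square del: of_nat_Suc)
  have "(\<lambda>n. real (Suc n) *\<^sub>R y n) \<longlonglongrightarrow> 0"
  proof (rule Lim_null_comparison[where g = "\<lambda>n. \<epsilon> / real (Suc n)"])
    show "\<forall>\<^sub>F n in sequentially. norm (real (Suc n) *\<^sub>R y n) \<le> \<epsilon> / real (Suc n)" using np by simp
    have "(\<lambda>n. \<epsilon> * inverse (real (Suc n))) \<longlonglongrightarrow> \<epsilon> * 0" by (intro tendsto_intros LIMSEQ_inverse_real_of_nat)
    then show "(\<lambda>n. \<epsilon> / real (Suc n)) \<longlonglongrightarrow> 0" by (simp add: divide_inverse)
  qed
  then have p_lim: "p \<longlonglongrightarrow> x + 0" unfolding p_def by (intro tendsto_intros)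
  have pD: "p n \<in> D" for n
  proof -
    have "norm (real (Suc n) *\<^sub>R y n) = real (Suc n) * norm (y n)" by simp
    also have "\<dots> < real (Suc n) * (\<epsilon> / (real (Suc n))\<^sup>2)" by (intro mult_strict_left_mono y) simp
    also have "\<dots> = \<epsilon> / real (Suc n)" by (simp add: power2_eq_square del: of_nat_Suc)
    also have "\<dots> \<le> \<epsilon> / 1" using \<epsilon> by (intro divide_left_mono) auto
    finally show ?thesis using \<epsilon>(2) by (auto simp: p_def subset_iff dist_norm simp del: of_nat_Suc)
  qed
  have cpt: "compact (insert x (range p))" using compact_insert_range_limit[of p x] p_lim by simp
  have pm: "(\<lambda>n z::complex. p n) n \<in> hol_maps (ball 0 1) D" for n
    using pD has_cderiv_const by (auto simp: hol_maps_def)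
  obtain g :: "complex \<Rightarrow> 'a" where g: "\<And>U K N. openin \<tau> U \<Longrightarrow> 0 \<in> U \<Longrightarrow> compact K \<Longrightarrow> K \<subseteq> ball 0 1 \<Longrightarrow> \<exists>n\<ge>N. \<forall>z\<in>K. p n - g z \<in> U"
    by (rule net_compact_cluster[OF T, of "\<lambda>n z. p n", OF pm cpt]) (use pD D(2) in auto)
  \<comment> \<open>Whether \<open>q\<close> is 0 stays open. Joint continuity of scaling at
    \<open>(0, q)\<close> suffices: \<open>y n\<close> is a small multiple of a vector that is
    \<tau>-close to \<open>q\<close>, hence lies in \<open>U\<close>.\<close>
  define q where "q = g 0 - x"
  define P where "P = {cw \<in> topspace (prod_topology euclidean \<tau>). (\<lambda>(c, w). c *\<^sub>C w) cw \<in> U}"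
  have "openin (prod_topology euclidean \<tau>) P"
    unfolding P_def by (rule openin_continuous_map_preimage[OF continuous_scale U(1)])
  moreover have "(0::complex, q) \<in> P" unfolding P_def using U(2) by simp
  ultimately obtain C W where "openin euclidean C" and W: "openin \<tau> W" "q \<in> W" and C0: "0 \<in> C" and sub: "C \<times> W \<subseteq> P"
    unfolding openin_prod_topology_alt by meson
  then have openC: "open C" by simp
  have CW: "c *\<^sub>C w \<in> U" if "c \<in> C" "w \<in> W" for c w
    using sub that unfolding P_def by auto
  obtain \<delta> where \<delta>: "\<delta> > 0" "ball 0 \<delta> \<subseteq> C" using openC C0 open_contains_ball by blast
  obtain N where N: "inverse (real (Suc N)) < \<delta>" using reals_Archimedean[OF \<delta>(1)] by blast
  have "\<exists>n\<ge>N. \<forall>z\<in>{0}. p n - g z \<in> {w. w + q \<in> W}"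
    by (rule g) (use W openin_translate in auto)
  then obtain n where n: "n \<ge> N" "real (Suc n) *\<^sub>R y n \<in> W" by (auto simp: p_def q_def algebra_simps)
  have "inverse (real (Suc n)) \<le> inverse (real (Suc N))" using n(1) by (intro le_imp_inverse_le) auto
  moreover have "0 \<le> inverse (real (Suc n))" by simp
  ultimately have "norm (complex_of_real (inverse (real (Suc n)))) < \<delta>" using N unfolding norm_of_real by linarith
  then have "of_real (inverse (real (Suc n))) \<in> C" using \<delta>(2) by (auto simp only: mem_ball_0)
  from CW[OF this n(2), unfolded scaleC_of_real] have "y n \<in> U" by (simp del: of_nat_Suc)
  with y(2) show False by blast
qed

end

text \<open>A cluster point of nearly optimal discs is the candidate. Its derivative is identified
  through one functional that is bounded on a \<tau>-neighbourhood of 0, because Cauchy's estimate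
  then transfers closeness of values to derivatives.\<close>

lemma extremal_disc:
  fixes D :: "'a::cbanach set"
  assumes D: "open D" "bounded D" "taut D" and xD: "x \<in> D" and v: "v \<noteq> 0"
  obtains f where "f \<in> hol_maps (ball 0 1) D" "f 0 = x" "kobayashi D x v *\<^sub>R cderiv f 0 = v"
proof -
  define k where "k = kobayashi D x v"
  have k: "k > 0" unfolding k_def by (rule kobayashi_pos[OF D(1,2) xD v])
  obtain \<tau> where \<tau>: "locally_convex_topology \<tau>" "Hausdorff_space \<tau>" and T: "net_compact \<tau> D"
    using D(3) unfolding taut_alt by blast
  interpret lc_topology \<tau> by unfold_locales (rule \<tau>)+
  have "\<exists>\<eta> f. 0 < \<eta> \<and> \<eta> < k + inverse (real (Suc n)) \<and> f \<in> hol_maps (ball 0 1) D \<and> f 0 = x \<and> \<eta> *\<^sub>R cderiv f 0 = v" for n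
  proof -
    have "kobayashi D x v < k + inverse (real (Suc n))" by (simp add: k_def)
    then show ?thesis using kobayashi_ltE[OF D(1) xD] by metis
  qed
  then obtain \<eta> f where f: "\<And>n. 0 < \<eta> n" "\<And>n. \<eta> n < k + inverse (real (Suc n))"
    "\<And>n. f n \<in> hol_maps (ball 0 1) D" "\<And>n. f n 0 = x" "\<And>n. \<eta> n *\<^sub>R cderiv (f n) 0 = v" by metis
  have \<eta>k: "k \<le> \<eta> n" for n unfolding k_def using f by (intro kobayashi_le)
  obtain g where g: "g \<in> hol_maps (ball 0 1) D"
    "\<And>U K N. openin \<tau> U \<Longrightarrow> 0 \<in> U \<Longrightarrow> compact K \<Longrightarrow> K \<subseteq> ball 0 1 \<Longrightarrow> \<exists>n\<ge>N. \<forall>z\<in>K. f n z - g z \<in> U"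
    by (rule net_compact_cluster[OF T, of f "{x}"]) (use xD f(3,4) in auto)
  have "g 0 = x"
  proof (rule ccontr)
    assume "g 0 \<noteq> x"
    then obtain V where V: "openin \<tau> V" "0 \<in> V" "x - g 0 \<notin> V"
      using convex_nhd_avoiding[of "x - g 0"] by auto
    have "\<exists>n\<ge>0. \<forall>z\<in>{0}. f n z - g z \<in> V" by (intro g V) auto
    then show False using V(3) f(4) by auto
  qed
  moreover have "k *\<^sub>R cderiv g 0 = v"
  proof (rule ccontr)
    assume ne: "k *\<^sub>R cderiv g 0 \<noteq> v"
    define e where "e = (1 / k) *\<^sub>R v - cderiv g 0"
    have "k *\<^sub>R e = v - k *\<^sub>R cderiv g 0" using k by (simp add: e_def scaleR_diff_right)
    then have "e \<noteq> 0" using ne by auto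
    then obtain V where V: "openin \<tau> V" "0 \<in> V" "convex V" "e \<notin> V" by (rule convex_nhd_avoiding)
    \<comment> \<open>\<tau> is coarser than the norm topology, so separation in the normed space
      applies to the \<tau>-neighbourhood \<open>V\<close>.\<close>
    have "open V"
      unfolding open_contains_ball
    proof
      fix p assume "p \<in> V"
      then obtain s where s: "s > 0" "ball 0 s \<subseteq> {w. w + p \<in> V}"
        using net_compact_imp_coarser[OF T D(1) xD openin_translate[OF V(1)], of p] by auto
      have "y \<in> V" if "y \<in> ball p s" for y
      proof -
        have "y - p \<in> ball 0 s" using that by (simp add: dist_norm norm_minus_commute)
        then show ?thesis using s(2) by force
      qed
      then show "\<exists>s>0. ball p s \<subseteq> V" using s(1) by blast
    qed
    then obtain l where l: "bounded_linear l" "\<And>d. d \<in> V \<Longrightarrow> l d < (l e :: real)"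
      using separate_point_open_convex[OF _ V(3,4)] by blast
    interpret l: bounded_linear l by (rule l)
    have le: "0 < l e" using l(2)[OF V(2)] by (simp add: l.zero)
    define \<Lambda> where "\<Lambda> = (\<lambda>x. Complex (l x) (- l (\<i> *\<^sub>C x)))"
    have \<Lambda>: "clinear_functional \<Lambda>" unfolding \<Lambda>_def by (rule complexify_functional[OF l(1)])
    \<comment> \<open>Four rotations scaled by 8 bound real and imaginary parts of
      \<open>\<Lambda>\<close> by \<open>l e / 8\<close>, the modulus by \<open>l e / 4\<close>, and
      after Cauchy's estimate at radius 1/2 the derivative by \<open>l e / 2\<close>.\<close>
    define U where "U = {w. 8 *\<^sub>C w \<in> V} \<inter> {w. (-8) *\<^sub>C w \<in> V} \<inter> {w. (8 * \<i>) *\<^sub>C w \<in> V} \<inter> {w. (- (8 * \<i>)) *\<^sub>C w \<in> V}"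
    have U: "openin \<tau> U" "0 \<in> U" unfolding U_def by (intro openin_Int openin_dilate V) (simp add: V)
    have \<Lambda>_le: "norm (\<Lambda> w) \<le> l e / 4" if w: "w \<in> U" for w
    proof -
      have c: "l (of_real r *\<^sub>C y) = r * l y" for r y by (simp add: scaleC_of_real l.scaleR)
      have "l (8 *\<^sub>C w) < l e" "l ((-8) *\<^sub>C w) < l e" "l ((8 * \<i>) *\<^sub>C w) < l e" "l ((- (8 * \<i>)) *\<^sub>C w) < l e"
        using w unfolding U_def by (auto intro: l(2))
      moreover have "l (8 *\<^sub>C w) = 8 * l w" "l ((-8) *\<^sub>C w) = -8 * l w"
        using c[of 8 w] c[of "-8" w] by simp_all
      moreover have "l ((8 * \<i>) *\<^sub>C w) = 8 * l (\<i> *\<^sub>C w)" "l ((- (8 * \<i>)) *\<^sub>C w) = -8 * l (\<i> *\<^sub>C w)"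
        using c[of 8 "\<i> *\<^sub>C w"] c[of "-8" "\<i> *\<^sub>C w"] by (simp_all add: scaleC_scaleC)
      ultimately have "\<bar>Re (\<Lambda> w)\<bar> \<le> l e / 8" "\<bar>Im (\<Lambda> w)\<bar> \<le> l e / 8" by (auto simp: \<Lambda>_def)
      then show ?thesis using cmod_le[of "\<Lambda> w"] by linarith
    qed
    have "(\<lambda>n. \<bar>l v\<bar> / k\<^sup>2 * inverse (real (Suc n))) \<longlonglongrightarrow> 0"
      by (intro tendsto_mult_right_zero LIMSEQ_inverse_real_of_nat)
    then have "\<forall>\<^sub>F n in sequentially. \<bar>l v\<bar> / k\<^sup>2 * inverse (real (Suc n)) < l e / 2"
      by (rule order_tendstoD(2)) (use le in simp)
    then obtain N where N: "\<And>n. n \<ge> N \<Longrightarrow> \<bar>l v\<bar> / k\<^sup>2 * inverse (real (Suc n)) < l e / 2"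
      unfolding eventually_sequentially by blast
    have "\<exists>n\<ge>N. \<forall>z\<in>cball 0 (1 / 2). f n z - g z \<in> U" by (rule g(2)[OF U]) auto
    then obtain n where n: "n \<ge> N" "\<And>z. z \<in> cball 0 (1 / 2) \<Longrightarrow> f n z - g z \<in> U" by blast
    define d where "d = (\<lambda>z. \<Lambda> (f n z - g z))"
    have dd: "(d has_field_derivative \<Lambda> (cderiv (f n) z - cderiv g z)) (at z)" if "z \<in> ball 0 1" for z
      unfolding d_def by (intro has_cderiv_functional[OF \<Lambda>] has_cderiv_diff hol_mapsD(1)[OF f(3)] hol_mapsD(1)[OF g(1)] that)
    then have hol: "d holomorphic_on ball 0 1" unfolding holomorphic_on_open[OF open_ball] by blast
    have sub: "cball 0 (1 / 2) \<subseteq> ball (0::complex) 1" by auto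
    have "norm ((deriv ^^ 1) d 0) \<le> fact 1 * (l e / 4) / (1 / 2) ^ 1"
    proof (rule Cauchy_inequality)
      show "d holomorphic_on ball 0 (1 / 2)" by (rule holomorphic_on_subset[OF hol]) auto
      show "continuous_on (cball 0 (1 / 2)) d"
        using holomorphic_on_imp_continuous_on[OF hol] sub by (rule continuous_on_subset)
      show "norm (d z) \<le> l e / 4" if "norm (0 - z) = 1 / 2" for z
        unfolding d_def using that by (intro \<Lambda>_le n(2)) simp
    qed simp
    then have "norm (\<Lambda> (cderiv (f n) 0 - cderiv g 0)) \<le> l e / 2"
      using DERIV_imp_deriv[OF dd[of 0]] by simp
    then have "Re (\<Lambda> (cderiv (f n) 0 - cderiv g 0)) \<le> l e / 2"
      using complex_Re_le_cmod order_trans by blast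
    then have 1: "l (cderiv (f n) 0) - l (cderiv g 0) \<le> l e / 2" by (simp add: \<Lambda>_def l.diff)
    have "cderiv (f n) 0 = (1 / \<eta> n) *\<^sub>R v" using f(1)[of n] by (simp flip: f(5)[of n])
    then have "l (cderiv (f n) 0) = l v / \<eta> n" by (simp add: l.scaleR)
    moreover have "l e = l v / k - l (cderiv g 0)" by (simp add: e_def l.diff l.scaleR)
    moreover have "l v * (1 / k - 1 / \<eta> n) = l v / k - l v / \<eta> n" by (simp add: right_diff_distrib)
    ultimately have "l e / 2 \<le> l v * (1 / k - 1 / \<eta> n)" using 1 by linarith
    also have "\<dots> \<le> \<bar>l v\<bar> * (1 / k - 1 / \<eta> n)"
      using k \<eta>k[of n] by (intro mult_right_mono) (auto simp: frac_le)
    also have "1 / k - 1 / \<eta> n \<le> inverse (real (Suc n)) / k\<^sup>2"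
    proof -
      have "1 / k - 1 / \<eta> n = (\<eta> n - k) / (k * \<eta> n)" using k f(1)[of n] by (simp add: field_simps)
      also have "\<dots> \<le> inverse (real (Suc n)) / (k * \<eta> n)"
        using f(2)[of n] k f(1)[of n] by (intro divide_right_mono) auto
      also have "\<dots> \<le> inverse (real (Suc n)) / k\<^sup>2"
        using k \<eta>k[of n] f(1)[of n] by (intro divide_left_mono) (auto simp: power2_eq_square)
      finally show ?thesis .
    qed
    finally have "l e / 2 \<le> \<bar>l v\<bar> * (inverse (real (Suc n)) / k\<^sup>2)" by (simp add: mult_left_mono)
    with N[OF n(1)] show False by (simp add: mult_ac)
  qed
  ultimately show ?thesis using that g(1) by (simp add: k_def)
qed

lemma kobayashi_nonneg:
  assumes "open D" "p \<in> D"
  shows "kobayashi D p w \<ge> 0"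
  unfolding kobayashi_def using kobayashi_set_nonempty[OF assms]
  by (intro cInf_greatest) auto

text \<open>The automorphism \<open>m\<close> carries 0 to \<open>a\<close> with derivative
  \<open>1 - (norm a)\<^sup>2\<close> at 0, so \<open>f\<close> composed with it competes at
  \<open>f a\<close>.\<close>

lemma kobayashi_along_disc_le:
  fixes D :: "'a::complex_normed_vector set"
  assumes f: "f \<in> hol_maps (ball 0 1) D" and k: "k > 0" and a: "norm a < 1"
  shows "kobayashi D (f a) (k *\<^sub>R cderiv f a) \<le> k / (1 - (norm a)\<^sup>2)"
proof (rule kobayashi_le)
  have q: "1 - (norm a)\<^sup>2 > 0" using a by (simp add: power_less_one_iff abs_square_less_1)
  then show "0 < k / (1 - (norm a)\<^sup>2)" using k by simp
  define m where "m = (\<lambda>t. (t + a) / (1 + cnj a * t))"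
  have m_eq: "m t = Moebius_function 0 (- a) t" for t by (simp add: m_def Moebius_function_simple)
  have m_ball: "m t \<in> ball 0 1" if "t \<in> ball 0 1" for t
    using Moebius_function_norm_lt_1[of "- a" t] a that by (simp add: m_eq)
  have "m holomorphic_on ball 0 1"
    using Moebius_function_holomorphic[of "- a" 0] a unfolding m_eq[abs_def] by simp
  then have dm: "(m has_field_derivative deriv m t) (at t)" if "t \<in> ball 0 1" for t
    using that by (intro holomorphic_derivI) auto
  have dm0: "(m has_field_derivative of_real (1 - (norm a)\<^sup>2)) (at 0)"
    unfolding m_def by (auto intro!: derivative_eq_intros simp flip: complex_norm_square)
  have der: "has_cderiv (\<lambda>t. f (m t)) (deriv m t *\<^sub>C cderiv f (m t)) t" if "t \<in> ball 0 1" for t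
    by (intro has_cderiv_compose dm hol_mapsD(1)[OF f] m_ball that)
  show "(\<lambda>t. f (m t)) \<in> hol_maps (ball 0 1) D"
    by (rule hol_mapsI[OF der]) (auto intro!: hol_mapsD(2)[OF f] m_ball simp del: mem_ball)
  show "f (m 0) = f a" by (simp add: m_def)
  have "cderiv (\<lambda>t. f (m t)) 0 = deriv m 0 *\<^sub>C cderiv f (m 0)" by (rule cderivI[OF der]) simp
  also have "deriv m 0 = of_real (1 - (norm a)\<^sup>2)" by (rule DERIV_imp_deriv[OF dm0])
  also have "m 0 = a" by (simp add: m_def)
  finally show "(k / (1 - (norm a)\<^sup>2)) *\<^sub>R cderiv (\<lambda>t. f (m t)) 0 = k *\<^sub>R cderiv f a"
    using q by (simp add: scaleC_of_real del: of_real_diff)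
qed

theorem kobayashi_laplacian_extremal:
  fixes D :: "'a::cbanach set"
  assumes D: "open D" "bounded D" "taut D" and xD: "x \<in> D" and v: "v \<noteq> 0"
  obtains g r where "r > 0" "g \<in> hol_maps (ball 0 r) D" "g 0 = x" "cderiv g 0 = v"
    "gen_laplacian (\<lambda>z. elog ((kobayashi D (g z) (cderiv g z))\<^sup>2)) 0 \<le> ereal (8 * (kobayashi D x v)\<^sup>2)"
proof -
  define k where "k = kobayashi D x v"
  have k: "k > 0" unfolding k_def by (rule kobayashi_pos[OF D(1,2) xD v])
  obtain f where f: "f \<in> hol_maps (ball 0 1) D" "f 0 = x" "k *\<^sub>R cderiv f 0 = v"
    using extremal_disc[OF D xD v] unfolding k_def by blast
  \<comment> \<open>The extremal disc has derivative \<open>v / k\<close>; the rescaling gives the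
    derivative \<open>v\<close> that the curvature prescribes.\<close>
  define g where "g = (\<lambda>z. f (of_real k * z))"
  have kz: "of_real k * z \<in> ball 0 1" if "z \<in> ball 0 (1 / k)" for z :: complex
    using that k by (simp add: norm_mult field_simps)
  have der: "has_cderiv g (of_real k *\<^sub>C cderiv f (of_real k * z)) z" if "z \<in> ball 0 (1 / k)" for z
    unfolding g_def by (intro has_cderiv_compose hol_mapsD(1)[OF f(1)] kz that) (auto intro!: derivative_eq_intros)
  have g': "cderiv g z = k *\<^sub>R cderiv f (of_real k * z)" if "z \<in> ball 0 (1 / k)" for z
    using cderivI[OF der[OF that]] by (simp add: scaleC_of_real)
  define u where "u = (\<lambda>z. elog ((kobayashi D (g z) (cderiv g z))\<^sup>2))"
  have g_in: "g \<in> hol_maps (ball 0 (1 / k)) D"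
    by (rule hol_mapsI[OF der]) (auto simp: g_def intro!: hol_mapsD(2)[OF f(1)] kz simp del: mem_ball)
  have g0: "g 0 = x" "cderiv g 0 = v" using f k g'[of 0] by (auto simp: g_def)
  have u0: "u 0 = ereal (2 * ln k)" using k by (simp add: u_def g0 elog_square flip: k_def)
  have upper: "ereal (1 / r\<^sup>2) * (circle_mean u 0 r - u 0) \<le> ereal (2 * k\<^sup>2 / (1 - (k * r)\<^sup>2))"
    if r: "0 < r" "r < 1 / k" for r
  proof -
    define q where "q = 1 - (k * r)\<^sup>2"
    have "k * r < 1" using r k by (simp add: field_simps)
    then have q: "0 < q" using r k by (simp add: q_def power_less_one_iff abs_square_less_1)
    define w where "w = 2 * ln k - 2 * ln q"
    have "u z \<le> ereal w" if z: "norm z = r" for z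
    proof -
      have zb: "z \<in> ball 0 (1 / k)" using z r by simp
      define K where "K = kobayashi D (g z) (cderiv g z)"
      have "norm (of_real k * z) < 1" using kz[OF zb] by simp
      from kobayashi_along_disc_le[OF f(1) k this] have "K \<le> k / q"
        using k z unfolding K_def g'[OF zb] by (simp add: g_def q_def norm_mult)
      moreover have "K \<ge> 0" unfolding K_def by (rule kobayashi_nonneg[OF D(1) hol_mapsD(2)[OF g_in zb]])
      \<comment> \<open>Where the metric vanishes, \<open>elog\<close> is -\<infinity> and the bound
        is trivial.\<close>
      ultimately consider "K = 0" | "0 < K" "ln K \<le> ln (k / q)" using k q by fastforce
      then show ?thesis
      proof cases
        case 1 then show ?thesis by (simp add: u_def elog_def flip: K_def)
      next
        case 2
        then show ?thesis using k q by (simp add: u_def elog_square w_def ln_div flip: K_def)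
      qed
    qed
    then have "circle_mean u 0 r \<le> circle_mean (\<lambda>_. ereal w) 0 r"
      using r by (intro circle_mean_mono) (simp add: norm_mult)
    also have "\<dots> = ereal ((2 * pi * w) / (2 * pi))"
    proof (rule circle_mean_ereal)
      show "((\<lambda>\<theta>. w) has_integral 2 * pi * w) {0..2 * pi}"
        using has_integral_const_real[of w 0 "2 * pi"] by simp
    qed simp
    finally have "circle_mean u 0 r \<le> ereal w" by simp
    then have "ereal (1 / r\<^sup>2) * (circle_mean u 0 r - u 0) \<le> ereal (1 / r\<^sup>2) * (ereal w - u 0)"
      by (intro ereal_mult_left_mono ereal_minus_mono) auto
    also have "\<dots> = ereal (2 * ln (1 / q) / r\<^sup>2)" using q by (simp add: u0 w_def ln_div)
    also have "\<dots> \<le> ereal (2 * k\<^sup>2 / q)"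
    proof -
      have "ln (1 / q) \<le> 1 / q - 1" using q by (intro ln_le_minus_one) simp
      also have "\<dots> = k\<^sup>2 * r\<^sup>2 / q" using q by (simp add: q_def field_simps power_mult_distrib)
      finally have "2 * ln (1 / q) / r\<^sup>2 \<le> 2 * (k\<^sup>2 * r\<^sup>2 / q) / r\<^sup>2" by (intro divide_right_mono) auto
      then show ?thesis using r by simp
    qed
    finally show ?thesis by (simp add: q_def)
  qed
  have lim: "((\<lambda>r. ereal (2 * k\<^sup>2 / (1 - (k * r)\<^sup>2))) \<longlongrightarrow> ereal (2 * k\<^sup>2 / (1 - (k * 0)\<^sup>2))) (at_right 0)"
    by (intro tendsto_intros) auto
  have "Liminf (at_right 0) (\<lambda>r. ereal (1 / r\<^sup>2) * (circle_mean u 0 r - u 0))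
      \<le> Liminf (at_right 0) (\<lambda>r. ereal (2 * k\<^sup>2 / (1 - (k * r)\<^sup>2)))"
  proof (rule Liminf_mono)
    have "\<forall>\<^sub>F r in at_right 0. r \<in> {0<..<1 / k}" using k by (intro eventually_at_right_real) simp
    then show "\<forall>\<^sub>F r in at_right 0. ereal (1 / r\<^sup>2) * (circle_mean u 0 r - u 0) \<le> ereal (2 * k\<^sup>2 / (1 - (k * r)\<^sup>2))"
      by eventually_elim (auto intro!: upper)
  qed
  also have "\<dots> = ereal (2 * k\<^sup>2)" using lim_imp_Liminf[OF _ lim] by simp
  finally have "gen_laplacian u 0 \<le> 4 * ereal (2 * k\<^sup>2)"
    unfolding gen_laplacian_def by (intro ereal_mult_left_mono) auto
  then show ?thesis
    using k by (intro that[of "1 / k" g] g_in g0) (simp_all add: u_def k_def)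
qed

theorem proposition6p7:
  fixes D :: "'a::cbanach set" and x v :: 'a
  assumes "open D" and "connected D" and "D \<noteq> {}"
    and "bounded D" and "convex D" and "taut D"
    and "x \<in> D" and "v \<noteq> 0"
  shows "kobayashi_curvature D x v = -4"
proof -
  define k where "k = kobayashi D x v"
  have k: "k > 0" unfolding k_def using assms by (intro kobayashi_pos)
  have quot: "ereal (8 * k\<^sup>2) / ereal (- 2 * k\<^sup>2) = -4" using k by simp
  show ?thesis
    unfolding kobayashi_curvature_def
  proof (rule antisym)
    show "Sup {gen_laplacian (\<lambda>z. elog ((kobayashi D (f z) (cderiv f z))\<^sup>2)) 0
            / ereal (- 2 * (kobayashi D (f 0) (cderiv f 0))\<^sup>2) | f r.
          r > 0 \<and> f \<in> hol_maps (ball 0 r) D \<and> f 0 = x \<and> cderiv f 0 = v} \<le> -4"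
    proof (rule Sup_least, safe)
      fix f r assume f: "r > 0" "f \<in> hol_maps (ball 0 r) D" "x = f 0" "v = cderiv f 0"
      define lap where "lap = gen_laplacian (\<lambda>z. elog ((kobayashi D (f z) (cderiv f z))\<^sup>2)) 0"
      have "ereal (8 * k\<^sup>2) \<le> lap"
        unfolding k_def lap_def using assms f by (intro kobayashi_laplacian_lower) auto
      \<comment> \<open>Division by a negative number reverses the inequality; an infinite Laplacian
        gives -\<infinity>.\<close>
      then have "lap / ereal (- 2 * k\<^sup>2) \<le> -4" using k by (cases lap) (auto simp: field_simps)
      then show "gen_laplacian (\<lambda>z. elog ((kobayashi D (f z) (cderiv f z))\<^sup>2)) 0
          / ereal (- 2 * (kobayashi D (f 0) (cderiv f 0))\<^sup>2) \<le> -4"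
        unfolding lap_def k_def f(3,4) .
    qed
    obtain g r where g: "r > 0" "g \<in> hol_maps (ball 0 r) D" "g 0 = x" "cderiv g 0 = v"
      "gen_laplacian (\<lambda>z. elog ((kobayashi D (g z) (cderiv g z))\<^sup>2)) 0 \<le> ereal (8 * k\<^sup>2)"
      using kobayashi_laplacian_extremal[OF assms(1,4,6,7,8)] unfolding k_def by blast
    have "ereal (8 * k\<^sup>2) \<le> gen_laplacian (\<lambda>z. elog ((kobayashi D (g z) (cderiv g z))\<^sup>2)) 0"
      unfolding k_def by (rule kobayashi_laplacian_lower[OF assms(1,5,4,7,8) g(2,1,3,4)])
    with g(5) have "gen_laplacian (\<lambda>z. elog ((kobayashi D (g z) (cderiv g z))\<^sup>2)) 0
        / ereal (- 2 * (kobayashi D (g 0) (cderiv g 0))\<^sup>2) = -4"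
      unfolding g(3,4) k_def[symmetric] quot[symmetric] by simp
    then show "-4 \<le> Sup {gen_laplacian (\<lambda>z. elog ((kobayashi D (f z) (cderiv f z))\<^sup>2)) 0
            / ereal (- 2 * (kobayashi D (f 0) (cderiv f 0))\<^sup>2) | f r.
          r > 0 \<and> f \<in> hol_maps (ball 0 r) D \<and> f 0 = x \<and> cderiv f 0 = v}"
      using g(1-4) by (intro Sup_upper) (metis (mono_tags, lifting) mem_Collect_eq)
  qed
qed

end
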